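(* Let $\mathcal{G}$ be a noncompact locally compact Hausdorff group with left Haar measure $\mu$, let $\pi$ be an irreducible, strongly continuous, square-integrable projective unitary representation of $\mathcal{G}$ on an infinite-dimensional Hilbert space $\mathcal{H}$, and let $\psi\in\mathcal{H}$ be an admissible wavelet, with $\mu$ normalized so that $c_\psi=1$. Assume that for every measurable $\Omega\subset\mathcal{G}$ with $\mu(\Omega)>0$, $$\int_\Omega|W_\psi f(x)|^2\,d\mu(x)>0\qquad\text{for all }f\in\mathcal{H}\setminus\{0\}.$$ Let $K\geq 1$ be an integer and $s>0$. Then the supremum $$\sup\left\{\sum_{k=1}^{K}\lambda_k(\Omega)\;:\;\Omega\subset\mathcal{G}\text{ measurable},\ \mu(\Omega)=s\right\}$$ is attained.
   Context: A projective unitary representation $\pi:\mathcal{G}\to\mathcal{U}(\mathcal{H})$ satisfies $\pi(xy)=\omega(x,y)\pi(x)\pi(y)$ for $x,y\in\mathcal{G}$, where $\omega:\mathcal{G}\times\mathcal{G}\to U(1)$ is a continuous phase factor; $\mathcal{H}$ is a complex Hilbert space. Strong continuity means that $x\mapsto\pi(x)\varphi\in\mathcal{H}$ is continuous for every $\varphi\in\mathcal{H}$. The representation is square-integrable if there is $\psi\in\mathcal{H}\setminus\{0\}$ such that $c_\psi=\int_{\mathcal{G}}|\langle\psi,\pi(x)\psi\rangle|^2\,d\mu(x)<\infty$; any $\psi$ with $\|\psi\|=1$ and $c_\psi<\infty$ is called an admissible wavelet, and the left Haar measure $\mu$ is rescaled so that $c_\psi=1$. The wavelet transform of $f\in\mathcal{H}$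 is $W_\psi f(x)=\langle f,\pi(x)\psi\rangle$, $x\in\mathcal{G}$; with this normalization $W_\psi$ is an isometry from $\mathcal{H}$ into $L^2(\mathcal{G},\mu)$. For measurable $\Omega\subset\mathcal{G}$ the localization operator $T_\Omega:\mathcal{H}\to\mathcal{H}$ is defined weakly by $\langle T_\Omega f,g\rangle=\int_\Omega W_\psi f(x)\overline{W_\psi g(x)}\,d\mu(x)$ for $f,g\in\mathcal{H}$. If $\mu(\Omega)<\infty$, $T_\Omega$ is nonnegative and compact, and $\lambda_1(\Omega)\geq\lambda_2(\Omega)\geq\cdots$ denote its eigenvalues in nonincreasing order, counted with multiplicity. *)

theory Defs
  imports "HOL-Analysis.Analysis"
begin

section \<open>Complex Hilbert spaces\<close>

text \<open>The complex inner product is linear in its first argument. The underlying real Hilbert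
  space structure (and hence norm and topology) is the one given by its real part.\<close>

class complex_hilbert_space = real_inner + complete_space +
  fixes scaleC :: "complex \<Rightarrow> 'a \<Rightarrow> 'a" (infixr \<open>*\<^sub>C\<close> 75)
    and cinner :: "'a \<Rightarrow> 'a \<Rightarrow> complex"
  assumes scaleC_add_right: "a *\<^sub>C (x + y) = a *\<^sub>C x + a *\<^sub>C y"
    and scaleC_add_left: "(a + b) *\<^sub>C x = a *\<^sub>C x + b *\<^sub>C x"
    and scaleC_scaleC: "a *\<^sub>C (b *\<^sub>C x) = (a * b) *\<^sub>C x"
    and scaleC_of_real: "complex_of_real r *\<^sub>C x = r *\<^sub>R x"
    and cinner_commute: "cinner x y = cnj (cinner y x)"
    and cinner_add_left: "cinner (x + y) z = cinner x z + cinner y z"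
    and cinner_scaleC_left: "cinner (a *\<^sub>C x) y = a * cinner x y"
    and inner_eq_Re_cinner: "inner x y = Re (cinner x y)"

global_interpretation complex_vector:
  vector_space "scaleC :: complex \<Rightarrow> 'a \<Rightarrow> 'a::complex_hilbert_space"
proof
  fix x :: 'a
  show "1 *\<^sub>C x = x"
    using scaleC_of_real[of 1 x] by simp
qed (simp_all add: scaleC_add_right scaleC_add_left scaleC_scaleC)

definition unitary_op :: "('h::complex_hilbert_space \<Rightarrow> 'h) \<Rightarrow> bool" where
  "unitary_op U \<longleftrightarrow>
     (\<forall>v w. U (v + w) = U v + U w) \<and> (\<forall>a v. U (a *\<^sub>C v) = a *\<^sub>C U v) \<and>
     (\<forall>v w. cinner (U v) (U w) = cinner v w) \<and> surj U"

definition infinite_dimensional :: "'h::complex_hilbert_space itself \<Rightarrow> bool" where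
  "infinite_dimensional _ \<longleftrightarrow> \<not> (\<exists>B :: 'h set. finite B \<and> complex_vector.span B = UNIV)"


section \<open>Haar measure and projective representations\<close>

text \<open>The group is a type of class \<^class>\<open>topological_group_add\<close>. This class does not
  assume commutativity: the group operation is merely written additively.\<close>

definition left_haar_measure :: "'g::{topological_group_add, t2_space} measure \<Rightarrow> bool" where
  "left_haar_measure M \<longleftrightarrow>
     sets M = sets borel \<and>
     emeasure M UNIV \<noteq> 0 \<and>
     (\<forall>x. \<forall>A\<in>sets borel. emeasure M ((\<lambda>y. x + y) ` A) = emeasure M A) \<and>
     (\<forall>C. compact C \<longrightarrow> emeasure M C < \<infinity>) \<and>
     (\<forall>A\<in>sets borel. emeasure M A = (INF U\<in>{U. open U \<and> A \<subseteq> U}. emeasure M U)) \<and>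
     (\<forall>U. open U \<longrightarrow> emeasure M U = (SUP C\<in>{C. compact C \<and> C \<subseteq> U}. emeasure M C))"

definition projective_unitary_rep ::
  "('g::topological_group_add \<Rightarrow> 'g \<Rightarrow> complex) \<Rightarrow> ('g \<Rightarrow> 'h::complex_hilbert_space \<Rightarrow> 'h) \<Rightarrow> bool"
  where
  "projective_unitary_rep \<omega> \<pi> \<longleftrightarrow>
     continuous_on UNIV (\<lambda>(x, y). \<omega> x y) \<and>
     (\<forall>x y. cmod (\<omega> x y) = 1) \<and>
     (\<forall>x. unitary_op (\<pi> x)) \<and>
     (\<forall>x y v. \<pi> (x + y) v = \<omega> x y *\<^sub>C \<pi> x (\<pi> y v))"

definition strongly_continuous_rep ::
  "('g::topological_group_add \<Rightarrow> 'h::complex_hilbert_space \<Rightarrow> 'h) \<Rightarrow> bool" where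
  "strongly_continuous_rep \<pi> \<longleftrightarrow> (\<forall>v. continuous_on UNIV (\<lambda>x. \<pi> x v))"

definition irreducible_rep :: "('g \<Rightarrow> 'h::complex_hilbert_space \<Rightarrow> 'h) \<Rightarrow> bool" where
  "irreducible_rep \<pi> \<longleftrightarrow>
     (UNIV :: 'h set) \<noteq> {0} \<and>
     (\<forall>S. complex_vector.subspace S \<and> closed S \<and> (\<forall>x. \<pi> x ` S \<subseteq> S) \<longrightarrow> S = {0} \<or> S = UNIV)"


section \<open>Wavelet transform and localization operators\<close>

definition wavelet_transform ::
  "('g \<Rightarrow> 'h::complex_hilbert_space \<Rightarrow> 'h) \<Rightarrow> 'h \<Rightarrow> 'h \<Rightarrow> 'g \<Rightarrow> complex" where
  "wavelet_transform \<pi> \<psi> f x = cinner f (\<pi> x \<psi>)"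

definition wavelet_constant ::
  "'g measure \<Rightarrow> ('g \<Rightarrow> 'h::complex_hilbert_space \<Rightarrow> 'h) \<Rightarrow> 'h \<Rightarrow> ennreal" where
  "wavelet_constant M \<pi> \<psi> = (\<integral>\<^sup>+ x. ennreal ((cmod (cinner \<psi> (\<pi> x \<psi>)))\<^sup>2) \<partial>M)"

definition square_integrable_rep ::
  "'g measure \<Rightarrow> ('g \<Rightarrow> 'h::complex_hilbert_space \<Rightarrow> 'h) \<Rightarrow> bool" where
  "square_integrable_rep M \<pi> \<longleftrightarrow> (\<exists>\<psi>. \<psi> \<noteq> 0 \<and> wavelet_constant M \<pi> \<psi> < \<infinity>)"

definition admissible_wavelet ::
  "'g measure \<Rightarrow> ('g \<Rightarrow> 'h::complex_hilbert_space \<Rightarrow> 'h) \<Rightarrow> 'h \<Rightarrow> bool" where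
  "admissible_wavelet M \<pi> \<psi> \<longleftrightarrow> norm \<psi> = 1 \<and> wavelet_constant M \<pi> \<psi> < \<infinity>"

definition localization_op ::
  "'g measure \<Rightarrow> ('g \<Rightarrow> 'h::complex_hilbert_space \<Rightarrow> 'h) \<Rightarrow> 'h \<Rightarrow> 'g set \<Rightarrow> 'h \<Rightarrow> 'h" where
  "localization_op M \<pi> \<psi> \<Omega> = (THE T. \<forall>f g. cinner (T f) g =
     (LINT x:\<Omega>|M. wavelet_transform \<pi> \<psi> f x * cnj (wavelet_transform \<pi> \<psi> g x)))"


section \<open>Eigenvalues in nonincreasing order\<close>

definition eigenspace :: "('h::complex_hilbert_space \<Rightarrow> 'h) \<Rightarrow> real \<Rightarrow> 'h set" where
  "eigenspace T t = {v. T v = complex_of_real t *\<^sub>C v}"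

text \<open>Meant for nonnegative compact operators on an infinite-dimensional space. Such an operator
  has real eigenvalues \<open>\<ge> 0\<close>, and those that are positive have finite multiplicity. The sequence
  lists each positive eigenvalue as often as its multiplicity; if there are only finitely many of
  them, the list is continued by the eigenvalue 0. The finiteness condition is needed because
  \<^const>\<open>card\<close> is 0 on infinite sets.\<close>

definition eigenvalue_sequence :: "('h::complex_hilbert_space \<Rightarrow> 'h) \<Rightarrow> (nat \<Rightarrow> real) \<Rightarrow> bool" where
  "eigenvalue_sequence T l \<longleftrightarrow>
     decseq l \<and> (\<forall>k. 0 \<le> l k) \<and>
     (\<forall>t>0. finite {k. l k = t} \<and> card {k. l k = t} = complex_vector.dim (eigenspace T t))"

text \<open>Sequences are indexed from 0, eigenvalues from 1.\<close>

definition nth_eigenvalue :: "('h::complex_hilbert_space \<Rightarrow> 'h) \<Rightarrow> nat \<Rightarrow> real" where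
  "nth_eigenvalue T k = (THE l. eigenvalue_sequence T l) (k - 1)"

definition loc_eigenvalue ::
  "'g measure \<Rightarrow> ('g \<Rightarrow> 'h::complex_hilbert_space \<Rightarrow> 'h) \<Rightarrow> 'h \<Rightarrow> 'g set \<Rightarrow> nat \<Rightarrow> real" where
  "loc_eigenvalue M \<pi> \<psi> \<Omega> k = nth_eigenvalue (localization_op M \<pi> \<psi> \<Omega>) k"

end

theory Submission
  imports Defs
begin

text \<open>
  Write \<open>S K \<Omega>\<close> for the sum of the first \<open>K\<close> eigenvalues. A maximising sequence \<open>\<Omega> n\<close> is translated
  so that the top eigenvector of its operator does not vanish weakly, and the operators converge
  weakly, along a filter, to an operator \<open>T\<close>. The part of the mass of \<open>\<Omega> n\<close> that stays near compact
  sets converges to some \<open>s1\<close>. A finite-rank projection that almost fixes a compact piece of the orbit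
  of \<open>\<psi>\<close> decouples this part from the rest, so that \<open>sup S K\<close> is at most the sum of the first \<open>k\<close>
  eigenvalues of \<open>T\<close> plus the optimal value for \<open>K - k\<close> eigenvalues and mass \<open>s - s1\<close>, where \<open>k \<ge> 1\<close>
  because \<open>T\<close> inherits the top eigenvalue. By the bathtub principle the first term is at most
  \<open>S k \<Omega>1\<close> for a superlevel set \<open>\<Omega>1\<close> of measure \<open>s1\<close>; the second term is attained by induction on \<open>K\<close>.
  Both sets are relatively compact: transforms vanish at infinity, and by the positivity assumption
  together with \<open>\<mu>(G) = \<infinity>\<close> the superlevel heights are positive. So one of them can be translated off
  the other, and the union does at least as well, because \<open>T\<^bsub>A \<union> B\<^esub> = T\<^bsub>A\<^esub> + T\<^bsub>B\<^esub>\<close> dominates the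
  corresponding spectral truncations, whose sum has rank at most \<open>K\<close>.
\<close>

section \<open>Complex inner products\<close>

text \<open>Neither the group nor the Hilbert space is assumed separable, so weak limits are taken
  along filters obtained from Tychonoff's theorem rather than along subsequences. Compactness does
  not survive weak limits of operators, but a bound on all partial traces does; hence the spectral
  theory rests on such bounds. The obstacle is that pieces of \<open>\<Omega> n\<close> may drift to
  infinity and leave no trace in the weak limit. The escaping part is not tracked but estimated by
  the optimum for fewer eigenvalues; the induction descends only if \<open>k \<ge> 1\<close>, and
  this is what centring the top eigenvector buys. Splitting an optimal family into projections and
  complements destroys orthonormality, but the pieces remain Bessel families whose traces add up to
  \<open>K\<close>; Ky Fan's inequality is proved in that generality. The mass outside a compact set
  is only close to \<open>s - s1\<close>, so optimality is taken among sets of at most the given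
  measure, and densities bounded by 1 make the optimum 1-Lipschitz in the mass. Positivity has a
  second use: it rules out atoms, so that level sets can be cut to exact measure.\<close>

lemma cinner_add_right: "cinner x (y + z) = cinner x y + cinner x (z::'h::complex_hilbert_space)"
  by (subst (1 2 3) cinner_commute) (simp add: cinner_add_left)

lemma cinner_scaleC_right: "cinner x (a *\<^sub>C y) = cnj a * cinner x (y::'h::complex_hilbert_space)"
  by (subst (1 2) cinner_commute) (simp add: cinner_scaleC_left)

lemma cinner_zero_left [simp]: "cinner 0 (y::'h::complex_hilbert_space) = 0"
  using cinner_add_left[of 0 0 y] by simp

lemma cinner_zero_right [simp]: "cinner (y::'h::complex_hilbert_space) 0 = 0"
  using cinner_add_right[of y 0 0] by simp

lemma cinner_minus_left [simp]: "cinner (- x) (y::'h::complex_hilbert_space) = - cinner x y"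
  using cinner_add_left[of x "- x" y] by (simp add: add_eq_0_iff)

lemma cinner_minus_right [simp]: "cinner x (- y::'h::complex_hilbert_space) = - cinner x y"
  using cinner_add_right[of x y "- y"] by (simp add: add_eq_0_iff)

lemma cinner_diff_left: "cinner (x - y) (z::'h::complex_hilbert_space) = cinner x z - cinner y z"
  using cinner_add_left[of x "- y" z] by simp

lemma cinner_diff_right: "cinner z (x - y::'h::complex_hilbert_space) = cinner z x - cinner z y"
  using cinner_add_right[of z x "- y"] by simp

lemma cinner_sum_left: "cinner (\<Sum>i\<in>I. f i) (z::'h::complex_hilbert_space) = (\<Sum>i\<in>I. cinner (f i) z)"
  by (induction I rule: infinite_finite_induct) (simp_all add: cinner_add_left)

lemma cinner_sum_right: "cinner z (\<Sum>i\<in>I. f i::'h::complex_hilbert_space) = (\<Sum>i\<in>I. cinner z (f i))"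
  by (induction I rule: infinite_finite_induct) (simp_all add: cinner_add_right)

lemma cinner_self: "cinner x x = complex_of_real ((norm (x::'h::complex_hilbert_space))\<^sup>2)"
proof -
  have "Im (cinner x x) = 0"
    using cinner_commute[of x x] by (metis cnj.simps(2) neg_equal_zero)
  then show ?thesis
    by (simp add: complex_eq_iff inner_eq_Re_cinner[symmetric] power2_norm_eq_inner)
qed

lemma cinner_ext: "(\<And>g. cinner x g = cinner y g) \<Longrightarrow> x = (y::'h::complex_hilbert_space)"
  using cinner_self[of "x - y"] by (simp add: cinner_diff_left)

lemma norm_scaleC: "norm (a *\<^sub>C (x::'h::complex_hilbert_space)) = cmod a * norm x"
proof -
  have "complex_of_real ((norm (a *\<^sub>C x))\<^sup>2) = (a * cnj a) * cinner x x"
    by (simp add: cinner_self[symmetric] cinner_scaleC_left cinner_scaleC_right del: of_real_power)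
  also have "\<dots> = complex_of_real ((cmod a * norm x)\<^sup>2)"
    by (simp only: cinner_self complex_norm_square[symmetric] of_real_mult[symmetric] power_mult_distrib)
  finally show ?thesis
    by (simp only: of_real_eq_iff power2_eq_iff_nonneg norm_ge_zero mult_nonneg_nonneg)
qed

lemma cinner_Cauchy_Schwarz: "cmod (cinner x y) \<le> norm x * norm (y::'h::complex_hilbert_space)"
proof -
  obtain a where a: "cmod a = 1" "a * cinner x y = complex_of_real (cmod (cinner x y))"
  proof (cases "cinner x y = 0")
    case True
    then show ?thesis using that[of 1] by simp
  next
    case False
    show ?thesis
    proof (rule that)
      show "cmod (cnj (cinner x y) / cmod (cinner x y)) = 1"
        using False by (simp add: norm_divide)
      show "cnj (cinner x y) / complex_of_real (cmod (cinner x y)) * cinner x y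
          = complex_of_real (cmod (cinner x y))"
        using False by (simp add: complex_norm_square[symmetric] power2_eq_square mult.commute
            divide_simps)
    qed
  qed
  have "cmod (cinner x y) = inner (a *\<^sub>C x) y"
    by (simp add: inner_eq_Re_cinner cinner_scaleC_left a)
  also have "\<dots> \<le> norm (a *\<^sub>C x) * norm y"
    by (rule norm_cauchy_schwarz)
  finally show ?thesis
    by (simp add: norm_scaleC a)
qed

lemma bounded_linear_cinner_right: "bounded_linear (\<lambda>y. cinner (x::'h::complex_hilbert_space) y)"
proof (rule bounded_linear_intro[where K = "norm x"])
  show "cinner x (r *\<^sub>R y) = r *\<^sub>R cinner x y" for r y
    by (simp add: scaleC_of_real[symmetric] cinner_scaleC_right scaleR_conv_of_real)
qed (use cinner_Cauchy_Schwarz[of x] in \<open>simp_all add: cinner_add_right mult.commute\<close>)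

lemma norm_add_sq:
  "(norm (x + y))\<^sup>2 = (norm x)\<^sup>2 + 2 * Re (cinner x y) + (norm (y::'h::complex_hilbert_space))\<^sup>2"
  unfolding power2_norm_eq_inner
  by (simp add: inner_simps inner_commute inner_eq_Re_cinner[symmetric])

text \<open>The Riesz vector is the minimiser of \<open>\<parallel>v\<parallel>\<^sup>2 / 2 - Re (\<phi> v)\<close>; the parallelogram law makes
  minimising sequences Cauchy.\<close>

lemma Riesz_real:
  fixes \<phi> :: "'a::{real_inner, complete_space} \<Rightarrow> real"
  assumes lin: "\<And>x y. \<phi> (x + y) = \<phi> x + \<phi> y" "\<And>r x. \<phi> (r *\<^sub>R x) = r * \<phi> x"
    and bnd: "\<And>x. \<bar>\<phi> x\<bar> \<le> c * norm x"
  shows "\<exists>w. \<forall>x. \<phi> x = inner x w"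
proof -
  define J where "J v = (norm v)\<^sup>2 / 2 - \<phi> v" for v
  have Jge: "- c\<^sup>2 / 2 \<le> J v" for v
  proof -
    have "0 \<le> (norm v - c)\<^sup>2" by simp
    then show ?thesis using bnd[of v] unfolding J_def power2_diff by (simp add: field_simps abs_le_iff)
  qed
  have bdd: "bdd_below (range J)"
    using Jge by (auto intro!: bdd_belowI)
  define m where "m = (INF v. J v)"
  have mle: "m \<le> J v" for v
    unfolding m_def by (rule cINF_lower[OF bdd]) simp
  have "\<exists>v. J v < m + 1 / Suc n" for n
    using cINF_less_iff[OF _ bdd, of "m + 1 / Suc n"] unfolding m_def by auto
  then obtain v where v: "\<And>n. J (v n) < m + 1 / Suc n" by metis
  have half: "\<phi> ((1/2) *\<^sub>R x) = \<phi> x / 2" for x by (simp add: lin)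
  have par: "(norm (x - y))\<^sup>2 = 4 * (J x + J y - 2 * J ((1/2) *\<^sub>R (x + y)))" for x y
    unfolding J_def half lin(1)
    by (simp add: power2_norm_eq_inner inner_simps inner_commute field_simps)
  have dle: "(norm (v i - v j))\<^sup>2 < 4 * (1 / Suc i + 1 / Suc j)" for i j
    unfolding par using v[of i] v[of j] mle[of "(1/2) *\<^sub>R (v i + v j)"] by simp
  have "Cauchy v"
  proof (rule metric_CauchyI)
    fix e :: real assume e: "e > 0"
    then obtain N where N: "1 / Suc N < e\<^sup>2 / 8"
      using reals_Archimedean[of "e\<^sup>2 / 8"] by (auto simp: field_simps)
    have "dist (v i) (v j) < e" if "i \<ge> N" "j \<ge> N" for i j
    proof -
      have "1 / real (Suc i) \<le> 1 / Suc N" "1 / real (Suc j) \<le> 1 / Suc N"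
        using that by (auto simp: frac_le)
      then have "(norm (v i - v j))\<^sup>2 < e\<^sup>2"
        using dle[of i j] N by simp
      then show ?thesis
        using e by (simp add: dist_norm power2_less_imp_less)
    qed
    then show "\<exists>N. \<forall>i\<ge>N. \<forall>j\<ge>N. dist (v i) (v j) < e" by blast
  qed
  then obtain w where w: "v \<longlonglongrightarrow> w"
    using Cauchy_convergent convergent_def by blast
  have blphi: "bounded_linear \<phi>"
    by (rule bounded_linear_intro[where K = c]) (use lin bnd in \<open>simp_all add: mult.commute\<close>)
  have "(\<lambda>n. J (v n)) \<longlonglongrightarrow> J w"
    unfolding J_def by (intro tendsto_intros w bounded_linear.tendsto[OF blphi]) auto
  moreover have "(\<lambda>n. m + 1 / Suc n) \<longlonglongrightarrow> m + 0"
    by (intro tendsto_intros LIMSEQ_Suc lim_1_over_n)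
  ultimately have Jw: "J w \<le> m"
    using v by (metis (no_types, lifting) LIMSEQ_le add.right_neutral less_imp_le)
  have "\<phi> x = inner x w" for x
  proof -
    define a where "a = inner x w - \<phi> x"
    have key: "0 \<le> t * a + t\<^sup>2 * (norm x)\<^sup>2 / 2" for t
    proof -
      have "J (w + t *\<^sub>R x) = J w + (t * a + t\<^sup>2 * (norm x)\<^sup>2 / 2)"
        unfolding J_def a_def power2_norm_eq_inner
        by (simp add: lin inner_simps inner_commute algebra_simps power2_eq_square
            add_divide_distrib)
      then show ?thesis using mle[of "w + t *\<^sub>R x"] Jw by linarith
    qed
    have "a = 0"
    proof (rule ccontr)
      assume a0: "a \<noteq> 0"
      \<comment> \<open>\<open>a\<close> is the derivative of \<open>J\<close> at \<open>w\<close>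
        in direction \<open>x\<close>. The step \<open>- a / N\<close> goes downhill, and the added
        1 keeps \<open>N\<close> positive when \<open>x\<close> is 0.\<close>
      define N where "N = (norm x)\<^sup>2 + 1"
      have N: "N > 0" "(norm x)\<^sup>2 < N" by (simp_all add: N_def add_nonneg_pos)
      have "0 \<le> (- a / N) * a + (- a / N)\<^sup>2 * (norm x)\<^sup>2 / 2" by (rule key)
      also have "\<dots> \<le> (- a / N) * a + (- a / N)\<^sup>2 * N / 2"
        using N by (intro add_left_mono divide_right_mono mult_left_mono) auto
      also have "\<dots> = - (a\<^sup>2 / N) / 2"
        using N by (simp add: field_simps power2_eq_square)
      finally show False using a0 N by (simp add: field_simps)
    qed
    then show ?thesis by (simp add: a_def)
  qed
  then show ?thesis by blast
qed

text \<open>The real part determines a complex linear functional, since its imaginary part at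
  \<open>x\<close> is minus the real part at \<open>\<i> *\<^sub>C x\<close>; so the real Riesz
  vector already represents \<open>\<phi>\<close>.\<close>

lemma Riesz:
  fixes \<phi> :: "'h::complex_hilbert_space \<Rightarrow> complex"
  assumes lin: "\<And>x y. \<phi> (x + y) = \<phi> x + \<phi> y" "\<And>a x. \<phi> (a *\<^sub>C x) = a * \<phi> x"
    and bnd: "\<And>x. cmod (\<phi> x) \<le> c * norm x"
  shows "\<exists>w. \<forall>x. \<phi> x = cinner x w"
proof -
  have "\<exists>w. \<forall>x. Re (\<phi> x) = inner x w"
  proof (rule Riesz_real)
    show "Re (\<phi> (r *\<^sub>R x)) = r * Re (\<phi> x)" for r x
      by (simp add: scaleC_of_real[symmetric] lin)
    show "\<bar>Re (\<phi> x)\<bar> \<le> c * norm x" for x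
      using abs_Re_le_cmod bnd order_trans by blast
  qed (simp add: lin)
  then obtain w where w: "\<And>x. Re (\<phi> x) = Re (cinner x w)"
    by (auto simp: inner_eq_Re_cinner)
  have "\<phi> x = cinner x w" for x
    using w[of x] w[of "\<i> *\<^sub>C x"] by (simp add: complex_eq_iff lin cinner_scaleC_left)
  then show ?thesis by blast
qed

text \<open>Riesz is applied in the first slot, and hermitian symmetry moves the representing vector
  to the left. This yields both the localization operators and their weak limit.\<close>

lemma bounded_sesquilinear_operator:
  fixes B :: "'h::complex_hilbert_space \<Rightarrow> 'h \<Rightarrow> complex"
  assumes lin: "\<And>x y g. B (x + y) g = B x g + B y g" "\<And>a x g. B (a *\<^sub>C x) g = a * B x g"
    and sym: "\<And>f g. B f g = cnj (B g f)"
    and bnd: "\<And>f g. cmod (B f g) \<le> c * norm f * norm g"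
  obtains T where "\<And>f g. cinner (T f) g = B f g"
proof -
  have "\<exists>w. \<forall>x. B x f = cinner x w" for f
    by (rule Riesz[where c = "c * norm f"]) (use lin bnd in \<open>simp_all add: mult_ac\<close>)
  then obtain T where T: "\<And>f x. B x f = cinner x (T f)" by metis
  have "cinner (T f) g = B f g" for f g
    using T[of g f] sym[of f g] cinner_commute[of "T f" g] by simp
  then show ?thesis by (rule that)
qed

section \<open>Orthonormal families\<close>

text \<open>Finite families are initial segments of sequences, so that one sequence of eigenvectors
  provides a family of every length.\<close>

definition orthonormal :: "nat \<Rightarrow> (nat \<Rightarrow> 'h::complex_hilbert_space) \<Rightarrow> bool" where
  "orthonormal N e \<longleftrightarrow> (\<forall>i<N. \<forall>j<N. cinner (e i) (e j) = (if i = j then 1 else 0))"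

definition proj :: "nat \<Rightarrow> (nat \<Rightarrow> 'h::complex_hilbert_space) \<Rightarrow> 'h \<Rightarrow> 'h" where
  "proj N e v = (\<Sum>i<N. cinner v (e i) *\<^sub>C e i)"

lemma cinner_self_eq_1: "cinner x x = 1 \<longleftrightarrow> norm (x::'h::complex_hilbert_space) = 1"
  by (simp add: cinner_self power2_eq_1_iff del: of_real_power)
    (use norm_ge_zero[of x] in linarith)

lemma orthonormal_norm: "orthonormal N e \<Longrightarrow> i < N \<Longrightarrow> norm (e i) = 1"
  by (simp add: orthonormal_def flip: cinner_self_eq_1)

lemma orthonormal_Suc:
  assumes "orthonormal n e" "norm (e n) = 1" "\<And>i. i < n \<Longrightarrow> cinner (e n) (e i) = 0"
  shows "orthonormal (Suc n) e"
proof -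
  have "cinner (e i) (e n) = 0" if "i < n" for i
    using assms(3)[OF that] cinner_commute[of "e i" "e n"] by simp
  then show ?thesis
    using assms cinner_self_eq_1[of "e n"] by (auto simp: orthonormal_def less_Suc_eq)
qed

lemma sum_if_lessThan:
  "(\<Sum>i<N::nat. if i = j then c i else 0) = (if j < N then c j else (0::'a::comm_monoid_add))"
  by (simp add: sum.delta)

lemma cinner_proj_basis:
  assumes "orthonormal N e" "j < N"
  shows "cinner (proj N e v) (e j) = cinner v (e j)"
proof -
  have "cinner (proj N e v) (e j) = (\<Sum>i<N. if i = j then cinner v (e i) else 0)"
    unfolding proj_def cinner_sum_left
    by (rule sum.cong) (use assms in \<open>auto simp: orthonormal_def cinner_scaleC_left\<close>)
  then show ?thesis using assms by (simp add: sum_if_lessThan)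
qed

lemma proj_diff: "proj N e (v - w) = proj N e v - proj N e w"
  by (simp add: proj_def cinner_diff_left complex_vector.scale_left_diff_distrib sum_subtractf)

lemma cinner_proj: "cinner (proj N e v) w = (\<Sum>i<N. cinner v (e i) * cnj (cinner w (e i)))"
  by (simp add: proj_def cinner_sum_left cinner_scaleC_left cinner_commute[of "e _" w])

lemma cinner_proj_right: "cinner w (proj N e v) = cinner (proj N e w) v"
  by (subst cinner_commute) (simp add: cinner_proj cinner_sum_left mult.commute)

lemma cinner_proj_self:
  "cinner (proj N e v) v = complex_of_real (\<Sum>i<N. (cmod (cinner v (e i)))\<^sup>2)"
  by (simp add: cinner_proj complex_norm_square del: of_real_power)

lemma proj_idem:
  assumes "orthonormal N e" shows "proj N e (proj N e v) = proj N e v"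
  unfolding proj_def[of N e "proj N e v"] proj_def[of N e v, symmetric]
  by (simp add: cinner_proj_basis[OF assms] flip: proj_def)

lemma norm_proj_sq:
  assumes "orthonormal N e"
  shows "(norm (proj N e v))\<^sup>2 = (\<Sum>i<N. (cmod (cinner v (e i)))\<^sup>2)"
proof -
  have "cinner (proj N e v) (proj N e v) = cinner (proj N e v) v"
    by (simp add: cinner_proj_right proj_idem[OF assms])
  then show ?thesis
    unfolding cinner_self cinner_proj_self of_real_eq_iff .
qed

lemma cinner_proj_compl:
  assumes "orthonormal N e" shows "cinner (proj N e v) (w - proj N e w) = 0"
  by (simp add: cinner_diff_right cinner_proj_right proj_idem[OF assms])

lemma Pythagoras_proj:
  assumes "orthonormal N e"
  shows "(norm v)\<^sup>2 = (norm (proj N e v))\<^sup>2 + (norm (v - proj N e v))\<^sup>2"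
  using norm_add_sq[of "proj N e v" "v - proj N e v"] by (simp add: cinner_proj_compl[OF assms])

lemma Bessel:
  assumes "orthonormal N e" shows "(\<Sum>i<N. (cmod (cinner v (e i)))\<^sup>2) \<le> (norm v)\<^sup>2"
  using Pythagoras_proj[OF assms, of v] norm_proj_sq[OF assms, of v] by simp

lemma norm_proj_le:
  assumes "orthonormal N e" shows "norm (proj N e v) \<le> norm v"
  using Pythagoras_proj[OF assms, of v] by (simp add: power2_le_imp_le)

lemma norm_proj_compl_le:
  assumes "orthonormal N e" shows "norm (v - proj N e v) \<le> norm v"
  using Pythagoras_proj[OF assms, of v] by (simp add: power2_le_imp_le)

lemma proj_compl_orth:
  assumes "orthonormal N e" "j < N" shows "cinner (v - proj N e v) (e j) = 0"
  by (simp add: cinner_diff_left cinner_proj_basis[OF assms])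

text \<open>Infinite dimension enters here: a finite orthonormal family never spans, so it can
  always be lengthened. Spectral sequences, the padding in Gram-Schmidt and the absence of atoms all
  use this.\<close>

lemma unit_vector_orthogonal:
  fixes e :: "nat \<Rightarrow> 'h::complex_hilbert_space"
  assumes "infinite_dimensional TYPE('h)" "orthonormal n e"
  obtains v where "norm v = 1" "\<And>i. i < n \<Longrightarrow> cinner v (e i) = 0"
proof -
  have "complex_vector.span (e ` {..<n}) \<noteq> UNIV"
    using assms(1) unfolding infinite_dimensional_def by blast
  then obtain w where w: "w \<notin> complex_vector.span (e ` {..<n})" by auto
  have "proj n e w \<in> complex_vector.span (e ` {..<n})"
    unfolding proj_def
    by (intro complex_vector.span_sum complex_vector.span_scale complex_vector.span_base) auto
  with w have "w - proj n e w \<noteq> 0" by auto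
  moreover have "cinner ((1 / norm (w - proj n e w)) *\<^sub>C (w - proj n e w)) (e i) = 0" if "i < n" for i
    by (simp only: cinner_scaleC_left proj_compl_orth[OF assms(2) that]) simp
  ultimately show ?thesis
    by (intro that[of "(1 / norm (w - proj n e w)) *\<^sub>C (w - proj n e w)"])
      (auto simp: norm_scaleC norm_divide)
qed

lemma orthonormal_cong: "orthonormal n e \<Longrightarrow> (\<And>i. i < n \<Longrightarrow> e i = e' i) \<Longrightarrow> orthonormal n e'"
  by (simp add: orthonormal_def)

text \<open>The vectors may be dependent. Whenever a vector adds nothing to the span, an arbitrary
  unit vector orthogonal to the family is inserted, so that the length stays exactly
  \<open>n\<close>.\<close>

lemma Gram_Schmidt:
  fixes v :: "nat \<Rightarrow> 'h::complex_hilbert_space"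
  assumes "infinite_dimensional TYPE('h)"
  shows "\<exists>e. orthonormal n e \<and> (\<forall>j<n. proj n e (v j) = v j)"
proof (induction n)
  case 0
  then show ?case by (simp add: orthonormal_def)
next
  case (Suc n)
  then obtain e where e: "orthonormal n e" "\<And>j. j < n \<Longrightarrow> proj n e (v j) = v j" by blast
  define w where "w = v n - proj n e (v n)"
  obtain u where u: "norm u = 1" "\<And>i. i < n \<Longrightarrow> cinner u (e i) = 0" "w = complex_of_real (norm w) *\<^sub>C u"
  proof (cases "w = 0")
    case True
    obtain x where "norm x = 1" "\<And>i. i < n \<Longrightarrow> cinner x (e i) = 0"
      using unit_vector_orthogonal[OF assms e(1)] by blast
    then show ?thesis using True by (intro that[of x]) simp_all
  next
    case False
    have "cinner w (e i) = 0" if "i < n" for i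
      unfolding w_def by (rule proj_compl_orth[OF e(1) that])
    then show ?thesis using False
      by (intro that[of "complex_of_real (1 / norm w) *\<^sub>C w"])
        (auto simp: norm_scaleC norm_divide scaleC_scaleC cinner_scaleC_left)
  qed
  define e' where "e' = e(n := u)"
  have e': "orthonormal (Suc n) e'"
    by (rule orthonormal_Suc) (use e u in \<open>auto simp: e'_def intro: orthonormal_cong\<close>)
  have pr: "proj (Suc n) e' x = proj n e x + cinner x u *\<^sub>C u" for x
    by (simp add: proj_def e'_def)
  have "proj (Suc n) e' (v j) = v j" if "j < n" for j
  proof -
    have "cinner (proj n e (v j)) u = 0"
      unfolding cinner_proj using u(2) by (simp)
    then show ?thesis using e(2)[OF that] by (simp add: pr)
  qed
  moreover have "proj (Suc n) e' (v n) = v n"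
  proof -
    have "cinner (proj n e (v n)) u = 0"
      unfolding cinner_proj using u(2) by simp
    then have "cinner (v n) u = cinner w u" by (simp add: w_def cinner_diff_left)
    also have "\<dots> = norm w"
      by (subst u(3)) (simp add: cinner_scaleC_left cinner_self u(1))
    finally have "proj (Suc n) e' (v n) = proj n e (v n) + complex_of_real (norm w) *\<^sub>C u"
      by (simp only: pr)
    also have "\<dots> = proj n e (v n) + w"
      by (simp only: u(3)[symmetric])
    finally show ?thesis
      by (simp add: w_def)
  qed
  ultimately show ?case using e' less_Suc_eq by blast
qed

section \<open>Weak compactness\<close>

text \<open>Tychonoff's theorem on a product of discs. The index type may be uncountable, which
  excludes diagonal subsequences; instead \<open>F\<close> is refined by the preimages of the
  neighbourhoods of a cluster point of \<open>X\<close>.\<close>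

lemma bounded_family_convergent_filter:
  fixes X :: "'n \<Rightarrow> 'i \<Rightarrow> complex"
  assumes "F \<noteq> bot" and bnd: "\<And>n i. cmod (X n i) \<le> B i"
  obtains G where "G \<noteq> bot" "G \<le> F" "\<And>i. \<exists>l. ((\<lambda>n. X n i) \<longlongrightarrow> l) G"
proof -
  let ?U = "PiE UNIV (\<lambda>i. cball 0 (B i)) :: ('i \<Rightarrow> complex) set"
  have "compactin (product_topology (\<lambda>i. euclidean) UNIV) ?U"
    by (subst compactin_PiE) auto
  then have U: "compact ?U"
    by (metis euclidean_product_topology compactin_euclidean_iff)
  have "eventually (\<lambda>x. x \<in> ?U) (filtermap X F)"
    using bnd by (simp add: eventually_filtermap PiE_def)
  then obtain x where x: "inf (nhds x) (filtermap X F) \<noteq> bot"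
    using U assms(1) filtermap_bot_iff[of X F] unfolding compact_filter by blast
  define G where "G = inf F (filtercomap X (nhds x))"
  have "G \<noteq> bot"
  proof
    assume "G = bot"
    then have "eventually (\<lambda>_. False) (inf F (filtercomap X (nhds x)))" by (simp add: G_def)
    then obtain P Q where PQ: "eventually P F" "eventually Q (nhds x)" "\<And>n. P n \<Longrightarrow> Q (X n) \<Longrightarrow> False"
      unfolding eventually_inf eventually_filtercomap by blast
    have "eventually (\<lambda>y. \<not> Q y) (filtermap X F)"
      unfolding eventually_filtermap using PQ by (auto elim!: eventually_mono)
    with PQ(2) have "eventually (\<lambda>_. False) (inf (nhds x) (filtermap X F))"
      unfolding eventually_inf by blast
    then show False using x by (simp add: trivial_limit_def)
  qed
  moreover have "G \<le> F" by (simp add: G_def)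
  moreover have "\<exists>l. ((\<lambda>n. X n i) \<longlongrightarrow> l) G" for i
  proof -
    have "filterlim X (nhds x) G"
      unfolding G_def by (rule filterlim_mono[OF filterlim_filtercomap order_refl inf_le2])
    then have "((\<lambda>n. X n i) \<longlongrightarrow> x i) G"
      using continuous_on_tendsto_compose[OF continuous_on_product_coordinates[of i] _ UNIV_I] by simp
    then show ?thesis ..
  qed
  ultimately show ?thesis by (rule that)
qed

text \<open>Banach-Alaoglu along a filter: the pointwise limits of the functionals
  \<open>\<lambda>g. cinner g (v n)\<close> form a bounded linear functional, which Riesz turns into
  the vector \<open>w\<close>.\<close>

lemma weak_compactness:
  fixes v :: "'n \<Rightarrow> 'h::complex_hilbert_space"
  assumes "F \<noteq> bot" and bnd: "\<And>n. norm (v n) \<le> c"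
  obtains G w where "G \<noteq> bot" "G \<le> F" "\<And>g. ((\<lambda>n. cinner g (v n)) \<longlongrightarrow> cinner g w) G"
proof -
  have b: "cmod (cinner g (v n)) \<le> c * norm g" for n g
    using cinner_Cauchy_Schwarz[of g "v n"] mult_left_mono[OF bnd[of n] norm_ge_zero[of g]]
    by (simp add: mult.commute)
  obtain G where G: "G \<noteq> bot" "G \<le> F" "\<And>g. \<exists>l. ((\<lambda>n. cinner g (v n)) \<longlongrightarrow> l) G"
    by (rule bounded_family_convergent_filter[OF assms(1),
          of "\<lambda>n g. cinner g (v n)" "\<lambda>g. c * norm g", OF b]) blast
  then obtain \<phi> where \<phi>: "\<And>g. ((\<lambda>n. cinner g (v n)) \<longlongrightarrow> \<phi> g) G" by metis
  have "\<exists>w. \<forall>g. \<phi> g = cinner g w"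
  proof (rule Riesz)
    show "\<phi> (x + y) = \<phi> x + \<phi> y" for x y
      by (rule tendsto_unique[OF G(1) \<phi>]) (use tendsto_add[OF \<phi>[of x] \<phi>[of y]] in \<open>simp add: cinner_add_left\<close>)
    show "\<phi> (a *\<^sub>C x) = a * \<phi> x" for a x
      by (rule tendsto_unique[OF G(1) \<phi>]) (use tendsto_mult_left[OF \<phi>[of x], of a] in \<open>simp add: cinner_scaleC_left\<close>)
    show "cmod (\<phi> x) \<le> c * norm x" for x
      by (rule tendsto_upperbound[OF tendsto_norm[OF \<phi>] _ G(1)]) (simp add: b)
  qed
  with \<phi> G show ?thesis by (metis that)
qed

section \<open>Positive operators with bounded trace\<close>

definition qform :: "('h::complex_hilbert_space \<Rightarrow> 'h) \<Rightarrow> 'h \<Rightarrow> real" where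
  "qform T v = Re (cinner (T v) v)"

text \<open>Common to the localization operators and their weak limits. Linearity follows from
  symmetry; the trace bound gives boundedness (take \<open>N = 1\<close>) and replaces
  compactness.\<close>

locale trace_bounded =
  fixes T :: "'h::complex_hilbert_space \<Rightarrow> 'h" and c :: real
  assumes symm: "cinner (T f) g = cinner f (T g)"
    and nonneg: "0 \<le> qform T f"
    and trace: "orthonormal N e \<Longrightarrow> (\<Sum>i<N. qform T (e i)) \<le> c"
begin

lemma T_add: "T (f + g) = T f + T g"
  by (rule cinner_ext) (simp add: symm cinner_add_left)

lemma T_scaleC: "T (a *\<^sub>C f) = a *\<^sub>C T f"
  by (rule cinner_ext) (simp add: symm cinner_scaleC_left)

lemma T_diff: "T (f - g) = T f - T g"
  by (rule cinner_ext) (simp add: symm cinner_diff_left)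

lemma T_sum: "T (\<Sum>i\<in>I. f i) = (\<Sum>i\<in>I. T (f i))"
  by (rule cinner_ext) (simp add: symm cinner_sum_left)

lemma qform_add: "qform T (f + g) = qform T f + 2 * Re (cinner (T f) g) + qform T g"
proof -
  have "Re (cinner (T g) f) = Re (cinner (T f) g)"
    using cinner_commute[of "T g" f] symm[of f g] by simp
  then show ?thesis
    by (simp add: qform_def T_add cinner_add_left cinner_add_right)
qed

lemma qform_scaleC: "qform T (a *\<^sub>C f) = (cmod a)\<^sup>2 * qform T f"
proof -
  have "cinner (T (a *\<^sub>C f)) (a *\<^sub>C f) = complex_of_real ((cmod a)\<^sup>2) * cinner (T f) f"
    by (simp add: T_scaleC cinner_scaleC_left cinner_scaleC_right complex_norm_square del: of_real_power)
  then show ?thesis by (simp add: qform_def del: of_real_power)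
qed

lemma qform_diff: "qform T (f - g) = qform T f - 2 * Re (cinner (T f) g) + qform T g"
  using qform_add[of f "(-1) *\<^sub>C g"] qform_scaleC[of "-1" g]
  by (simp add: cinner_scaleC_right)

lemma qform_add_le: "qform T (f + g) \<le> 2 * qform T f + 2 * qform T g"
  using nonneg[of "f - g"] by (simp add: qform_add qform_diff)

lemma c_nonneg: "0 \<le> c"
  using trace[of 0 "\<lambda>_. 0"] by (simp add: orthonormal_def)

text \<open>Only unit multiples of \<open>f\<close> have to be tested, so a bound on the unit
  vectors of a complex subspace transfers to all its vectors.\<close>

lemma qform_le_unit:
  assumes "\<And>u. norm u = 1 \<Longrightarrow> (\<exists>a. u = a *\<^sub>C f) \<Longrightarrow> qform T u \<le> b"
  shows "qform T f \<le> b * (norm f)\<^sup>2"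
proof (cases "f = 0")
  case True
  then show ?thesis by (simp add: qform_def)
next
  case False
  define u where "u = complex_of_real (1 / norm f) *\<^sub>C f"
  have "norm u = 1" using False by (simp add: u_def norm_scaleC norm_divide)
  then have "qform T u \<le> b" using assms u_def by blast
  moreover have "qform T u = qform T f / (norm f)\<^sup>2"
    unfolding u_def qform_scaleC by (simp add: power_divide norm_divide)
  ultimately show ?thesis using False by (simp add: field_simps)
qed

lemma qform_le: "qform T f \<le> c * (norm f)\<^sup>2"
proof (rule qform_le_unit)
  fix u :: 'h assume "norm u = 1"
  then have "orthonormal 1 (\<lambda>_. u)" by (simp add: orthonormal_def cinner_self_eq_1)
  then show "qform T u \<le> c" using trace[of 1 "\<lambda>_. u"] by simp
qed

lemma form_Cauchy_Schwarz: "(cmod (cinner (T f) g))\<^sup>2 \<le> qform T f * qform T g"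
proof -
  define z where "z = cinner (T f) g"
  \<comment> \<open>Positivity of the form at \<open>f - (t * z) g\<close>. For degenerate
    \<open>g\<close> a large \<open>t\<close> gives a contradiction; otherwise the minimiser
    \<open>t = 1 / qform T g\<close> is inserted.\<close>
  have *: "0 \<le> qform T f - 2 * t * (cmod z)\<^sup>2 + t\<^sup>2 * (cmod z)\<^sup>2 * qform T g" for t
  proof -
    have "Re (cinner (T f) ((complex_of_real t * z) *\<^sub>C g)) = t * (cmod z)\<^sup>2"
      unfolding cinner_scaleC_right z_def[symmetric] cmod_power2
      by (simp add: power2_eq_square algebra_simps)
    then show ?thesis
      using nonneg[of "f - (complex_of_real t * z) *\<^sub>C g"]
      by (simp add: qform_diff qform_scaleC norm_mult power_mult_distrib)
  qed
  show ?thesis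
  proof (cases "qform T g = 0")
    case True
    have "cmod z = 0"
    proof (rule ccontr)
      assume "cmod z \<noteq> 0"
      then show False
        using *[of "(qform T f + 1) / (cmod z)\<^sup>2"] nonneg[of f] True by simp
    qed
    then show ?thesis using True by (simp add: z_def)
  next
    case False
    then have q: "qform T g > 0" using nonneg[of g] by simp
    have "0 \<le> qform T f - (cmod z)\<^sup>2 / qform T g"
      using *[of "1 / qform T g"] q by (simp add: power_divide power2_eq_square)
    then show ?thesis using q by (simp add: field_simps z_def)
  qed
qed

text \<open>Cauchy-Schwarz for the form, applied to \<open>f\<close> and \<open>T f\<close>. A bound
  at the single vector \<open>T f\<close> suffices, so on an invariant subspace \<open>b\<close> can
  be the supremum of the form there.\<close>

lemma norm_T_sq_le_gen:
  assumes "qform T (T f) \<le> b * (norm (T f))\<^sup>2" "0 \<le> b"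
  shows "(norm (T f))\<^sup>2 \<le> b * qform T f"
proof (cases "T f = 0")
  case True
  then show ?thesis using assms nonneg[of f] by simp
next
  case False
  have "((norm (T f))\<^sup>2)\<^sup>2 = (cmod (cinner (T f) (T f)))\<^sup>2"
    by (simp add: cinner_self norm_power)
  also have "\<dots> \<le> qform T f * qform T (T f)" by (rule form_Cauchy_Schwarz)
  also have "\<dots> \<le> qform T f * (b * (norm (T f))\<^sup>2)"
    by (intro mult_left_mono assms nonneg)
  finally show ?thesis using False by (simp add: power2_eq_square mult_ac)
qed

lemma norm_T_sq_le: "(norm (T f))\<^sup>2 \<le> c * qform T f"
  by (rule norm_T_sq_le_gen[OF qform_le c_nonneg])

lemma eigenvector_qform:
  "T v = complex_of_real t *\<^sub>C v \<Longrightarrow> qform T v = t * (norm v)\<^sup>2"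
  by (simp add: qform_def cinner_scaleC_left cinner_self del: of_real_power)

text \<open>A family whose partial trace nearly attains the supremum leaves no room for the form on its
  orthogonal complement.\<close>

lemma finite_rank_tail:
  assumes "\<epsilon> > 0"
  obtains N e where "orthonormal N e" "\<And>g. qform T (g - proj N e g) \<le> \<epsilon> * (norm g)\<^sup>2"
proof -
  define S where "S = {\<Sum>i<N. qform T (e i) | N e. orthonormal N e}"
  have bdd: "bdd_above S" unfolding S_def using trace by (auto intro!: bdd_aboveI)
  have "S \<noteq> {}" unfolding S_def by (auto simp: orthonormal_def intro: exI[of _ 0])
  then obtain x where "x \<in> S" "Sup S - \<epsilon> < x"
    using less_cSup_iff[OF _ bdd, of "Sup S - \<epsilon>"] assms by auto
  then obtain N e where e: "orthonormal N e" "Sup S - \<epsilon> < (\<Sum>i<N. qform T (e i))"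
    unfolding S_def by auto
  show ?thesis
  proof (rule that[OF e(1)])
    fix g
    have "qform T (g - proj N e g) \<le> \<epsilon> * (norm (g - proj N e g))\<^sup>2"
    proof (rule qform_le_unit)
      fix u assume u: "norm u = 1" "\<exists>a. u = a *\<^sub>C (g - proj N e g)"
      define e' where "e' = e(N := u)"
      have "orthonormal (Suc N) e'"
        by (rule orthonormal_Suc)
          (use e(1) u in \<open>auto simp: e'_def cinner_scaleC_left proj_compl_orth intro: orthonormal_cong\<close>)
      then have "(\<Sum>i<Suc N. qform T (e' i)) \<in> S" unfolding S_def by blast
      then have "(\<Sum>i<Suc N. qform T (e' i)) \<le> Sup S" by (rule cSup_upper[OF _ bdd])
      then show "qform T u \<le> \<epsilon>" using e(2) by (simp add: e'_def)
    qed
    also have "\<dots> \<le> \<epsilon> * (norm g)\<^sup>2"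
      using norm_proj_compl_le[OF e(1)] assms by (simp add: power_mono)
    finally show "qform T (g - proj N e g) \<le> \<epsilon> * (norm g)\<^sup>2" .
  qed
qed

text \<open>A maximising sequence for the form on the orthogonal complement \<open>V\<close>, which
  \<open>T\<close> leaves invariant, has a weak limit. Small residuals make it an eigenvector, and
  the small tail of the form outside a finite-dimensional space keeps it from being 0.\<close>

lemma top_eigenvector:
  assumes inf: "infinite_dimensional TYPE('h)"
    and e: "orthonormal n e" and eig: "\<And>i. i < n \<Longrightarrow> T (e i) = complex_of_real (l i) *\<^sub>C e i"
  obtains v t where "norm v = 1" "\<And>i. i < n \<Longrightarrow> cinner v (e i) = 0" "0 \<le> t"
    "T v = complex_of_real t *\<^sub>C v"
    "\<And>g. (\<And>i. i < n \<Longrightarrow> cinner g (e i) = 0) \<Longrightarrow> qform T g \<le> t * (norm g)\<^sup>2"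
proof -
  define V where "V = {g. \<forall>i<n. cinner g (e i) = 0}"
  have Vsc: "a *\<^sub>C g \<in> V" if "g \<in> V" for a g
    using that by (auto simp: V_def cinner_scaleC_left)
  have VT: "T g \<in> V" if "g \<in> V" for g
    using that by (auto simp: V_def symm eig cinner_scaleC_right)
  define S where "S = qform T ` {g \<in> V. norm g = 1}"
  have bdd: "bdd_above S"
    unfolding S_def using qform_le by (intro bdd_aboveI[of _ c]) (auto, metis mult.right_neutral one_power2)
  obtain v0 where v0: "norm v0 = 1" "v0 \<in> V"
    using unit_vector_orthogonal[OF inf e] unfolding V_def by blast
  then have Sne: "S \<noteq> {}" unfolding S_def by auto
  define t where "t = Sup S"
  have qle: "qform T g \<le> t * (norm g)\<^sup>2" if "g \<in> V" for g
  proof (rule qform_le_unit)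
    fix u assume "norm u = 1" "\<exists>a. u = a *\<^sub>C g"
    then have "qform T u \<in> S" unfolding S_def using Vsc[OF that] by auto
    then show "qform T u \<le> t" unfolding t_def by (rule cSup_upper[OF _ bdd])
  qed
  have t0: "0 \<le> t" using qle[OF v0(2)] nonneg[of v0] v0(1) by simp
  have "\<exists>v\<in>V. norm v = 1 \<and> T v = complex_of_real t *\<^sub>C v"
  proof (cases "t = 0")
    case True
    then have "qform T v0 = 0" using qle[OF v0(2)] nonneg[of v0] by simp
    then have "T v0 = 0" using norm_T_sq_le[of v0] by simp
    then show ?thesis using v0 True by auto
  next
    case False
    then have tpos: "t > 0" using t0 by simp
    have "\<exists>v\<in>V. norm v = 1 \<and> t - 1 / Suc k < qform T v" for k
      using less_cSup_iff[OF Sne bdd, of "t - 1 / Suc k"] unfolding t_def S_def by auto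
    then obtain v where v: "\<And>k. v k \<in> V" "\<And>k. norm (v k) = 1" "\<And>k. t - 1 / Suc k < qform T (v k)"
      by metis
    obtain G w where G: "G \<noteq> bot" "G \<le> sequentially" "\<And>g. ((\<lambda>k. cinner g (v k)) \<longlongrightarrow> cinner g w) G"
      using weak_compactness[of sequentially v 1] v(2) by auto
    have small: "(\<lambda>k. 1 / real (Suc k)) \<longlonglongrightarrow> 0"
      using LIMSEQ_Suc[OF lim_1_over_n] by simp
    have smallG: "((\<lambda>k. 1 / real (Suc k)) \<longlongrightarrow> 0) G"
      by (rule tendsto_mono[OF G(2) small])
    have wV: "w \<in> V"
    proof -
      have "cinner (e i) w = 0" if "i < n" for i
      proof (rule tendsto_unique[OF G(1) G(3)])
        have "cinner (e i) (v k) = 0" for k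
          using v(1)[of k] that cinner_commute[of "e i"] by (simp add: V_def)
        then show "((\<lambda>k. cinner (e i) (v k)) \<longlongrightarrow> 0) G" by simp
      qed
      then show ?thesis unfolding V_def using cinner_commute[of w] by simp
    qed
    \<comment> \<open>Expanding the square and bounding \<open>(norm (T (v k)))\<^sup>2\<close> by
      \<open>t * qform T (v k)\<close> leaves \<open>t * (t - qform T (v k))\<close>.\<close>
    have res: "(norm (T (v k) - complex_of_real t *\<^sub>C v k))\<^sup>2 \<le> t * (1 / Suc k)" for k
    proof -
      have "(norm (T (v k)))\<^sup>2 \<le> t * qform T (v k)"
        by (rule norm_T_sq_le_gen[OF qle[OF VT[OF v(1)]] t0])
      moreover have "(norm (T (v k) - complex_of_real t *\<^sub>C v k))\<^sup>2
          = (norm (T (v k)))\<^sup>2 - 2 * t * qform T (v k) + t\<^sup>2"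
        using norm_add_sq[of "T (v k)" "- (complex_of_real t *\<^sub>C v k)"] v(2)[of k]
        by (simp add: cinner_scaleC_right qform_def norm_scaleC power_mult_distrib)
      ultimately have "(norm (T (v k) - complex_of_real t *\<^sub>C v k))\<^sup>2 \<le> t * (t - qform T (v k))"
        by (simp add: algebra_simps power2_eq_square)
      also have "\<dots> \<le> t * (1 / Suc k)" using v(3)[of k] t0 by (intro mult_left_mono) auto
      finally show ?thesis .
    qed
    have "((\<lambda>k. (norm (T (v k) - complex_of_real t *\<^sub>C v k))\<^sup>2) \<longlongrightarrow> 0) G"
      by (rule tendsto_sandwich[OF _ _ tendsto_const tendsto_mult_right_zero[OF smallG, of t]])
        (use res in auto)
    then have "((\<lambda>k. sqrt ((norm (T (v k) - complex_of_real t *\<^sub>C v k))\<^sup>2)) \<longlongrightarrow> sqrt 0) G"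
      by (intro tendsto_intros)
    then have "((\<lambda>k. T (v k) - complex_of_real t *\<^sub>C v k) \<longlongrightarrow> 0) G"
      by (simp add: tendsto_norm_zero_iff)
    then have lim0: "((\<lambda>k. cinner g (T (v k) - complex_of_real t *\<^sub>C v k)) \<longlongrightarrow> 0) G" for g
      using bounded_linear.tendsto[OF bounded_linear_cinner_right] by fastforce
    have Tw: "T w = complex_of_real t *\<^sub>C w"
    proof -
      have "cinner g (T w - complex_of_real t *\<^sub>C w) = 0" for g
      proof (rule tendsto_unique[OF G(1) _ lim0])
        have "((\<lambda>k. cinner (T g) (v k) - t * cinner g (v k)) \<longlongrightarrow> cinner (T g) w - t * cinner g w) G"
          by (intro tendsto_intros G(3))
        then show "((\<lambda>k. cinner g (T (v k) - complex_of_real t *\<^sub>C v k))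
            \<longlongrightarrow> cinner g (T w - complex_of_real t *\<^sub>C w)) G"
          by (simp add: cinner_diff_right cinner_scaleC_right symm)
      qed
      from this[of "T w - complex_of_real t *\<^sub>C w"] show ?thesis
        by (simp add: cinner_self)
    qed
    have "w \<noteq> 0"
    proof
      \<comment> \<open>A weakly null sequence loses its finite-rank part in norm. The rest
        contributes at most \<open>2 * (t / 4)\<close>, which is below the limit \<open>t\<close> of
        the form.\<close>
      assume w0: "w = 0"
      obtain N e' where e': "orthonormal N e'" "\<And>g. qform T (g - proj N e' g) \<le> t / 4 * (norm g)\<^sup>2"
        using finite_rank_tail[of "t / 4"] tpos by auto
      have "((\<lambda>k. \<Sum>i<N. (cmod (cinner (e' i) (v k)))\<^sup>2) \<longlongrightarrow> (\<Sum>i<N. (cmod (cinner (e' i) w))\<^sup>2)) G"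
        by (intro tendsto_intros G(3))
      then have P0: "((\<lambda>k. \<Sum>i<N. (cmod (cinner (v k) (e' i)))\<^sup>2) \<longlongrightarrow> 0) G"
        using cinner_commute[of _ "e' _"] by (simp add: w0)
      have le: "t - 1 / Suc k \<le> 2 * c * (\<Sum>i<N. (cmod (cinner (v k) (e' i)))\<^sup>2) + t / 2" for k
      proof -
        have "qform T (v k) \<le> 2 * qform T (proj N e' (v k)) + 2 * qform T (v k - proj N e' (v k))"
          using qform_add_le[of "proj N e' (v k)" "v k - proj N e' (v k)"] by simp
        then show ?thesis
          using v(3)[of k] e'(2)[of "v k"] v(2)[of k] qform_le[of "proj N e' (v k)"]
            norm_proj_sq[OF e'(1), of "v k"] by simp
      qed
      have "((\<lambda>k. t - 1 / Suc k) \<longlongrightarrow> t - 0) G"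
        by (intro tendsto_intros smallG)
      moreover have "((\<lambda>k. 2 * c * (\<Sum>i<N. (cmod (cinner (v k) (e' i)))\<^sup>2) + t / 2)
          \<longlongrightarrow> 2 * c * 0 + t / 2) G"
        by (intro tendsto_intros P0)
      ultimately have "t - 0 \<le> 2 * c * 0 + t / 2"
        using le by (intro tendsto_le[OF G(1)]) (auto intro: always_eventually)
      then show False using tpos by simp
    qed
    then have "norm (complex_of_real (1 / norm w) *\<^sub>C w) = 1"
      by (simp add: norm_scaleC norm_divide)
    then show ?thesis
      using Vsc[OF wV, of "complex_of_real (1 / norm w)"] Tw
      by (intro bexI[of _ "complex_of_real (1 / norm w) *\<^sub>C w"])
        (auto simp: T_scaleC scaleC_scaleC mult.commute)
  qed
  then obtain v where "v \<in> V" "norm v = 1" "T v = complex_of_real t *\<^sub>C v" by blast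
  then show ?thesis
    using that[of v t] t0 qle by (auto simp: V_def)
qed

end

section \<open>Spectral sequences\<close>

text \<open>Together with the eigenvector equation, the last clause makes \<open>l k\<close> the
  maximum of the form on unit vectors orthogonal to the first \<open>k\<close> vectors. It stands in
  for completeness of \<open>e\<close>, which can fail when \<open>T\<close> has a kernel.\<close>

definition spectral_seq ::
  "('h::complex_hilbert_space \<Rightarrow> 'h) \<Rightarrow> (nat \<Rightarrow> 'h) \<Rightarrow> (nat \<Rightarrow> real) \<Rightarrow> bool" where
  "spectral_seq T e l \<longleftrightarrow> (\<forall>n. orthonormal n e) \<and> decseq l \<and> (\<forall>k. 0 \<le> l k) \<and>
     (\<forall>k. T (e k) = complex_of_real (l k) *\<^sub>C e k) \<and>
     (\<forall>k g. (\<forall>i<k. cinner g (e i) = 0) \<longrightarrow> qform T g \<le> l k * (norm g)\<^sup>2)"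

text \<open>The condition says that the sum of the rank-one operators of the \<open>f i\<close> is
  at most the identity. Unlike orthonormality, it survives orthogonal projections.\<close>

definition Bessel_family :: "nat \<Rightarrow> (nat \<Rightarrow> 'h::complex_hilbert_space) \<Rightarrow> bool" where
  "Bessel_family n f \<longleftrightarrow> (\<forall>g. (\<Sum>i<n. (cmod (cinner g (f i)))\<^sup>2) \<le> (norm g)\<^sup>2)"

lemma orthonormal_Bessel: "orthonormal n e \<Longrightarrow> Bessel_family n e"
  by (simp add: Bessel_family_def Bessel)

lemma Bessel_proj:
  assumes "Bessel_family n f" "orthonormal N e"
  shows "Bessel_family n (\<lambda>i. proj N e (f i))"
  unfolding Bessel_family_def
proof
  fix g
  have "(\<Sum>i<n. (cmod (cinner g (proj N e (f i))))\<^sup>2) \<le> (norm (proj N e g))\<^sup>2"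
    using assms(1) unfolding Bessel_family_def cinner_proj_right by blast
  also have "\<dots> \<le> (norm g)\<^sup>2"
    by (intro power_mono norm_proj_le assms norm_ge_zero)
  finally show "(\<Sum>i<n. (cmod (cinner g (proj N e (f i))))\<^sup>2) \<le> (norm g)\<^sup>2" .
qed

lemma Bessel_proj_compl:
  assumes "Bessel_family n f" "orthonormal N e"
  shows "Bessel_family n (\<lambda>i. f i - proj N e (f i))"
  unfolding Bessel_family_def
proof
  fix g
  have "cinner g (f i - proj N e (f i)) = cinner (g - proj N e g) (f i)" for i
    by (simp add: cinner_diff_left cinner_diff_right cinner_proj_right)
  then have "(\<Sum>i<n. (cmod (cinner g (f i - proj N e (f i))))\<^sup>2) \<le> (norm (g - proj N e g))\<^sup>2"
    using assms(1) unfolding Bessel_family_def by simp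
  also have "\<dots> \<le> (norm g)\<^sup>2"
    by (intro power_mono norm_proj_compl_le assms norm_ge_zero)
  finally show "(\<Sum>i<n. (cmod (cinner g (f i - proj N e (f i))))\<^sup>2) \<le> (norm g)\<^sup>2" .
qed

text \<open>If \<open>l' k\<close> exceeded \<open>l k\<close>, the values \<open>l' 0\<close>, ...,
  \<open>l' k\<close> would fill at least \<open>k + 1\<close> positions of \<open>l'\<close>, but
  only positions below \<open>k\<close> in \<open>l\<close>. Used in both directions, this makes
  eigenvalue sequences unique.\<close>

lemma decseq_eq_of_counts:
  fixes l l' :: "nat \<Rightarrow> real"
  assumes "decseq l" "decseq l'" "\<And>k. 0 \<le> l k"
    and cnt: "\<And>t. t > 0 \<Longrightarrow> finite {k. l' k = t} \<and> card {k. l k = t} = card {k. l' k = t}"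
  shows "l' k \<le> l k"
proof (rule ccontr)
  assume less: "\<not> l' k \<le> l k"
  define V where "V = l' ` {..k}"
  have V: "l k < t" if "t \<in> V" for t
    using that less assms(2) by (fastforce simp: V_def decseq_def)
  have pos: "t > 0" if "t \<in> V" for t
    using V[OF that] assms(3)[of k] by simp
  have sub: "{j. l j = t} \<subseteq> {..<k}" if "t \<in> V" for t
  proof
    fix j assume "j \<in> {j. l j = t}"
    then show "j \<in> {..<k}"
      using V[OF that] decseqD[OF assms(1), of k j] by (cases "k \<le> j") auto
  qed
  have "Suc k = card {..k}" by simp
  also have "\<dots> \<le> card (\<Union>t\<in>V. {j. l' j = t})"
    using cnt pos by (intro card_mono finite_UN_I) (auto simp: V_def)
  also have "\<dots> = (\<Sum>t\<in>V. card {j. l' j = t})"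
    using cnt pos by (intro card_UN_disjoint) (auto simp: V_def)
  also have "\<dots> = (\<Sum>t\<in>V. card {j. l j = t})"
    using cnt pos by (intro sum.cong) auto
  also have "\<dots> = card (\<Union>t\<in>V. {j. l j = t})"
    using finite_subset[OF sub] by (intro card_UN_disjoint[symmetric]) (auto simp: V_def)
  also have "\<dots> \<le> card {..<k}"
    using sub by (intro card_mono) auto
  finally show False by simp
qed

section \<open>Spectral theorem, Ky Fan inequality and agreement with the eigenvalue
  sequence\<close>

context trace_bounded
begin

text \<open>Top eigenvectors are peeled off one at a time. The recursion builds pairs of a vector
  and its eigenvalue; \<open>P f n\<close> looks at \<open>f\<close> only below \<open>n\<close>, as
  well-founded choice demands.\<close>

lemma spectral_seq_exists:
  assumes inf: "infinite_dimensional TYPE('h)"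
  obtains e l where "spectral_seq T e l"
proof -
  define P where "P f n r \<longleftrightarrow> norm (fst r) = 1 \<and> (\<forall>i<n. cinner (fst r) (fst (f i)) = 0) \<and>
    T (fst r) = complex_of_real (snd r) *\<^sub>C fst r \<and> 0 \<le> snd r \<and>
    (\<forall>g. (\<forall>i<n. cinner g (fst (f i)) = 0) \<longrightarrow> qform T g \<le> snd r * (norm g)\<^sup>2)"
    for f :: "nat \<Rightarrow> 'h \<times> real" and n :: nat and r :: "'h \<times> real"
  have orth: "orthonormal n (fst \<circ> f)" if "\<And>i. i < n \<Longrightarrow> P f i (f i)" for f n
    using that by (induction n) (auto simp: orthonormal_def[of 0] P_def intro!: orthonormal_Suc)
  have "\<exists>f. \<forall>n. P f n (f n)"
  proof (rule dependent_wellorder_choice)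
    show "P f x r = P g x r" if "\<And>y. y < x \<Longrightarrow> f y = g y" for r f g and x :: nat
      using that by (simp add: P_def)
    show "\<exists>r. P f x r" if *: "\<And>y. y < x \<Longrightarrow> P f y (f y)" for x f
    proof -
      obtain v t where "norm v = 1" "\<And>i. i < x \<Longrightarrow> cinner v ((fst \<circ> f) i) = 0" "0 \<le> t"
        "T v = complex_of_real t *\<^sub>C v"
        "\<And>g. (\<And>i. i < x \<Longrightarrow> cinner g ((fst \<circ> f) i) = 0) \<Longrightarrow> qform T g \<le> t * (norm g)\<^sup>2"
        by (rule top_eigenvector[OF inf orth[OF *], of x "snd \<circ> f"])
          (use * in \<open>auto simp: P_def\<close>)
      then have "P f x (v, t)" by (simp add: P_def)
      then show ?thesis ..
    qed
  qed
  then obtain f where f: "\<And>n. P f n (f n)" by blast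
  define e l where "e = fst \<circ> f" and "l = snd \<circ> f"
  have on: "orthonormal n e" for n unfolding e_def by (rule orth) (rule f)
  have eig: "T (e k) = complex_of_real (l k) *\<^sub>C e k" for k
    using f[of k] by (simp add: P_def e_def l_def)
  have top: "qform T g \<le> l k * (norm g)\<^sup>2" if "\<forall>i<k. cinner g (e i) = 0" for k g
    using f[of k] that by (simp add: P_def e_def l_def)
  have "l (Suc k) \<le> l k" for k
  proof -
    have "l (Suc k) = qform T (e (Suc k))"
      using eigenvector_qform[OF eig, of "Suc k"] f[of "Suc k"] by (simp add: P_def e_def)
    also have "\<dots> \<le> l k * (norm (e (Suc k)))\<^sup>2"
      by (rule top) (use f[of "Suc k"] in \<open>auto simp: P_def e_def\<close>)
    finally show ?thesis using f[of "Suc k"] by (simp add: P_def e_def)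
  qed
  then have "spectral_seq T e l"
    using on eig top f unfolding spectral_seq_def
    by (auto intro!: decseq_SucI simp: P_def l_def)
  then show ?thesis by (rule that)
qed

context
  fixes e l assumes spec: "spectral_seq T e l"
begin

lemma spec_orthonormal: "orthonormal n e"
  and spec_decseq: "decseq l"
  and spec_nonneg: "0 \<le> l k"
  and spec_eig: "T (e k) = complex_of_real (l k) *\<^sub>C e k"
  and spec_top: "(\<And>i. i < k \<Longrightarrow> cinner g (e i) = 0) \<Longrightarrow> qform T g \<le> l k * (norm g)\<^sup>2"
  using spec unfolding spectral_seq_def by blast+

lemma spec_norm: "norm (e k) = 1"
  by (rule orthonormal_norm[OF spec_orthonormal[of "Suc k"]]) simp

lemma spec_cinner: "cinner (e i) (e j) = (if i = j then 1 else 0)"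
  using spec_orthonormal[of "Suc (max i j)"] unfolding orthonormal_def
  by (meson less_Suc_eq_le max.cobounded1 max.cobounded2)

lemma spec_qform: "qform T (e k) = l k"
  using eigenvector_qform[OF spec_eig] by (simp add: spec_norm)

text \<open>The first \<open>k + 1\<close> eigenvalues are all at least \<open>l k\<close>, and
  their sum is at most \<open>c\<close>. The resulting decay is what compactness would give.\<close>

lemma spec_le: "real (Suc k) * l k \<le> c"
proof -
  have "real (Suc k) * l k = (\<Sum>i<Suc k. l k)" by simp
  also have "\<dots> \<le> (\<Sum>i<Suc k. l i)"
    using spec_decseq by (intro sum_mono) (auto simp: decseq_def)
  also have "\<dots> \<le> c"
    using trace[OF spec_orthonormal, of "Suc k"] by (simp add: spec_qform)
  finally show ?thesis .
qed

lemma spec_tendsto_0: "l \<longlonglongrightarrow> 0"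
proof (rule tendsto_sandwich[OF _ _ tendsto_const])
  have "(\<lambda>k. c * (1 / real (Suc k))) \<longlonglongrightarrow> c * 0"
    by (intro tendsto_intros LIMSEQ_Suc lim_1_over_n)
  then show "(\<lambda>k. c / real (Suc k)) \<longlonglongrightarrow> 0" by simp
  show "\<forall>\<^sub>F k in sequentially. l k \<le> c / real (Suc k)"
    using spec_le by (intro always_eventually) (simp add: field_simps)
qed (simp add: spec_nonneg)

lemma spec_split:
  "qform T f = (\<Sum>j<k. l j * (cmod (cinner f (e j)))\<^sup>2) + qform T (f - proj k e f)"
proof -
  let ?p = "proj k e f" let ?r = "f - ?p"
  have Tp: "T ?p = (\<Sum>j<k. (l j * cinner f (e j)) *\<^sub>C e j)"
    by (simp add: proj_def T_sum T_scaleC spec_eig scaleC_scaleC mult.commute)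
  have "cinner (T ?p) ?r = 0"
    using proj_compl_orth[OF spec_orthonormal, of _ k f] cinner_commute[of "e _" ?r]
    by (simp add: Tp cinner_sum_left cinner_scaleC_left)
  moreover have "qform T ?p = (\<Sum>j<k. l j * (cmod (cinner f (e j)))\<^sup>2)"
  proof -
    have "cinner (T ?p) ?p = cinner (\<Sum>j<k. (l j * cinner f (e j)) *\<^sub>C e j) f"
      unfolding cinner_proj_right Tp[symmetric]
      by (simp add: Tp proj_def[of k e "\<Sum>j<k. _ j"])
        (simp add: cinner_sum_left cinner_scaleC_left spec_cinner if_distrib cong: if_cong)
    also have "\<dots> = complex_of_real (\<Sum>j<k. l j * (cmod (cinner f (e j)))\<^sup>2)"
      by (simp add: cinner_sum_left cinner_scaleC_left cinner_commute[of "e _" f]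
          complex_norm_square mult.assoc del: of_real_power)
    finally show ?thesis by (simp add: qform_def del: of_real_power of_real_sum)
  qed
  ultimately show ?thesis
    using qform_add[of ?p ?r] by simp
qed

lemma spec_lower: "(\<Sum>j<k. l j * (cmod (cinner f (e j)))\<^sup>2) \<le> qform T f"
  using spec_split[of f k] nonneg[of "f - proj k e f"] by simp

text \<open>Along \<open>e\<close> the family has weights \<open>w j \<le> 1\<close> by the Bessel
  property, and whatever trace lies beyond the first \<open>k\<close> vectors counts at most
  \<open>l k\<close>. Since \<open>k\<close> is independent of \<open>n\<close> and of the trace,
  non-integer traces are covered.\<close>

lemma Ky_Fan:
  assumes "Bessel_family n f"
  shows "(\<Sum>i<n. qform T (f i)) \<le> (\<Sum>j<k. l j) + l k * ((\<Sum>i<n. (norm (f i))\<^sup>2) - real k)"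
proof -
  define w where "w j = (\<Sum>i<n. (cmod (cinner (f i) (e j)))\<^sup>2)" for j
  have w1: "w j \<le> 1" for j
  proof -
    have "w j = (\<Sum>i<n. (cmod (cinner (e j) (f i)))\<^sup>2)"
      unfolding w_def by (subst cinner_commute) simp
    also have "\<dots> \<le> (norm (e j))\<^sup>2" using assms unfolding Bessel_family_def by blast
    finally show ?thesis by (simp add: spec_norm)
  qed
  have "qform T (f i) \<le> (\<Sum>j<k. l j * (cmod (cinner (f i) (e j)))\<^sup>2)
      + l k * ((norm (f i))\<^sup>2 - (\<Sum>j<k. (cmod (cinner (f i) (e j)))\<^sup>2))" for i
  proof -
    have "qform T (f i - proj k e (f i)) \<le> l k * (norm (f i - proj k e (f i)))\<^sup>2"
      by (rule spec_top) (rule proj_compl_orth[OF spec_orthonormal])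
    also have "(norm (f i - proj k e (f i)))\<^sup>2
        = (norm (f i))\<^sup>2 - (\<Sum>j<k. (cmod (cinner (f i) (e j)))\<^sup>2)"
      using Pythagoras_proj[OF spec_orthonormal, of "f i" k] norm_proj_sq[OF spec_orthonormal, of k "f i"]
      by simp
    finally show ?thesis using spec_split[of "f i" k] by simp
  qed
  then have "(\<Sum>i<n. qform T (f i)) \<le> (\<Sum>i<n. (\<Sum>j<k. l j * (cmod (cinner (f i) (e j)))\<^sup>2)
      + l k * ((norm (f i))\<^sup>2 - (\<Sum>j<k. (cmod (cinner (f i) (e j)))\<^sup>2)))"
    by (rule sum_mono)
  also have "\<dots> = (\<Sum>j<k. l j * w j) + l k * ((\<Sum>i<n. (norm (f i))\<^sup>2) - (\<Sum>j<k. w j))"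
    unfolding sum.distrib sum_distrib_left[symmetric] sum_subtractf
    by (subst (1 2) sum.swap) (simp add: w_def sum_distrib_left)
  also have "\<dots> = (\<Sum>j<k. (l j - l k) * w j) + l k * (\<Sum>i<n. (norm (f i))\<^sup>2)"
    by (simp add: left_diff_distrib sum_subtractf right_diff_distrib sum_distrib_left)
  also have "(\<Sum>j<k. (l j - l k) * w j) \<le> (\<Sum>j<k. (l j - l k) * 1)"
    using spec_decseq w1 by (intro sum_mono mult_left_mono) (auto simp: decseq_def)
  also have "(\<Sum>j<k. (l j - l k) * 1) + l k * (\<Sum>i<n. (norm (f i))\<^sup>2)
      = (\<Sum>j<k. l j) + l k * ((\<Sum>i<n. (norm (f i))\<^sup>2) - real k)"
    by (simp add: sum_subtractf algebra_simps)
  finally show ?thesis by simp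
qed

lemma Ky_Fan_orthonormal:
  assumes "orthonormal n f"
  shows "(\<Sum>i<n. qform T (f i)) \<le> (\<Sum>j<n. l j)"
  using Ky_Fan[OF orthonormal_Bessel[OF assms], of n] orthonormal_norm[OF assms] by simp

lemma spec_finite_level:
  assumes "t > 0" shows "finite {k. l k = t}"
proof -
  obtain N where "\<And>k. k \<ge> N \<Longrightarrow> l k < t"
    using order_tendstoD(2)[OF spec_tendsto_0 assms] by (auto simp: eventually_sequentially)
  then have "k < N" if "l k = t" for k using that by (cases "N \<le> k") force+
  then have "{k. l k = t} \<subseteq> {..<N}" by auto
  then show ?thesis by (rule finite_subset) simp
qed

text \<open>An eigenvector freed of its components along the matching \<open>e k\<close> is
  orthogonal to every \<open>e k\<close>, since different eigenvalues have orthogonal eigenvectors.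
  Its form is then at most \<open>l k\<close> times its squared norm for every \<open>k\<close>, and
  \<open>l k\<close> tends to 0.\<close>

lemma spec_eigenspace:
  assumes t: "t > 0" shows "eigenspace T t = complex_vector.span (e ` {k. l k = t})"
proof
  show "complex_vector.span (e ` {k. l k = t}) \<subseteq> eigenspace T t"
  proof (rule complex_vector.span_minimal)
    show "e ` {k. l k = t} \<subseteq> eigenspace T t"
      by (auto simp: eigenspace_def spec_eig)
    show "complex_vector.subspace (eigenspace T t)"
      by (rule complex_vector.subspaceI)
        (auto simp: eigenspace_def T_add T_scaleC scaleC_add_right scaleC_scaleC mult.commute
          T_sum[of _ "{}", simplified])
  qed
  show "eigenspace T t \<subseteq> complex_vector.span (e ` {k. l k = t})"
  proof
    fix v assume "v \<in> eigenspace T t"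
    then have Tv: "T v = complex_of_real t *\<^sub>C v" by (simp add: eigenspace_def)
    define p where "p = (\<Sum>k\<in>{k. l k = t}. cinner v (e k) *\<^sub>C e k)"
    have ps: "p \<in> complex_vector.span (e ` {k. l k = t})"
      unfolding p_def by (intro complex_vector.span_sum complex_vector.span_scale complex_vector.span_base) auto
    have Tp: "T p = complex_of_real t *\<^sub>C p"
      unfolding p_def T_sum T_scaleC complex_vector.scale_sum_right
      by (rule sum.cong) (auto simp: spec_eig scaleC_scaleC mult.commute)
    have orth: "cinner (v - p) (e k) = 0" for k
    proof (cases "l k = t")
      case True
      have "cinner p (e k) = (\<Sum>j\<in>{k. l k = t}. if j = k then cinner v (e k) else 0)"
        unfolding p_def cinner_sum_left
        by (rule sum.cong) (auto simp: cinner_scaleC_left spec_cinner)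
      also have "\<dots> = cinner v (e k)"
        using True spec_finite_level[OF t] by (simp add: sum.delta)
      finally show ?thesis by (simp add: cinner_diff_left)
    next
      case False
      have "complex_of_real t * cinner (v - p) (e k) = complex_of_real (l k) * cinner (v - p) (e k)"
        using symm[of "v - p" "e k"]
        by (simp add: T_diff Tv Tp spec_eig cinner_scaleC_right cinner_scaleC_left
            flip: complex_vector.scale_right_diff_distrib)
      then show ?thesis using False by auto
    qed
    have "qform T (v - p) = t * (norm (v - p))\<^sup>2"
      by (rule eigenvector_qform)
        (simp add: T_diff Tv Tp complex_vector.scale_right_diff_distrib)
    moreover have "qform T (v - p) \<le> l k * (norm (v - p))\<^sup>2" for k
      by (rule spec_top) (rule orth)
    ultimately have "t * (norm (v - p))\<^sup>2 \<le> 0 * (norm (v - p))\<^sup>2"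
      by (intro LIMSEQ_le_const[OF tendsto_mult_right[OF spec_tendsto_0]]) auto
    then have "(norm (v - p))\<^sup>2 \<le> 0"
      using t by (simp add: mult_le_0_iff)
    then show "v \<in> complex_vector.span (e ` {k. l k = t})" using ps by simp
  qed
qed

lemma spec_inj: "inj e"
  by (rule injI) (metis spec_cinner zero_neq_one)

lemma spec_independent: "complex_vector.independent (e ` A)"
  unfolding complex_vector.independent_explicit_module
proof (intro allI impI)
  fix S u v assume S: "finite S" "S \<subseteq> e ` A" "(\<Sum>v\<in>S. u v *\<^sub>C v) = 0" "v \<in> S"
  then obtain k where k: "v = e k" by auto
  have on: "cinner x v = (if x = v then 1 else 0)" if "x \<in> S" for x
    using that S(2) k by (auto simp: spec_cinner)
  have "0 = cinner (\<Sum>v\<in>S. u v *\<^sub>C v) v" using S by simp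
  also have "\<dots> = (\<Sum>x\<in>S. if x = v then u v else 0)"
    unfolding cinner_sum_left
    by (rule sum.cong) (auto simp: cinner_scaleC_left on)
  also have "\<dots> = u v" using S by (simp add: sum.delta)
  finally show "u v = 0" by simp
qed

lemma spec_eigenvalue_sequence: "eigenvalue_sequence T l"
  unfolding eigenvalue_sequence_def
proof (intro conjI allI impI)
  fix t :: real assume t: "t > 0"
  show "finite {k. l k = t}" by (rule spec_finite_level[OF t])
  show "card {k. l k = t} = complex_vector.dim (eigenspace T t)"
    unfolding spec_eigenspace[OF t] complex_vector.dim_span_eq_card_independent[OF spec_independent]
    by (simp add: card_image inj_on_subset[OF spec_inj])
qed (use spec_decseq spec_nonneg in auto)

text \<open>The definite description is resolved by \<open>decseq_eq_of_counts\<close>, applied both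
  ways. Eigenvalue number \<open>Suc k\<close> is entry \<open>k\<close>.\<close>

lemma spec_nth_eigenvalue: "nth_eigenvalue T (Suc k) = l k"
proof -
  have "(THE l. eigenvalue_sequence T l) = l"
  proof (rule the_equality[where P = "eigenvalue_sequence T", OF spec_eigenvalue_sequence])
    fix l' assume l': "eigenvalue_sequence T l'"
    have "l' k = l k" for k
      using l' spec_eigenvalue_sequence decseq_eq_of_counts[of l l' k] decseq_eq_of_counts[of l' l k]
      unfolding eigenvalue_sequence_def by (auto intro: antisym)
    then show "l' = l" by blast
  qed
  then show ?thesis by (simp add: nth_eigenvalue_def)
qed

lemma spec_sum_nth_eigenvalue: "(\<Sum>k=1..K. nth_eigenvalue T k) = (\<Sum>j<K. l j)"
  by (rule sum.reindex_bij_witness[of _ Suc "\<lambda>k. k - 1"]) (auto simp: spec_nth_eigenvalue[symmetric])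

end

end

section \<open>Topological groups\<close>

lemma translation_vimage: "(+) x ` A = (+) (- x) -` (A :: 'g::group_add set)"
proof
  show "(+) (- x) -` A \<subseteq> (+) x ` A"
  proof
    fix y assume "y \<in> (+) (- x) -` A"
    then show "y \<in> (+) x ` A" by (intro image_eqI[of _ _ "- x + y"]) (auto simp: add.assoc[symmetric])
  qed
qed (auto simp: add.assoc[symmetric])

lemma open_translation_group:
  fixes A :: "'g::topological_group_add set"
  assumes "open A" shows "open ((+) x ` A)"
  unfolding translation_vimage by (intro open_vimage assms continuous_intros)

lemma compact_translation_group:
  fixes A :: "'g::topological_group_add set"
  assumes "compact A" shows "compact ((+) x ` A)"
  by (intro compact_continuous_image assms continuous_intros)

lemma compact_differences_group:
  fixes A B :: "'g::topological_group_add set"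
  assumes "compact A" "compact B" shows "compact ((\<lambda>(a, b). a - b) ` (A \<times> B))"
  unfolding case_prod_unfold
  by (intro compact_continuous_image compact_Times assms continuous_intros)

text \<open>\<open>x + b = a\<close> means \<open>x = a - b\<close>, so it is enough that
  \<open>x\<close> avoids the compact set of differences, which is not the whole group.\<close>

lemma exists_disjoint_translate:
  fixes A B :: "'g::topological_group_add set"
  assumes "\<not> compact (UNIV :: 'g set)" "compact A" "compact B"
  obtains x where "A \<inter> (+) x ` B = {}"
proof -
  obtain x where x: "x \<notin> (\<lambda>(a, b). a - b) ` (A \<times> B)"
    using compact_differences_group[OF assms(2,3)] assms(1) by (metis UNIV_eq_I)
  have "A \<inter> (+) x ` B = {}"
  proof (rule ccontr)
    assume "A \<inter> (+) x ` B \<noteq> {}"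
    then obtain b where b: "b \<in> B" "x + b \<in> A" by blast
    have "x = (x + b) - b" by simp
    then show False using x b by (metis (no_types, lifting) SigmaI case_prod_conv image_eqI)
  qed
  then show ?thesis by (rule that)
qed

text \<open>Greedy choice: the new point has to avoid finitely many compact sets of differences,
  whose union cannot contain \<open>A\<close>.\<close>

lemma disjoint_translates:
  fixes A C :: "'g::topological_group_add set"
  assumes A: "\<And>B. compact B \<Longrightarrow> \<not> A \<subseteq> B" and C: "compact C" "V \<subseteq> C"
  obtains x :: "nat \<Rightarrow> 'g" where "\<And>n. x n \<in> A" "disjoint_family (\<lambda>n. (+) (x n) ` V)"
proof -
  define P where "P f n r \<longleftrightarrow> r \<in> A \<and> (\<forall>i<n. (+) r ` V \<inter> (+) (f i) ` V = {})"
    for f :: "nat \<Rightarrow> 'g" and n :: nat and r :: 'g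
  have "\<exists>f. \<forall>n. P f n (f n)"
  proof (rule dependent_wellorder_choice)
    show "P f n r = P g n r" if "\<And>y. y < n \<Longrightarrow> f y = g y" for r f g and n :: nat
      using that by (simp add: P_def)
    show "\<exists>r. P f n r" for n :: nat and f
    proof -
      have "compact (\<Union>i<n. (\<lambda>(a, b). a - b) ` (((+) (f i) ` C) \<times> C))"
        by (intro compact_UN compact_differences_group compact_translation_group C) simp
      then obtain r where r: "r \<in> A" "r \<notin> (\<Union>i<n. (\<lambda>(a, b). a - b) ` (((+) (f i) ` C) \<times> C))"
        using A by blast
      have "(+) r ` V \<inter> (+) (f i) ` V = {}" if "i < n" for i
      proof (rule ccontr)
        assume "(+) r ` V \<inter> (+) (f i) ` V \<noteq> {}"
        then obtain v v' where v: "v \<in> V" "v' \<in> V" "r + v = f i + v'" by auto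
        then have "r = (f i + v') - v" by (metis add_diff_cancel)
        then show False using r(2) v C(2) that by fastforce
      qed
      then show ?thesis using r(1) by (auto simp: P_def)
    qed
  qed
  then obtain f where f: "\<And>n. P f n (f n)" by blast
  show ?thesis
  proof (rule that[of f])
    show "f n \<in> A" for n using f[of n] by (simp add: P_def)
    show "disjoint_family (\<lambda>n. (+) (f n) ` V)"
      unfolding disjoint_family_on_def
    proof (intro ballI impI)
      fix m n :: nat assume "m \<noteq> n"
      then show "(+) (f m) ` V \<inter> (+) (f n) ` V = {}"
        using f[of n] f[of m] by (cases "m < n") (auto simp: P_def)
    qed
  qed
qed

lemma ennreal_eq_top_of_multiples:
  fixes a b :: ennreal
  assumes "a > 0" "\<And>n. of_nat n * a \<le> b" shows "b = \<infinity>"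
proof (rule ccontr)
  assume b: "b \<noteq> \<infinity>"
  then have a: "a \<noteq> \<infinity>" using assms(2)[of 1] by (auto simp: top_unique)
  have "real n * enn2real a \<le> enn2real b" for n
    using enn2real_mono[OF assms(2)[of n]] b by (simp add: enn2real_mult less_top)
  moreover have "enn2real a > 0"
    using assms(1) a by (simp add: enn2real_positive_iff less_top)
  ultimately show False
    by (metis reals_Archimedean3 linorder_not_le)
qed

section \<open>Square-integrable representations\<close>

locale wavelet_setting =
  fixes M :: "'g::{topological_group_add, t2_space} measure"
    and \<omega> :: "'g \<Rightarrow> 'g \<Rightarrow> complex"
    and \<pi> :: "'g \<Rightarrow> 'h::complex_hilbert_space \<Rightarrow> 'h"
    and \<psi> :: 'h
  assumes loc_compact: "locally compact (UNIV :: 'g set)"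
    and noncompact: "\<not> compact (UNIV :: 'g set)"
    and haar: "left_haar_measure M"
    and rep: "projective_unitary_rep \<omega> \<pi>"
    and cont: "strongly_continuous_rep \<pi>"
    and irred: "irreducible_rep \<pi>"
    and inf_dim: "infinite_dimensional TYPE('h)"
    and admissible: "admissible_wavelet M \<pi> \<psi>"
    and positive: "\<And>\<Omega> f. \<Omega> \<in> sets M \<Longrightarrow> emeasure M \<Omega> > 0 \<Longrightarrow> f \<noteq> 0 \<Longrightarrow>
           (\<integral>\<^sup>+ x\<in>\<Omega>. ennreal ((cmod (wavelet_transform \<pi> \<psi> f x))\<^sup>2) \<partial>M) > 0"
begin

abbreviation "W \<equiv> wavelet_transform \<pi> \<psi>"

lemma sets_M: "sets M = sets borel"
  using haar by (simp add: left_haar_measure_def)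

lemma space_M [simp]: "space M = UNIV"
  using sets_eq_imp_space_eq[OF sets_M] by simp

lemma open_sets: "open A \<Longrightarrow> A \<in> sets M"
  by (simp add: sets_M)

lemma compact_sets: "compact A \<Longrightarrow> A \<in> sets M"
  by (simp add: sets_M compact_imp_closed)

lemma continuous_measurable:
  fixes u :: "'g \<Rightarrow> 'b::topological_space"
  assumes "continuous_on UNIV u" shows "u \<in> borel_measurable M"
  using borel_measurable_continuous_onI[OF assms] by (simp add: measurable_cong_sets[OF sets_M refl])

lemma compact_fmeasurable: "compact A \<Longrightarrow> A \<in> fmeasurable M"
  using haar by (intro fmeasurableI compact_sets) (auto simp: left_haar_measure_def)

lemma fmeasurable_of_compact: "A \<in> sets M \<Longrightarrow> A \<subseteq> C \<Longrightarrow> compact C \<Longrightarrow> A \<in> fmeasurable M"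
  using compact_fmeasurable fmeasurableI2 by blast

lemma translation_measurable: "(+) x \<in> measurable M M"
proof -
  have "(+) x \<in> borel_measurable (borel :: 'g measure)"
    by (intro borel_measurable_continuous_onI continuous_intros)
  then show ?thesis by (simp add: measurable_cong_sets[OF sets_M sets_M])
qed

lemma translation_sets: "A \<in> sets M \<Longrightarrow> (+) x ` A \<in> sets M"
  unfolding translation_vimage using measurable_sets[OF translation_measurable] by fastforce

lemma emeasure_translation: "A \<in> sets M \<Longrightarrow> emeasure M ((+) x ` A) = emeasure M A"
  using haar by (simp add: left_haar_measure_def sets_M)

lemma distr_translation: "distr M M ((+) x) = M"
proof (rule measure_eqI)
  fix A assume "A \<in> sets (distr M M ((+) x))"
  then have A: "A \<in> sets M" by simp
  have "(+) x -` A = (+) (- x) ` A" using translation_vimage[of "- x" A] by simp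
  then show "emeasure (distr M M ((+) x)) A = emeasure M A"
    using A by (simp add: emeasure_distr translation_measurable emeasure_translation)
qed simp

lemma translation_fmeasurable: "A \<in> fmeasurable M \<Longrightarrow> (+) x ` A \<in> fmeasurable M"
  by (auto simp: fmeasurable_def translation_sets emeasure_translation)

lemma measure_translation: "A \<in> sets M \<Longrightarrow> measure M ((+) x ` A) = measure M A"
  by (simp add: measure_def emeasure_translation)

text \<open>Finitely many translates of \<open>U\<close> cover any compact set. Were
  \<open>U\<close> null, all compact sets would be null, and by inner regularity the whole
  group.\<close>

lemma emeasure_open_pos:
  assumes "open U" "U \<noteq> {}" shows "emeasure M U > 0"
proof (rule ccontr)
  assume "\<not> emeasure M U > 0"
  then have U0: "emeasure M U = 0" by simp
  obtain u where u: "u \<in> U" using assms by auto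
  have null: "emeasure M C = 0" if C: "compact C" for C
  proof -
    have "C \<subseteq> (\<Union>x\<in>UNIV. (+) x ` U)"
    proof
      fix y show "y \<in> (\<Union>x\<in>UNIV. (+) x ` U)"
        using u by (auto intro!: exI[of _ "y - u"] image_eqI[of _ _ u])
    qed
    then obtain D where D: "finite D" "C \<subseteq> (\<Union>x\<in>D. (+) x ` U)"
      by (rule compactE_image[OF C open_translation_group[OF assms(1)], of "\<lambda>x. x" UNIV]) blast+
    have "(+) x ` U \<in> null_sets M" for x
      using U0 open_sets[OF assms(1)] by (intro null_setsI translation_sets) (simp add: emeasure_translation)
    then have "(\<Union>x\<in>D. (+) x ` U) \<in> null_sets M" using D(1) by (intro null_sets.finite_UN) auto
    then show ?thesis
      using D(2) emeasure_mono[of C "\<Union>x\<in>D. (+) x ` U" M] by (auto simp: null_sets_def)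
  qed
  have "emeasure M UNIV = (SUP C\<in>{C. compact C \<and> C \<subseteq> UNIV}. emeasure M C)"
    using haar unfolding left_haar_measure_def by blast
  also have "\<dots> \<le> 0"
    by (rule SUP_least) (simp add: null)
  finally have "emeasure M UNIV = 0" by simp
  then show False using haar by (simp add: left_haar_measure_def)
qed

lemma compact_neighbourhood:
  fixes U :: "'g set"
  assumes "open U" "x \<in> U"
  obtains V C where "open V" "compact C" "x \<in> V" "V \<subseteq> C" "C \<subseteq> U"
  using loc_compact[unfolded locally_def, rule_format, of U x] assms that
  by (auto simp: subtopology_UNIV)

text \<open>Infinitely many disjoint translates of one neighbourhood of 0, based at points of
  \<open>A\<close>, have equal positive measure. With \<open>A = UNIV\<close> this shows that the
  group has infinite measure; with a superlevel set of the transform of \<open>\<psi>\<close> it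
  contradicts the finite wavelet constant.\<close>

lemma emeasure_translates_infinite:
  assumes "\<And>B. compact B \<Longrightarrow> \<not> A \<subseteq> B" "open U" "0 \<in> U"
  obtains E where "E \<in> sets M" "emeasure M E = \<infinity>" "\<And>y. y \<in> E \<Longrightarrow> \<exists>x\<in>A. \<exists>h\<in>U. y = x + h"
proof -
  obtain V C where V: "open V" "compact C" "0 \<in> V" "V \<subseteq> C" "C \<subseteq> U"
    using compact_neighbourhood[OF assms(2,3)] by blast
  obtain x where x: "\<And>n::nat. x n \<in> A" "disjoint_family (\<lambda>n. (+) (x n) ` V)"
    using disjoint_translates[OF assms(1) V(2,4)] by blast
  define E where "E = (\<Union>n. (+) (x n) ` V)"
  have s: "(+) (x n) ` V \<in> sets M" for n
    by (intro translation_sets open_sets V)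
  have E: "E \<in> sets M" unfolding E_def using s by blast
  have "of_nat n * emeasure M V \<le> emeasure M E" for n
  proof -
    have "of_nat n * emeasure M V = (\<Sum>i<n. emeasure M ((+) (x i) ` V))"
      using V by (simp add: emeasure_translation open_sets)
    also have "\<dots> = emeasure M (\<Union>i<n. (+) (x i) ` V)"
      using s x(2) by (intro sum_emeasure) (auto simp: disjoint_family_on_def)
    also have "\<dots> \<le> emeasure M E" by (rule emeasure_mono) (auto simp: E_def E[unfolded E_def])
    finally show ?thesis .
  qed
  then have "emeasure M E = \<infinity>"
    using emeasure_open_pos[OF V(1)] V(3) by (intro ennreal_eq_top_of_multiples[of "emeasure M V"]) auto
  then show ?thesis
    using x(1) V by (intro that[OF E]) (auto simp: E_def, metis subset_iff)
qed

lemma emeasure_UNIV: "emeasure M UNIV = \<infinity>"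
proof -
  obtain E where "E \<in> sets M" "emeasure M E = \<infinity>"
    using emeasure_translates_infinite[of UNIV UNIV] noncompact by (metis open_UNIV UNIV_I top.extremum_unique)
  then show ?thesis using emeasure_mono[of E UNIV M] sets.top[of M] by (simp add: top_unique)
qed

lemma rep_add: "\<pi> x (v + w) = \<pi> x v + \<pi> x w"
  and rep_cinner: "cinner (\<pi> x v) (\<pi> x w) = cinner v w"
  and rep_mult: "\<pi> (x + y) v = \<omega> x y *\<^sub>C \<pi> x (\<pi> y v)"
  and cmod_cocycle: "cmod (\<omega> x y) = 1"
  using rep unfolding projective_unitary_rep_def unitary_op_def by blast+

lemma rep_diff: "\<pi> x (v - w) = \<pi> x v - \<pi> x w"
  using rep_add[of x "v - w" w] by simp

lemma rep_norm: "norm (\<pi> x v) = norm v"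
proof -
  have "complex_of_real ((norm (\<pi> x v))\<^sup>2) = complex_of_real ((norm v)\<^sup>2)"
    unfolding cinner_self[symmetric] rep_cinner ..
  then show ?thesis by (simp only: of_real_eq_iff power2_eq_iff_nonneg norm_ge_zero)
qed

lemma norm_wavelet [simp]: "norm \<psi> = 1"
  using admissible by (simp add: admissible_wavelet_def)

lemma norm_orbit [simp]: "norm (\<pi> x \<psi>) = 1"
  by (simp add: rep_norm)

lemma cont_rep: "continuous_on UNIV (\<lambda>x. \<pi> x v)"
  using cont by (simp add: strongly_continuous_rep_def)

lemma cont_W: "continuous_on UNIV (W f)"
  unfolding wavelet_transform_def
  by (rule bounded_linear.continuous_on[OF bounded_linear_cinner_right cont_rep])

lemma W_le: "cmod (W f x) \<le> norm f"
  using cinner_Cauchy_Schwarz[of f "\<pi> x \<psi>"] by (simp add: wavelet_transform_def)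

lemma W_add: "W (f + g) x = W f x + W g x"
  and W_diff: "W (f - g) x = W f x - W g x"
  and W_scaleC: "W (a *\<^sub>C f) x = a * W f x"
  by (simp_all add: wavelet_transform_def cinner_add_left cinner_diff_left cinner_scaleC_left)

lemma cmod_W_translate: "cmod (W (\<pi> y f) (y + x)) = cmod (W f x)"
  by (simp add: wavelet_transform_def rep_mult cinner_scaleC_right rep_cinner norm_mult cmod_cocycle)

text \<open>\<open>\<pi> (x + h) \<psi>\<close> is, up to a phase,
  \<open>\<pi> x (\<pi> h \<psi>)\<close>, so by strong continuity at 0 the modulus of the transform
  changes by at most \<open>\<epsilon> / 2\<close> on \<open>x + U\<close>, uniformly in
  \<open>x\<close>. A superlevel set contained in no compact set would thus force infinite
  energy.\<close>

lemma W_wavelet_vanishes: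
  assumes "\<epsilon> > 0" shows "\<exists>C. compact C \<and> (\<forall>x. x \<notin> C \<longrightarrow> cmod (W \<psi> x) < \<epsilon>)"
proof (rule ccontr)
  assume contra: "\<not> ?thesis"
  define A where "A = {x. \<epsilon> \<le> cmod (W \<psi> x)}"
  have A: "\<not> A \<subseteq> B" if "compact B" for B
    using contra that unfolding A_def by (metis (mono_tags, lifting) linorder_not_le mem_Collect_eq subset_iff)
  define U where "U = {h. dist (\<pi> h \<psi>) (\<pi> 0 \<psi>) < \<epsilon> / 2}"
  have U: "open U"
    unfolding U_def by (intro open_Collect_less continuous_intros cont_rep)
  obtain E where E: "E \<in> sets M" "emeasure M E = \<infinity>" "\<And>y. y \<in> E \<Longrightarrow> \<exists>x\<in>A. \<exists>h\<in>U. y = x + h"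
    using emeasure_translates_infinite[OF A U] assms by (auto simp: U_def)
  have big: "\<epsilon> / 2 \<le> cmod (W \<psi> y)" if y: "y \<in> E" for y
  proof -
    obtain x h where xh: "x \<in> A" "h \<in> U" "y = x + h" using E(3)[OF y] by blast
    \<comment> \<open>\<open>\<pi> 0\<close> is only a phase times the identity; writing
      \<open>x + 0\<close> lets the cocycle absorb that phase.\<close>
    have "\<epsilon> \<le> cmod (W \<psi> (x + 0))" using xh by (simp add: A_def)
    also have "\<dots> = cmod (cinner \<psi> (\<pi> x (\<pi> 0 \<psi>)))"
      unfolding wavelet_transform_def rep_mult by (simp add: cinner_scaleC_right norm_mult cmod_cocycle)
    also have "\<dots> \<le> cmod (cinner \<psi> (\<pi> x (\<pi> h \<psi>))) + cmod (cinner \<psi> (\<pi> x (\<pi> 0 \<psi> - \<pi> h \<psi>)))"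
      unfolding rep_diff cinner_diff_right using norm_triangle_sub[of "cinner \<psi> (\<pi> x (\<pi> 0 \<psi>))"] by simp
    also have "cmod (cinner \<psi> (\<pi> x (\<pi> h \<psi>))) = cmod (W \<psi> y)"
      by (simp add: wavelet_transform_def xh(3) rep_mult cinner_scaleC_right norm_mult cmod_cocycle)
    also have "cmod (cinner \<psi> (\<pi> x (\<pi> 0 \<psi> - \<pi> h \<psi>))) \<le> \<epsilon> / 2"
      using cinner_Cauchy_Schwarz[of \<psi> "\<pi> x (\<pi> 0 \<psi> - \<pi> h \<psi>)"] xh(2)
      by (simp add: rep_norm U_def dist_norm norm_minus_commute)
    finally show ?thesis by simp
  qed
  have "\<infinity> = ennreal ((\<epsilon> / 2)\<^sup>2) * emeasure M E"
    using assms E(2) by (simp add: ennreal_mult_top)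
  also have "\<dots> = (\<integral>\<^sup>+ x. ennreal ((\<epsilon> / 2)\<^sup>2) * indicator E x \<partial>M)"
    using E(1) by (simp add: nn_integral_cmult_indicator)
  also have "\<dots> \<le> (\<integral>\<^sup>+ x. ennreal ((cmod (W \<psi> x))\<^sup>2) \<partial>M)"
    using big assms
    by (intro nn_integral_mono) (auto simp: indicator_def intro!: ennreal_leI power_mono)
  also have "\<dots> < \<infinity>"
    using admissible by (simp add: admissible_wavelet_def wavelet_constant_def wavelet_transform_def)
  finally show False by simp
qed

text \<open>The vectors whose transform vanishes at infinity form a closed invariant subspace.\<close>

lemma W_vanishes:
  assumes "\<epsilon> > 0" shows "\<exists>C. compact C \<and> (\<forall>x. x \<notin> C \<longrightarrow> cmod (W f x) < \<epsilon>)"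
proof -
  define S where "S = {f. \<forall>\<epsilon>>0. \<exists>C. compact C \<and> (\<forall>x. x \<notin> C \<longrightarrow> cmod (W f x) < \<epsilon>)}"
  have S: "\<exists>C. compact C \<and> (\<forall>x. x \<notin> C \<longrightarrow> cmod (W f x) < \<epsilon>)" if "f \<in> S" "\<epsilon> > 0" for f \<epsilon>
    using that by (simp add: S_def)
  have "complex_vector.subspace S"
  proof (rule complex_vector.subspaceI)
    show "0 \<in> S" by (auto simp: S_def wavelet_transform_def intro: exI[of _ "{}"])
    fix f g assume fg: "f \<in> S" "g \<in> S"
    show "f + g \<in> S" unfolding S_def
    proof (intro CollectI allI impI)
      fix \<epsilon> :: real assume e: "\<epsilon> > 0"
      obtain C D where C: "compact C" "\<And>x. x \<notin> C \<Longrightarrow> cmod (W f x) < \<epsilon> / 2"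
        and D: "compact D" "\<And>x. x \<notin> D \<Longrightarrow> cmod (W g x) < \<epsilon> / 2"
        using S[OF fg(1), of "\<epsilon> / 2"] S[OF fg(2), of "\<epsilon> / 2"] e by auto
      show "\<exists>C. compact C \<and> (\<forall>x. x \<notin> C \<longrightarrow> cmod (W (f + g) x) < \<epsilon>)"
      proof (intro exI[of _ "C \<union> D"] conjI allI impI)
        show "cmod (W (f + g) x) < \<epsilon>" if "x \<notin> C \<union> D" for x
          using C(2)[of x] D(2)[of x] that norm_triangle_ineq[of "W f x" "W g x"] by (simp add: W_add)
      qed (use C D in auto)
    qed
  next
    fix a f assume f: "f \<in> S"
    show "a *\<^sub>C f \<in> S" unfolding S_def
    proof (intro CollectI allI impI)
      fix \<epsilon> :: real assume e: "\<epsilon> > 0"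
      have ca: "0 < cmod a + 1" by (simp add: add_nonneg_pos)
      obtain C where C: "compact C" "\<And>x. x \<notin> C \<Longrightarrow> cmod (W f x) < \<epsilon> / (cmod a + 1)"
        using S[OF f, of "\<epsilon> / (cmod a + 1)"] e ca by auto
      show "\<exists>C. compact C \<and> (\<forall>x. x \<notin> C \<longrightarrow> cmod (W (a *\<^sub>C f) x) < \<epsilon>)"
      proof (intro exI[of _ C] conjI allI impI C(1))
        fix x assume "x \<notin> C"
        have "cmod (W (a *\<^sub>C f) x) \<le> (cmod a + 1) * cmod (W f x)"
          by (simp add: W_scaleC norm_mult mult_right_mono)
        also have "\<dots> < \<epsilon>" using C(2)[OF \<open>x \<notin> C\<close>] ca by (simp add: field_simps)
        finally show "cmod (W (a *\<^sub>C f) x) < \<epsilon>" .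
      qed
    qed
  qed
  moreover have "closure S \<subseteq> S"
  proof
    fix f assume "f \<in> closure S"
    then have f: "\<forall>e>0. \<exists>y\<in>S. dist y f < e" by (simp add: closure_approachable)
    show "f \<in> S" unfolding S_def
    proof (intro CollectI allI impI)
      fix \<epsilon> :: real assume e: "\<epsilon> > 0"
      obtain g where g: "g \<in> S" "dist g f < \<epsilon> / 2" using f e by (meson half_gt_zero)
      obtain C where C: "compact C" "\<And>x. x \<notin> C \<Longrightarrow> cmod (W g x) < \<epsilon> / 2"
        using S[OF g(1), of "\<epsilon> / 2"] e by auto
      show "\<exists>C. compact C \<and> (\<forall>x. x \<notin> C \<longrightarrow> cmod (W f x) < \<epsilon>)"
      proof (intro exI[of _ C] conjI allI impI C(1))
        fix x assume "x \<notin> C"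
        have "cmod (W f x) \<le> cmod (W g x) + cmod (W (f - g) x)"
          using norm_triangle_ineq[of "W g x" "W (f - g) x"] by (simp add: W_diff)
        then show "cmod (W f x) < \<epsilon>"
          using C(2)[OF \<open>x \<notin> C\<close>] W_le[of "f - g" x] g(2) by (simp add: dist_norm norm_minus_commute)
      qed
    qed
  qed
  moreover have "\<pi> y ` S \<subseteq> S" for y
  proof
    fix v assume "v \<in> \<pi> y ` S"
    then obtain f where f: "f \<in> S" "v = \<pi> y f" by blast
    show "v \<in> S" unfolding S_def
    proof (intro CollectI allI impI)
      fix \<epsilon> :: real assume e: "\<epsilon> > 0"
      obtain C where C: "compact C" "\<And>x. x \<notin> C \<Longrightarrow> cmod (W f x) < \<epsilon>"
        using S[OF f(1) e] by auto
      show "\<exists>C. compact C \<and> (\<forall>x. x \<notin> C \<longrightarrow> cmod (W v x) < \<epsilon>)"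
      proof (intro exI[of _ "(+) y ` C"] conjI allI impI compact_translation_group C(1))
        fix x assume "x \<notin> (+) y ` C"
        then have "- y + x \<notin> C" by (simp add: translation_vimage)
        then show "cmod (W v x) < \<epsilon>"
          using C(2) cmod_W_translate[of y f "- y + x"] by (simp add: f(2) add.assoc[symmetric])
      qed
    qed
  qed
  moreover have "\<psi> \<in> S" using W_wavelet_vanishes by (simp add: S_def)
  moreover have "\<psi> \<noteq> 0" using norm_wavelet by force
  ultimately have "S = UNIV"
    using irred unfolding irreducible_rep_def closure_subset_eq by blast
  then show ?thesis using S assms by blast
qed

lemma W_vanishes_uniformly:
  fixes n :: nat
  assumes "\<epsilon> > 0"
  shows "\<exists>C. compact C \<and> (\<forall>x. x \<notin> C \<longrightarrow> (\<forall>i<n. cmod (W (f i) x) < \<epsilon>))"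
proof (induct n)
  case (Suc n)
  then obtain C where C: "compact C" "\<forall>x. x \<notin> C \<longrightarrow> (\<forall>i<n. cmod (W (f i) x) < \<epsilon>)" by blast
  obtain D where D: "compact D" "\<forall>x. x \<notin> D \<longrightarrow> cmod (W (f n) x) < \<epsilon>"
    using W_vanishes[OF assms] by blast
  show ?case
    by (intro exI[of _ "C \<union> D"]) (use C D in \<open>auto simp: less_Suc_eq\<close>)
qed (auto intro: exI[of _ "{}"])

section \<open>Subsets of prescribed measure\<close>

text \<open>A point of positive measure would be a set on which the transform of every vector orthogonal
  to one orbit vector vanishes.\<close>

lemma emeasure_singleton: "emeasure M {x} = 0"
proof (rule ccontr)
  assume "emeasure M {x} \<noteq> 0"
  then have pos: "emeasure M {x} > 0" by (simp add: zero_less_iff_neq_zero)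
  have "orthonormal 1 (\<lambda>_. \<pi> x \<psi>)"
    by (simp add: orthonormal_def cinner_self_eq_1)
  then obtain f where f: "norm f = 1" "cinner f (\<pi> x \<psi>) = 0"
    using unit_vector_orthogonal[OF inf_dim, of 1 "\<lambda>_. \<pi> x \<psi>"] by auto
  have "(\<integral>\<^sup>+ y\<in>{x}. ennreal ((cmod (W f y))\<^sup>2) \<partial>M) = (\<integral>\<^sup>+ y. 0 \<partial>M)"
    by (intro nn_integral_cong) (auto simp: indicator_def wavelet_transform_def f)
  moreover have "f \<noteq> 0" using f(1) by auto
  ultimately show False
    using positive[OF compact_sets pos, of f] by simp
qed

lemma small_neighbourhood:
  assumes "\<delta> > 0"
  obtains U where "open U" "x \<in> U" "U \<in> fmeasurable M" "measure M U < \<delta>"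
proof -
  have "\<forall>A\<in>sets borel. emeasure M A = (INF U\<in>{U. open U \<and> A \<subseteq> U}. emeasure M U)"
    using haar unfolding left_haar_measure_def by (elim conjE)
  then have "emeasure M {x} = (INF U\<in>{U. open U \<and> {x} \<subseteq> U}. emeasure M U)"
    by (rule bspec) simp
  then have "(INF U\<in>{U. open U \<and> {x} \<subseteq> U}. emeasure M U) < ennreal \<delta>"
    using assms by (simp add: emeasure_singleton)
  then obtain U where U: "open U" "x \<in> U" "emeasure M U < ennreal \<delta>"
    unfolding INF_less_iff by auto
  then have "U \<in> fmeasurable M"
    by (intro fmeasurableI open_sets) (simp_all add: order.strict_trans[OF _ ennreal_less_top])
  then show ?thesis
    using U assms by (intro that[OF U(1,2)]) (auto simp: emeasure_eq_measure2 ennreal_less_iff)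
qed

text \<open>Members of the cover are discarded one by one until the remaining part of
  \<open>E\<close> has measure at most \<open>r\<close>; every step loses less than
  \<open>\<delta>\<close>, so the value cannot jump past \<open>r - \<delta>\<close>.\<close>

lemma approximate_subset:
  assumes "finite \<U>" "\<And>U. U \<in> \<U> \<Longrightarrow> U \<in> fmeasurable M \<and> measure M U < \<delta>" "\<delta> > 0"
    and "E \<in> fmeasurable M" "E \<subseteq> \<Union>\<U>" "0 \<le> r" "r \<le> measure M E"
  shows "\<exists>E'\<subseteq>E. E' \<in> sets M \<and> r - \<delta> < measure M E' \<and> measure M E' \<le> r"
  using assms(1,2,4-)
proof (induction \<U> arbitrary: E rule: finite_induct)
  case empty
  then show ?case using assms(3) by (intro exI[of _ "{}"]) auto
next
  case (insert U \<U>)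
  define E1 where "E1 = E \<inter> \<Union>\<U>"
  have UU: "\<Union>\<U> \<in> sets M"
    using insert by (intro sets.finite_Union) auto
  then have E1: "E1 \<in> fmeasurable M"
    unfolding E1_def by (intro fmeasurable_Int_fmeasurable insert)
  show ?case
  proof (cases "r \<le> measure M E1")
    case True
    have "\<exists>E'\<subseteq>E1. E' \<in> sets M \<and> r - \<delta> < measure M E' \<and> measure M E' \<le> r"
      by (rule insert.IH) (use insert True E1 in \<open>auto simp: E1_def\<close>)
    then show ?thesis unfolding E1_def by blast
  next
    case False
    have U: "U \<in> fmeasurable M" "measure M U < \<delta>" using insert.prems(1) by auto
    have "measure M E \<le> measure M (E1 \<union> U)"
      by (rule measure_mono_fmeasurable)
        (use insert.prems E1 U in \<open>auto simp: E1_def intro: fmeasurable.Un\<close>)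
    also have "\<dots> \<le> measure M E1 + measure M U"
      using E1 U by (intro measure_Un_le) auto
    finally have "r - \<delta> < measure M E1" using insert.prems(5) U(2) by linarith
    then show ?thesis using False E1 by (intro exI[of _ E1]) (auto simp: E1_def)
  qed
qed

text \<open>An increasing sequence with defects below \<open>1 / Suc n\<close> is built by
  repeatedly filling up from the remaining set, and its union has exact measure \<open>m\<close>.
  Compactness of \<open>C\<close> supplies the finite covers by sets of small measure.\<close>

lemma subset_of_measure:
  assumes E: "E \<in> sets M" "E \<subseteq> C" "compact C" and m: "0 \<le> m" "m \<le> measure M E"
  obtains E' where "E' \<subseteq> E" "E' \<in> sets M" "measure M E' = m"
proof -
  have Ef: "E \<in> fmeasurable M" using fmeasurable_of_compact E by blast
  have step: "\<exists>E'\<subseteq>A. E' \<in> sets M \<and> r - \<delta> < measure M E' \<and> measure M E' \<le> r"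
    if "A \<in> fmeasurable M" "A \<subseteq> E" "0 \<le> r" "r \<le> measure M A" "\<delta> > 0" for A r \<delta>
  proof -
    have "\<exists>U. open U \<and> x \<in> U \<and> U \<in> fmeasurable M \<and> measure M U < \<delta>" for x
      using small_neighbourhood[OF \<open>\<delta> > 0\<close>, of x] by metis
    then obtain U where U: "\<And>x. open (U x)" "\<And>x. x \<in> U x" "\<And>x. U x \<in> fmeasurable M"
      "\<And>x. measure M (U x) < \<delta>" by metis
    obtain D where D: "finite D" "C \<subseteq> (\<Union>x\<in>D. U x)"
      by (rule compactE_image[OF E(3), of UNIV U]) (use U in blast)+
    show ?thesis
      by (rule approximate_subset[of "U ` D" \<delta>]) (use D U that E in auto)
  qed
  define P where "P n X \<longleftrightarrow> X \<subseteq> E \<and> X \<in> sets M \<and> m - 1 / Suc n < measure M X \<and> measure M X \<le> m"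
    for n X
  have "\<exists>X. \<forall>n. P n (X n) \<and> X n \<subseteq> X (Suc n)"
  proof (rule dependent_nat_choice)
    show "\<exists>X. P 0 X"
      using step[of E m 1] Ef m unfolding P_def by auto
    fix X n assume P: "P n X"
    have Xf: "X \<in> fmeasurable M" using P Ef fmeasurableI2 unfolding P_def by blast
    have Df: "E - X \<in> fmeasurable M" using Ef Xf by (intro fmeasurable_Diff) auto
    have dm: "measure M (E - X) = measure M E - measure M X"
      using P Ef Xf by (intro measurable_measure_Diff) (auto simp: P_def)
    obtain Y where Y: "Y \<subseteq> E - X" "Y \<in> sets M"
      "m - measure M X - 1 / Suc (Suc n) < measure M Y" "measure M Y \<le> m - measure M X"
      using step[of "E - X" "m - measure M X" "1 / Suc (Suc n)"] Df dm P m unfolding P_def by auto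
    have "Y \<in> fmeasurable M" using Y Df fmeasurableI2 by blast
    then have "measure M (X \<union> Y) = measure M X + measure M Y"
      using Xf Y by (intro measure_Union) (auto dest: fmeasurableD2)
    then have "P (Suc n) (X \<union> Y)" using P Y unfolding P_def by auto
    then show "\<exists>Y. P (Suc n) Y \<and> X \<subseteq> Y" by blast
  qed
  then obtain X where X: "\<And>n. P n (X n)" "\<And>n. X n \<subseteq> X (Suc n)" by blast
  have sub: "(\<Union>n. X n) \<subseteq> E" and ms: "(\<Union>n. X n) \<in> sets M" using X(1) unfolding P_def by blast+
  have fin: "(\<Union>n. X n) \<in> fmeasurable M" using fmeasurableI2[OF Ef sub ms] .
  have l1: "(\<lambda>n. measure M (X n)) \<longlonglongrightarrow> measure M (\<Union>n. X n)"
    by (rule Lim_measure_incseq)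
      (use X fin fmeasurableD2[OF fin] in \<open>auto simp: P_def intro!: incseq_SucI\<close>)
  have "(\<lambda>n. m - 1 / Suc n) \<longlonglongrightarrow> m - 0"
    by (intro tendsto_intros LIMSEQ_Suc lim_1_over_n)
  then have l0: "(\<lambda>n. m - 1 / Suc n) \<longlonglongrightarrow> m" by simp
  have "\<forall>\<^sub>F n in sequentially. m - 1 / Suc n \<le> measure M (X n)"
    using X(1) unfolding P_def by (intro always_eventually allI less_imp_le) blast
  moreover have "\<forall>\<^sub>F n in sequentially. measure M (X n) \<le> m"
    using X(1) unfolding P_def by (intro always_eventually allI) blast
  ultimately have l2: "(\<lambda>n. measure M (X n)) \<longlonglongrightarrow> m"
    by (rule tendsto_sandwich[OF _ _ l0 tendsto_const])
  show ?thesis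
    by (rule that[OF sub ms LIMSEQ_unique[OF l1 l2]])
qed

section \<open>Localization operators\<close>

definition energy :: "'g set \<Rightarrow> 'h \<Rightarrow> real" where
  "energy \<Omega> f = (LINT x:\<Omega>|M. (cmod (W f x))\<^sup>2)"

lemma set_integrable_continuous:
  fixes u :: "'g \<Rightarrow> 'b::{banach, second_countable_topology}"
  assumes "\<Omega> \<in> fmeasurable M" "continuous_on UNIV u" "\<And>x. norm (u x) \<le> B"
  shows "set_integrable M \<Omega> u"
  unfolding set_integrable_def
  by (rule integrableI_bounded_set_indicator[where B = B])
    (use assms in \<open>auto simp: continuous_measurable fmeasurable_def\<close>)

lemma cont_energy_density: "continuous_on UNIV (\<lambda>x. (cmod (W f x))\<^sup>2)"
  by (intro continuous_intros cont_W)

lemma energy_density_le: "(cmod (W f x))\<^sup>2 \<le> (norm f)\<^sup>2"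
  by (intro power_mono W_le norm_ge_zero)

lemma set_integrable_energy:
  "\<Omega> \<in> fmeasurable M \<Longrightarrow> set_integrable M \<Omega> (\<lambda>x. (cmod (W f x))\<^sup>2)"
  by (rule set_integrable_continuous[OF _ cont_energy_density, where B = "(norm f)\<^sup>2"])
    (simp_all add: energy_density_le)

lemma energy_nonneg: "0 \<le> energy \<Omega> f"
  unfolding energy_def set_lebesgue_integral_def by (rule integral_nonneg_AE) simp

lemma set_integral_const:
  "\<Omega> \<in> fmeasurable M \<Longrightarrow> (LINT x:\<Omega>|M. (b::real)) = b * measure M \<Omega>"
  by (simp add: set_lebesgue_integral_def fmeasurable_def)

lemma energy_le:
  assumes "\<Omega> \<in> fmeasurable M" "\<And>x. x \<in> \<Omega> \<Longrightarrow> cmod (W f x) \<le> b"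
  shows "energy \<Omega> f \<le> b\<^sup>2 * measure M \<Omega>"
proof -
  have "energy \<Omega> f \<le> (LINT x:\<Omega>|M. b\<^sup>2)"
    unfolding energy_def
    by (intro set_integral_mono set_integrable_energy set_integrable_continuous[of _ _ "b\<^sup>2"] assms)
      (auto intro!: power_mono assms)
  then show ?thesis by (simp add: set_integral_const assms)
qed

lemma energy_le_measure: "\<Omega> \<in> fmeasurable M \<Longrightarrow> energy \<Omega> f \<le> (norm f)\<^sup>2 * measure M \<Omega>"
  by (rule energy_le[OF _ W_le])

lemma sum_energy:
  assumes "\<Omega> \<in> fmeasurable M"
  shows "(\<Sum>i<n. energy \<Omega> (f i)) = (LINT x:\<Omega>|M. (\<Sum>i<n. (cmod (W (f i) x))\<^sup>2))"
  using set_integrable_energy[OF assms] unfolding energy_def set_lebesgue_integral_def set_integrable_def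
  by (simp add: sum_distrib_left)

lemma energy_Un:
  assumes "A \<in> fmeasurable M" "B \<in> fmeasurable M" "A \<inter> B = {}"
  shows "energy (A \<union> B) f = energy A f + energy B f"
  unfolding energy_def
  by (intro set_integral_Un set_integrable_energy assms)

lemma energy_mono:
  assumes "A \<subseteq> B" "A \<in> sets M" "B \<in> fmeasurable M"
  shows "energy A f \<le> energy B f"
proof -
  have "A \<in> fmeasurable M" "B - A \<in> fmeasurable M"
    using assms by (auto intro: fmeasurableI2 fmeasurable_Diff)
  moreover have "A \<union> (B - A) = B" using assms by blast
  ultimately have "energy B f = energy A f + energy (B - A) f"
    using energy_Un[of A "B - A" f] by (simp only: Diff_disjoint)
  then show ?thesis using energy_nonneg[of "B - A" f] by simp
qed

lemma energy_translate: "\<Omega> \<in> sets M \<Longrightarrow> energy ((+) y ` \<Omega>) (\<pi> y f) = energy \<Omega> f"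
proof -
  assume \<Omega>: "\<Omega> \<in> sets M"
  have meas: "(\<lambda>x. indicator ((+) y ` \<Omega>) x *\<^sub>R (cmod (W (\<pi> y f) x))\<^sup>2) \<in> borel_measurable M"
    by (intro borel_measurable_scaleR borel_measurable_indicator translation_sets \<Omega>
        continuous_measurable cont_energy_density)
  have "energy ((+) y ` \<Omega>) (\<pi> y f)
      = (LINT x|distr M M ((+) y). indicator ((+) y ` \<Omega>) x *\<^sub>R (cmod (W (\<pi> y f) x))\<^sup>2)"
    by (simp add: energy_def set_lebesgue_integral_def distr_translation)
  also have "\<dots> = (LINT x|M. indicator ((+) y ` \<Omega>) (y + x) *\<^sub>R (cmod (W (\<pi> y f) (y + x)))\<^sup>2)"
    by (rule integral_distr[OF translation_measurable meas])
  also have "\<dots> = energy \<Omega> f"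
    unfolding energy_def set_lebesgue_integral_def
    by (intro Bochner_Integration.integral_cong)
      (auto simp: cmod_W_translate indicator_def)
  finally show ?thesis .
qed

definition loc_form :: "'g set \<Rightarrow> 'h \<Rightarrow> 'h \<Rightarrow> complex" where
  "loc_form \<Omega> f g = (LINT x:\<Omega>|M. W f x * cnj (W g x))"

lemma set_integrable_loc_form:
  assumes "\<Omega> \<in> fmeasurable M" shows "set_integrable M \<Omega> (\<lambda>x. W f x * cnj (W g x))"
  by (rule set_integrable_continuous[OF assms, of _ "norm f * norm g"])
    (auto intro!: continuous_intros cont_W mult_mono W_le simp: norm_mult)

lemma loc_form_bound:
  assumes "\<Omega> \<in> fmeasurable M" "\<And>x. x \<in> \<Omega> \<Longrightarrow> cmod (W f x) \<le> a" "\<And>x. x \<in> \<Omega> \<Longrightarrow> cmod (W g x) \<le> b" "0 \<le> a"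
  shows "cmod (loc_form \<Omega> f g) \<le> a * b * measure M \<Omega>"
proof -
  have "cmod (loc_form \<Omega> f g) \<le> (LINT x:\<Omega>|M. cmod (W f x * cnj (W g x)))"
    unfolding loc_form_def by (rule set_integral_norm_bound[OF set_integrable_loc_form[OF assms(1)]])
  also have "\<dots> \<le> (LINT x:\<Omega>|M. a * b)"
    by (intro set_integral_mono set_integrable_norm set_integrable_loc_form assms(1)
        set_integrable_continuous[of _ _ "norm (a * b)"])
      (auto simp: norm_mult intro!: mult_mono assms)
  finally show ?thesis by (simp add: set_integral_const assms mult_ac)
qed

lemma loc_form_Un:
  assumes "A \<in> fmeasurable M" "B \<in> fmeasurable M" "A \<inter> B = {}"
  shows "loc_form (A \<union> B) f g = loc_form A f g + loc_form B f g"
  unfolding loc_form_def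
  by (intro set_integral_Un set_integrable_loc_form assms)

lemma cnj_loc_form: "cnj (loc_form \<Omega> f g) = loc_form \<Omega> g f"
proof -
  have "cnj (loc_form \<Omega> f g) = (CLINT x|M. cnj (indicator \<Omega> x *\<^sub>R (W f x * cnj (W g x))))"
    unfolding loc_form_def set_lebesgue_integral_def by (rule Bochner_Integration.integral_cnj[symmetric])
  also have "\<dots> = loc_form \<Omega> g f"
    unfolding loc_form_def set_lebesgue_integral_def
    by (intro Bochner_Integration.integral_cong) (simp_all add: mult.commute)
  finally show ?thesis .
qed

abbreviation "L \<equiv> localization_op M \<pi> \<psi>"

text \<open>Resolves the definite description in \<open>localization_op\<close>: Riesz gives
  existence, and an operator is determined by its form.\<close>

lemma cinner_L:
  assumes \<Omega>: "\<Omega> \<in> fmeasurable M"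
  shows "cinner (L \<Omega> f) g = loc_form \<Omega> f g"
proof -
  obtain T where T: "\<And>f g. cinner (T f) g = loc_form \<Omega> f g"
  proof (rule bounded_sesquilinear_operator[of "loc_form \<Omega>" "measure M \<Omega>"])
    show "loc_form \<Omega> (x + y) g = loc_form \<Omega> x g + loc_form \<Omega> y g" for x y g
      unfolding loc_form_def W_add distrib_right
      by (intro set_integral_add set_integrable_loc_form \<Omega>)
    show "loc_form \<Omega> (a *\<^sub>C x) g = a * loc_form \<Omega> x g" for a x g
      unfolding loc_form_def W_scaleC mult.assoc by simp
    show "loc_form \<Omega> f g = cnj (loc_form \<Omega> g f)" for f g
      by (simp add: cnj_loc_form)
    show "cmod (loc_form \<Omega> f g) \<le> measure M \<Omega> * norm f * norm g" for f g
      using loc_form_bound[OF \<Omega> W_le W_le norm_ge_zero, of f g] by (simp add: mult_ac)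
  qed blast
  have "\<forall>f g. cinner (L \<Omega> f) g = (LINT x:\<Omega>|M. W f x * cnj (W g x))"
    unfolding localization_op_def
  proof (rule theI[where a = T])
    show "\<forall>f g. cinner (T f) g = (LINT x:\<Omega>|M. W f x * cnj (W g x))"
      using T by (simp add: loc_form_def)
    show "S = T" if "\<forall>f g. cinner (S f) g = (LINT x:\<Omega>|M. W f x * cnj (W g x))" for S
      using that T by (intro ext cinner_ext) (simp add: loc_form_def)
  qed
  then show ?thesis by (simp add: loc_form_def)
qed

lemma qform_L:
  assumes \<Omega>: "\<Omega> \<in> fmeasurable M"
  shows "qform (L \<Omega>) f = energy \<Omega> f"
proof -
  have "cinner (L \<Omega> f) f = (LINT x:\<Omega>|M. complex_of_real ((cmod (W f x))\<^sup>2))"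
    by (simp only: cinner_L[OF \<Omega>] loc_form_def complex_norm_square)
  also have "\<dots> = complex_of_real (energy \<Omega> f)"
    by (simp only: energy_def set_integral_complex_of_real)
  finally show ?thesis by (simp add: qform_def)
qed

text \<open>At each \<open>x\<close> this is the Bessel property tested on the unit vector
  \<open>\<pi> x \<psi>\<close>. Integration then bounds the trace of \<open>L \<Omega>\<close> by
  the measure of \<open>\<Omega>\<close>.\<close>

lemma W_Bessel:
  assumes "Bessel_family n f" shows "(\<Sum>i<n. (cmod (W (f i) x))\<^sup>2) \<le> 1"
proof -
  have "(\<Sum>i<n. (cmod (W (f i) x))\<^sup>2) = (\<Sum>i<n. (cmod (cinner (\<pi> x \<psi>) (f i)))\<^sup>2)"
    by (subst cinner_commute) (simp add: wavelet_transform_def)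
  also have "\<dots> \<le> (norm (\<pi> x \<psi>))\<^sup>2" using assms unfolding Bessel_family_def by blast
  finally show ?thesis by simp
qed

lemma cont_sum_density: "continuous_on UNIV (\<lambda>x. \<Sum>i<n. (cmod (W (f i) x))\<^sup>2)"
  by (intro continuous_intros cont_W)

lemma sum_energy_le_measure:
  assumes "Bessel_family n f" "\<Omega> \<in> fmeasurable M"
  shows "(\<Sum>i<n. energy \<Omega> (f i)) \<le> measure M \<Omega>"
proof -
  have "(LINT x:\<Omega>|M. (\<Sum>i<n. (cmod (W (f i) x))\<^sup>2)) \<le> (LINT x:\<Omega>|M. 1)"
    by (intro set_integral_mono set_integrable_continuous[of _ _ 1] assms cont_sum_density)
      (auto simp: W_Bessel[OF assms(1)] sum_nonneg)
  then show ?thesis by (simp add: sum_energy set_integral_const assms)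
qed

lemma trace_bounded_L:
  assumes \<Omega>: "\<Omega> \<in> fmeasurable M"
  shows "trace_bounded (L \<Omega>) (measure M \<Omega>)"
proof
  show "cinner (L \<Omega> f) g = cinner f (L \<Omega> g)" for f g
    by (subst (2) cinner_commute) (simp add: cinner_L[OF \<Omega>] cnj_loc_form)
  show "0 \<le> qform (L \<Omega>) f" for f by (simp add: qform_L[OF \<Omega>] energy_nonneg)
  show "(\<Sum>i<N. qform (L \<Omega>) (e i)) \<le> measure M \<Omega>" if "orthonormal N e" for N e
    using sum_energy_le_measure[OF orthonormal_Bessel[OF that] \<Omega>] by (simp add: qform_L[OF \<Omega>])
qed

definition esum :: "'g set \<Rightarrow> nat \<Rightarrow> real" where
  "esum \<Omega> K = (\<Sum>k=1..K. loc_eigenvalue M \<pi> \<psi> \<Omega> k)"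

lemma esum_spectral:
  assumes "\<Omega> \<in> fmeasurable M"
  obtains e l where "spectral_seq (L \<Omega>) e l" "\<And>K. esum \<Omega> K = (\<Sum>j<K. l j)"
proof -
  interpret trace_bounded "L \<Omega>" "measure M \<Omega>" by (rule trace_bounded_L[OF assms])
  obtain e l where el: "spectral_seq (L \<Omega>) e l" by (rule spectral_seq_exists[OF inf_dim])
  show ?thesis
    using spec_sum_nth_eigenvalue[OF el]
    by (intro that[OF el]) (simp only: esum_def loc_eigenvalue_def)
qed

text \<open>Ky Fan's variational principle. Together with \<open>esum_attained\<close> it identifies
  \<open>esum \<Omega> K\<close> as a maximum over orthonormal families, so that sets can be
  compared by testing families.\<close>

lemma esum_ge:
  assumes "\<Omega> \<in> fmeasurable M" "orthonormal K f"
  shows "(\<Sum>i<K. energy \<Omega> (f i)) \<le> esum \<Omega> K"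
proof -
  interpret trace_bounded "L \<Omega>" "measure M \<Omega>" by (rule trace_bounded_L[OF assms(1)])
  obtain e l where el: "spectral_seq (L \<Omega>) e l" "\<And>K. esum \<Omega> K = (\<Sum>j<K. l j)"
    by (rule esum_spectral[OF assms(1)]) blast
  show ?thesis
    using Ky_Fan_orthonormal[OF el(1) assms(2)] by (simp add: el(2) qform_L[OF assms(1)])
qed

lemma esum_attained:
  assumes "\<Omega> \<in> fmeasurable M"
  obtains f where "orthonormal K f" "(\<Sum>i<K. energy \<Omega> (f i)) = esum \<Omega> K"
proof -
  interpret trace_bounded "L \<Omega>" "measure M \<Omega>" by (rule trace_bounded_L[OF assms])
  obtain e l where el: "spectral_seq (L \<Omega>) e l" "\<And>K. esum \<Omega> K = (\<Sum>j<K. l j)"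
    by (rule esum_spectral[OF assms]) blast
  show ?thesis
    using that[OF spec_orthonormal[OF el(1)]] spec_qform[OF el(1)]
    by (simp add: el(2) qform_L[OF assms])
qed

lemma esum_le_measure:
  assumes "\<Omega> \<in> fmeasurable M" shows "esum \<Omega> K \<le> measure M \<Omega>"
  using esum_attained[OF assms] sum_energy_le_measure[OF orthonormal_Bessel assms] by metis

lemma esum_nonneg:
  assumes "\<Omega> \<in> fmeasurable M" shows "0 \<le> esum \<Omega> K"
  using esum_attained[OF assms, of K] energy_nonneg by (metis sum_nonneg)

lemma esum_0 [simp]: "esum \<Omega> 0 = 0"
  by (simp add: esum_def)

lemma esum_mono:
  assumes "A \<subseteq> B" "A \<in> sets M" "B \<in> fmeasurable M"
  shows "esum A K \<le> esum B K"
proof -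
  have A: "A \<in> fmeasurable M" using assms fmeasurableI2 by blast
  obtain f where f: "orthonormal K f" "(\<Sum>i<K. energy A (f i)) = esum A K"
    by (rule esum_attained[OF A])
  have "esum A K \<le> (\<Sum>i<K. energy B (f i))"
    unfolding f(2)[symmetric] by (intro sum_mono energy_mono assms)
  also have "\<dots> \<le> esum B K" by (rule esum_ge[OF assms(3) f(1)])
  finally show ?thesis .
qed

lemma esum_translate:
  assumes "\<Omega> \<in> fmeasurable M" shows "esum \<Omega> K \<le> esum ((+) y ` \<Omega>) K"
proof -
  obtain f where f: "orthonormal K f" "(\<Sum>i<K. energy \<Omega> (f i)) = esum \<Omega> K"
    by (rule esum_attained[OF assms])
  have "orthonormal K (\<lambda>i. \<pi> y (f i))" using f(1) by (simp add: orthonormal_def rep_cinner)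
  from esum_ge[OF translation_fmeasurable[OF assms, of y] this] show ?thesis
    using f(2) assms by (simp add: energy_translate fmeasurableD)
qed

text \<open>Each top eigenframe lies in the span of the orthonormal family \<open>h\<close>, so by Parseval the
  trace over \<open>h\<close> sees all the selected eigenvalues; the two frames need not be orthogonal to each
  other.\<close>

lemma esum_disjoint_Un:
  assumes A: "A \<in> fmeasurable M" and B: "B \<in> fmeasurable M" and "A \<inter> B = {}"
  shows "esum A k1 + esum B k2 \<le> esum (A \<union> B) (k1 + k2)"
proof -
  let ?n = "k1 + k2"
  obtain e1 l1 where s1: "spectral_seq (L A) e1 l1" "\<And>K. esum A K = (\<Sum>j<K. l1 j)"
    by (rule esum_spectral[OF A]) blast
  obtain e2 l2 where s2: "spectral_seq (L B) e2 l2" "\<And>K. esum B K = (\<Sum>j<K. l2 j)"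
    by (rule esum_spectral[OF B]) blast
  interpret A: trace_bounded "L A" "measure M A" by (rule trace_bounded_L[OF A])
  interpret B: trace_bounded "L B" "measure M B" by (rule trace_bounded_L[OF B])
  obtain h where h: "orthonormal ?n h"
    "\<And>j. j < ?n \<Longrightarrow> proj ?n h (if j < k1 then e1 j else e2 (j - k1)) = (if j < k1 then e1 j else e2 (j - k1))"
    using Gram_Schmidt[OF inf_dim, of ?n "\<lambda>j. if j < k1 then e1 j else e2 (j - k1)"] by blast
  have h1: "proj ?n h (e1 j) = e1 j" if "j < k1" for j using h(2)[of j] that by simp
  have h2: "proj ?n h (e2 j) = e2 j" if "j < k2" for j using h(2)[of "k1 + j"] that by simp
  have parseval: "(\<Sum>i<?n. (cmod (cinner (h i) v))\<^sup>2) = 1" if "proj ?n h v = v" "norm v = 1" for v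
    using norm_proj_sq[OF h(1), of v] that
    by (subst cinner_commute) simp
  have "(\<Sum>i<?n. \<Sum>j<k1. l1 j * (cmod (cinner (h i) (e1 j)))\<^sup>2) = esum A k1"
    by (subst sum.swap) (simp add: parseval h1 A.spec_norm[OF s1(1)] s1(2) flip: sum_distrib_left)
  moreover have "(\<Sum>i<?n. \<Sum>j<k2. l2 j * (cmod (cinner (h i) (e2 j)))\<^sup>2) = esum B k2"
    by (subst sum.swap) (simp add: parseval h2 B.spec_norm[OF s2(1)] s2(2) flip: sum_distrib_left)
  ultimately have "esum A k1 + esum B k2 = (\<Sum>i<?n. (\<Sum>j<k1. l1 j * (cmod (cinner (h i) (e1 j)))\<^sup>2)
      + (\<Sum>j<k2. l2 j * (cmod (cinner (h i) (e2 j)))\<^sup>2))"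
    by (simp add: sum.distrib)
  also have "\<dots> \<le> (\<Sum>i<?n. energy A (h i) + energy B (h i))"
    unfolding qform_L[OF A, symmetric] qform_L[OF B, symmetric]
    by (intro sum_mono add_mono A.spec_lower[OF s1(1)] B.spec_lower[OF s2(1)])
  also have "\<dots> = (\<Sum>i<?n. energy (A \<union> B) (h i))"
    by (simp add: energy_Un[OF assms])
  also have "\<dots> \<le> esum (A \<union> B) ?n"
    using A B h(1) by (intro esum_ge) auto
  finally show ?thesis .
qed

section \<open>Superlevel sets\<close>

definition relatively_compact :: "'g set \<Rightarrow> bool" where
  "relatively_compact \<Omega> \<longleftrightarrow> \<Omega> \<in> sets M \<and> (\<exists>C. compact C \<and> \<Omega> \<subseteq> C)"

lemma relatively_compact_fmeasurable: "relatively_compact \<Omega> \<Longrightarrow> \<Omega> \<in> fmeasurable M"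
  unfolding relatively_compact_def using fmeasurable_of_compact by blast

lemma relatively_compact_Un:
  "relatively_compact A \<Longrightarrow> relatively_compact B \<Longrightarrow> relatively_compact (A \<union> B)"
  unfolding relatively_compact_def by (meson Un_mono compact_Un sets.Un)

lemma relatively_compact_translate:
  "relatively_compact A \<Longrightarrow> relatively_compact ((+) x ` A)"
  unfolding relatively_compact_def by (meson compact_translation_group image_mono translation_sets)

lemma density_vanishes:
  fixes f :: "nat \<Rightarrow> 'h"
  assumes "\<epsilon> > 0"
  shows "\<exists>C. compact C \<and> (\<forall>x. x \<notin> C \<longrightarrow> (\<Sum>i<n. (cmod (W (f i) x))\<^sup>2) < \<epsilon>)"
proof -
  define \<delta> where "\<delta> = sqrt (\<epsilon> / (real n + 1))"
  have \<delta>: "\<delta> > 0" "\<delta>\<^sup>2 = \<epsilon> / (real n + 1)" using assms by (simp_all add: \<delta>_def)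
  obtain C where C: "compact C" "\<And>x i. x \<notin> C \<Longrightarrow> i < n \<Longrightarrow> cmod (W (f i) x) < \<delta>"
    using W_vanishes_uniformly[OF \<delta>(1), of n f] by blast
  have "(\<Sum>i<n. (cmod (W (f i) x))\<^sup>2) < \<epsilon>" if "x \<notin> C" for x
  proof -
    have "(\<Sum>i<n. (cmod (W (f i) x))\<^sup>2) \<le> (\<Sum>i<n. \<delta>\<^sup>2)"
      using C(2)[OF that] by (intro sum_mono power_mono) (auto intro: less_imp_le)
    also have "\<dots> = real n * \<epsilon> / (real n + 1)" by (simp add: \<delta>(2))
    also have "\<dots> < \<epsilon>" using assms by (simp add: field_simps)
    finally show ?thesis .
  qed
  then show ?thesis using C(1) by blast
qed

text \<open>On the zero set the transform of \<open>f 0\<close> vanishes, which the positivity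
  assumption forbids on sets of positive measure.\<close>

lemma density_zero_null:
  fixes f :: "nat \<Rightarrow> 'h"
  assumes "orthonormal K f" "K \<ge> 1"
  shows "emeasure M {x. (\<Sum>i<K. (cmod (W (f i) x))\<^sup>2) = 0} = 0"
proof (rule ccontr)
  let ?Z = "{x. (\<Sum>i<K. (cmod (W (f i) x))\<^sup>2) = 0}"
  assume "emeasure M ?Z \<noteq> 0"
  then have pos: "emeasure M ?Z > 0" by (simp add: zero_less_iff_neq_zero)
  have "closed ?Z"
    by (intro closed_Collect_eq cont_sum_density continuous_on_const)
  then have Z: "?Z \<in> sets M" by (simp add: sets_M)
  have "f 0 \<noteq> 0" using orthonormal_norm[OF assms(1), of 0] assms(2) by auto
  moreover have "(\<integral>\<^sup>+ x\<in>?Z. ennreal ((cmod (W (f 0) x))\<^sup>2) \<partial>M) = (\<integral>\<^sup>+ x. 0 \<partial>M)"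
  proof (rule nn_integral_cong)
    fix x
    have "W (f 0) x = 0" if "x \<in> ?Z"
      using that assms(2) by (simp add: sum_nonneg_eq_0_iff)
    then show "ennreal ((cmod (W (f 0) x))\<^sup>2) * indicator ?Z x = 0"
      by (auto simp: indicator_def)
  qed
  ultimately show False using positive[OF Z pos, of "f 0"] by simp
qed

text \<open>A superlevel set of the density \<open>u\<close> is topped up to the exact measure with
  part of the level set. The slack is \<open>\<tau> * (measure M \<Omega>' - m)\<close>, and
  \<open>0 \<le> \<tau> \<le> 1\<close> because \<open>u \<le> 1\<close>.\<close>

lemma bathtub:
  fixes f :: "nat \<Rightarrow> 'h"
  assumes f: "orthonormal K f" "K \<ge> 1" and m: "0 \<le> m"
  obtains \<Omega> where "relatively_compact \<Omega>" "measure M \<Omega> = m"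
    "\<And>\<Omega>'. \<Omega>' \<in> fmeasurable M \<Longrightarrow>
       (\<Sum>i<K. energy \<Omega>' (f i)) \<le> (\<Sum>i<K. energy \<Omega> (f i)) + max 0 (measure M \<Omega>' - m)"
proof -
  define u where "u x = (\<Sum>i<K. (cmod (W (f i) x))\<^sup>2)" for x
  have cu: "continuous_on UNIV u" unfolding u_def by (rule cont_sum_density)
  have u1: "u x \<le> 1" and u0: "0 \<le> u x" for x
    unfolding u_def using W_Bessel[OF orthonormal_Bessel[OF f(1)]] by (simp_all add: sum_nonneg)
  define A where "A \<tau> = {x. \<tau> < u x}" for \<tau>
  have Ao: "open (A \<tau>)" for \<tau>
    unfolding A_def by (intro open_Collect_less cu continuous_on_const)
  note As = open_sets[OF Ao]
  have Ac: "relatively_compact (A \<tau>)" if pos: "\<tau> > 0" for \<tau>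
  proof -
    obtain C where C: "compact C" "\<And>x. x \<notin> C \<Longrightarrow> u x < \<tau>"
      using density_vanishes[OF pos, where n = K and f = f] unfolding u_def by blast
    have "A \<tau> \<subseteq> C" unfolding A_def using C(2) by (metis (mono_tags, lifting) less_asym mem_Collect_eq subsetI)
    then show ?thesis unfolding relatively_compact_def using As C(1) by blast
  qed
  define Z where "Z = {\<tau>. \<tau> > 0 \<and> emeasure M (A \<tau>) \<le> ennreal m}"
  have "A 1 = {}" using u1 by (auto simp: A_def not_less)
  then have Zne: "Z \<noteq> {}" unfolding Z_def by (auto intro!: exI[of _ 1])
  have Zbdd: "bdd_below Z" unfolding Z_def by (intro bdd_belowI[of _ 0]) auto
  define \<tau> where "\<tau> = Inf Z"
  have \<tau>0: "0 \<le> \<tau>" unfolding \<tau>_def by (rule cInf_greatest[OF Zne]) (simp add: Z_def)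
  have \<tau>1: "\<tau> \<le> 1"
    unfolding \<tau>_def by (rule cInf_lower[OF _ Zbdd]) (simp add: Z_def \<open>A 1 = {}\<close>)
  have A\<tau>: "emeasure M (A \<tau>) \<le> ennreal m"
  proof -
    have "A \<tau> = (\<Union>n. A (\<tau> + 1 / Suc n))"
    proof (intro equalityI subsetI)
      fix x assume "x \<in> A \<tau>"
      then have "0 < u x - \<tau>" by (simp add: A_def)
      then obtain n where "1 / Suc n < u x - \<tau>" using reals_Archimedean by (metis inverse_eq_divide)
      then have "x \<in> A (\<tau> + 1 / Suc n)" by (simp add: A_def)
      then show "x \<in> (\<Union>n. A (\<tau> + 1 / Suc n))" by blast
    next
      fix x assume "x \<in> (\<Union>n. A (\<tau> + 1 / Suc n))"
      then obtain n where "\<tau> + 1 / Suc n < u x" by (auto simp: A_def)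
      moreover have "0 < 1 / real (Suc n)" by simp
      ultimately show "x \<in> A \<tau>" unfolding A_def mem_Collect_eq by linarith
    qed
    also have "emeasure M \<dots> = (SUP n. emeasure M (A (\<tau> + 1 / Suc n)))"
    proof (rule SUP_emeasure_incseq[symmetric])
      show "incseq (\<lambda>n. A (\<tau> + 1 / Suc n))"
      proof (rule incseq_SucI)
        fix n
        have "1 / real (Suc (Suc n)) \<le> 1 / Suc n" by (simp add: frac_le)
        then show "A (\<tau> + 1 / Suc n) \<subseteq> A (\<tau> + 1 / Suc (Suc n))" by (auto simp: A_def)
      qed
    qed (use As in auto)
    also have "\<dots> \<le> ennreal m"
    proof (rule SUP_least)
      fix n
      obtain t where t: "t \<in> Z" "t < \<tau> + 1 / Suc n"
        using cInf_less_iff[OF Zne Zbdd, of "\<tau> + 1 / Suc n"] unfolding \<tau>_def by auto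
      then have "emeasure M (A (\<tau> + 1 / Suc n)) \<le> emeasure M (A t)"
        by (intro emeasure_mono As) (auto simp: A_def)
      then show "emeasure M (A (\<tau> + 1 / Suc n)) \<le> ennreal m"
        using t(1) by (auto simp: Z_def intro: order_trans)
    qed
    finally show ?thesis .
  qed
  \<comment> \<open>At height 0 the superlevel set would be the whole group up to a null set, hence
    of infinite measure.\<close>
  have \<tau>pos: "\<tau> > 0"
  proof (rule ccontr)
    assume "\<not> \<tau> > 0"
    then have \<tau>eq: "\<tau> = 0" using \<tau>0 by simp
    have Z0: "{x. u x = 0} \<in> null_sets M"
      using density_zero_null[OF f] closed_Collect_eq[OF cu continuous_on_const, of 0]
      by (simp add: u_def null_sets_def sets_M)
    have "UNIV = A \<tau> \<union> {x. u x = 0}"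
      using u0 by (auto simp: A_def \<tau>eq less_le)
    then have "emeasure M UNIV = emeasure M (A \<tau>)"
      using emeasure_Un_null_set[OF As Z0, of \<tau>] by simp
    then show False using A\<tau> by (simp add: emeasure_UNIV top_unique)
  qed
  have A\<tau>f: "A \<tau> \<in> fmeasurable M" by (rule relatively_compact_fmeasurable[OF Ac[OF \<tau>pos]])
  have mA: "measure M (A \<tau>) \<le> m"
    using A\<tau> m by (simp add: emeasure_eq_measure2[OF A\<tau>f])
  define B where "B = {x. \<tau> \<le> u x}"
  have "closed B" unfolding B_def by (intro closed_Collect_le cu continuous_on_const)
  then have Bs: "B \<in> sets M" by (simp add: sets_M)
  have "B \<subseteq> A (\<tau> / 2)" using \<tau>pos by (auto simp: A_def B_def)
  then obtain C where C: "compact C" "B \<subseteq> C"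
    using Ac[of "\<tau> / 2"] \<tau>pos unfolding relatively_compact_def by (metis half_gt_zero order_trans)
  have Bf: "B \<in> fmeasurable M" using fmeasurable_of_compact[OF Bs C(2,1)] .
  have mB: "m \<le> measure M B"
  proof -
    \<comment> \<open>The levels lie below \<open>\<tau>\<close> and increase to it, so their
      superlevel sets have measure at least \<open>m\<close>; with \<open>n + 2\<close> in place of
      \<open>n + 1\<close> they are positive already at \<open>n = 0\<close>.\<close>
    define D where "D n = A (\<tau> - \<tau> / (real n + 2))" for n
    have pos: "0 < \<tau> - \<tau> / (real n + 2)" for n
      using \<tau>pos by (simp add: field_simps add_pos_nonneg)
    have BD: "B = (\<Inter>n. D n)"
    proof (intro equalityI subsetI)
      fix x assume "x \<in> B"
      then have "\<tau> \<le> u x" by (simp add: B_def)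
      moreover have "0 < \<tau> / (real n + 2)" for n using \<tau>pos by simp
      ultimately have "\<tau> - \<tau> / (real n + 2) < u x" for n by (smt (verit))
      then show "x \<in> (\<Inter>n. D n)" by (simp add: D_def A_def)
    next
      fix x assume "x \<in> (\<Inter>n. D n)"
      then have x: "\<tau> - \<tau> / (real n + 2) \<le> u x" for n by (simp add: D_def A_def less_imp_le)
      have "filterlim (\<lambda>n. real n + 2) at_top sequentially"
        by (rule filterlim_tendsto_add_at_top[OF tendsto_const filterlim_real_sequentially, of 2, simplified add.commute])
      then have "(\<lambda>n. \<tau> - \<tau> / (real n + 2)) \<longlonglongrightarrow> \<tau> - 0"
        by (intro tendsto_diff tendsto_const tendsto_divide_0[OF tendsto_const] filterlim_at_top_imp_at_infinity)
      then have "\<tau> - 0 \<le> u x" by (rule LIMSEQ_le_const2) (use x in blast)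
      then show "x \<in> B" by (simp add: B_def)
    qed
    have "(\<lambda>n. measure M (D n)) \<longlonglongrightarrow> measure M (\<Inter>n. D n)"
    proof (rule Lim_measure_decseq)
      show "decseq D"
      proof (rule decseq_SucI)
        fix n
        have "\<tau> / (real (Suc n) + 2) \<le> \<tau> / (real n + 2)" using \<tau>pos by (intro divide_left_mono) auto
        then show "D (Suc n) \<subseteq> D n" by (auto simp: D_def A_def)
      qed
      show "emeasure M (D n) \<noteq> \<infinity>" for n
        using relatively_compact_fmeasurable[OF Ac[OF pos]] fmeasurableD2 unfolding D_def by auto
    qed (auto simp: D_def As)
    moreover have "m \<le> measure M (D n)" for n
    proof -
      have "\<tau> - \<tau> / (real n + 2) \<notin> Z"
      proof
        assume "\<tau> - \<tau> / (real n + 2) \<in> Z"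
        then have "\<tau> \<le> \<tau> - \<tau> / (real n + 2)" unfolding \<tau>_def by (rule cInf_lower[OF _ Zbdd])
        moreover have "0 < \<tau> / (real n + 2)" using \<tau>pos by simp
        ultimately show False by simp
      qed
      then have "\<not> emeasure M (D n) \<le> ennreal m" using pos by (simp add: Z_def D_def)
      then show ?thesis
        using emeasure_eq_measure2[OF relatively_compact_fmeasurable[OF Ac[OF pos]], of n]
        by (auto simp: D_def ennreal_leI not_le intro: linear dest: less_imp_le)
    qed
    ultimately show ?thesis unfolding BD by (intro LIMSEQ_le_const) auto
  qed
  have AB: "A \<tau> \<subseteq> B" by (auto simp: A_def B_def)
  have mBA: "measure M (B - A \<tau>) = measure M B - measure M (A \<tau>)"
    using AB Bf A\<tau>f by (intro measurable_measure_Diff) auto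
  obtain E where E: "E \<subseteq> B - A \<tau>" "E \<in> sets M" "measure M E = m - measure M (A \<tau>)"
    by (rule subset_of_measure[of "B - A \<tau>" C "m - measure M (A \<tau>)"]) (use Bs As C mA mB mBA in auto)
  have Ef: "E \<in> fmeasurable M" using fmeasurableI2[OF Bf _ E(2)] E(1) by blast
  define \<Omega> where "\<Omega> = A \<tau> \<union> E"
  have \<Omega>f: "\<Omega> \<in> fmeasurable M" unfolding \<Omega>_def using A\<tau>f Ef by (rule fmeasurable.Un)
  have m\<Omega>: "measure M \<Omega> = m"
    unfolding \<Omega>_def
    by (subst measure_Union) (use A\<tau>f Ef E in \<open>auto dest: fmeasurableD2\<close>)
  have int: "(LINT x:X|M. u x - \<tau>) = (\<Sum>i<K. energy X (f i)) - \<tau> * measure M X"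
    "set_integrable M X (\<lambda>x. u x - \<tau>)" if X: "X \<in> fmeasurable M" for X
  proof -
    have iu: "set_integrable M X u"
      by (rule set_integrable_continuous[OF X cu, where B = 1]) (use u0 u1 in simp)
    moreover have it: "set_integrable M X (\<lambda>_. \<tau>)"
      by (rule set_integrable_continuous[OF X continuous_on_const, where B = \<tau>]) (use \<tau>0 in simp)
    ultimately show "set_integrable M X (\<lambda>x. u x - \<tau>)" by (rule set_integral_diff)
    show "(LINT x:X|M. u x - \<tau>) = (\<Sum>i<K. energy X (f i)) - \<tau> * measure M X"
      unfolding set_integral_diff(2)[OF iu it] sum_energy[OF X] u_def[symmetric] set_integral_const[OF X] ..
  qed
  show ?thesis
  proof (rule that[OF _ m\<Omega>])
    show "relatively_compact \<Omega>"
      unfolding relatively_compact_def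
    proof (intro conjI exI)
      show "\<Omega> \<in> sets M" using \<Omega>f by blast
      show "\<Omega> \<subseteq> C" using AB C E by (auto simp: \<Omega>_def)
    qed (rule C)
    fix \<Omega>' assume \<Omega>': "\<Omega>' \<in> fmeasurable M"
    \<comment> \<open>Pointwise comparison: \<open>u - \<tau>\<close> is positive exactly on
      \<open>A \<tau>\<close>, which lies in \<open>\<Omega>\<close>, and it is 0 on
      \<open>E\<close>.\<close>
    have "(LINT x:\<Omega>'|M. u x - \<tau>) \<le> (LINT x:\<Omega>|M. u x - \<tau>)"
      unfolding set_lebesgue_integral_def
    proof (rule integral_mono)
      fix x
      show "indicat_real \<Omega>' x *\<^sub>R (u x - \<tau>) \<le> indicat_real \<Omega> x *\<^sub>R (u x - \<tau>)"
        using E(1) by (auto simp: indicator_def \<Omega>_def A_def B_def)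
    qed (use int(2) \<Omega>f \<Omega>' in \<open>auto simp: set_integrable_def\<close>)
    then have "(\<Sum>i<K. energy \<Omega>' (f i)) \<le> (\<Sum>i<K. energy \<Omega> (f i)) + \<tau> * (measure M \<Omega>' - m)"
      by (simp add: int(1) \<Omega>f \<Omega>' m\<Omega> algebra_simps)
    also have "\<tau> * (measure M \<Omega>' - m) \<le> max 0 (measure M \<Omega>' - m)"
    proof -
      have "\<tau> * (measure M \<Omega>' - m) \<le> \<tau> * max 0 (measure M \<Omega>' - m)"
        using \<tau>0 by (intro mult_left_mono) auto
      also have "\<dots> \<le> 1 * max 0 (measure M \<Omega>' - m)"
        using \<tau>1 by (intro mult_right_mono) auto
      finally show ?thesis by simp
    qed
    finally show "(\<Sum>i<K. energy \<Omega>' (f i)) \<le> (\<Sum>i<K. energy \<Omega> (f i)) + max 0 (measure M \<Omega>' - m)"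
      by simp
  qed
qed

lemma relatively_compact_of_measure:
  assumes "0 \<le> m" obtains \<Omega> where "relatively_compact \<Omega>" "measure M \<Omega> = m"
proof -
  have "orthonormal 1 (\<lambda>_. \<psi>)" by (simp add: orthonormal_def cinner_self_eq_1)
  from bathtub[OF this _ assms] show ?thesis using that by auto
qed

lemma disjoint_union_with_translate:
  assumes "relatively_compact A" "relatively_compact B"
  obtains x where "A \<inter> (+) x ` B = {}" "relatively_compact (A \<union> (+) x ` B)"
    "measure M (A \<union> (+) x ` B) = measure M A + measure M B"
proof -
  obtain C D where CD: "compact C" "A \<subseteq> C" "compact D" "B \<subseteq> D"
    using assms unfolding relatively_compact_def by blast
  obtain x where "C \<inter> (+) x ` D = {}"
    using exists_disjoint_translate[OF noncompact CD(1,3)] by blast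
  then have dis: "A \<inter> (+) x ` B = {}" using CD by blast
  note B' = relatively_compact_translate[OF assms(2), of x]
  have "measure M (A \<union> (+) x ` B) = measure M A + measure M ((+) x ` B)"
    using dis relatively_compact_fmeasurable[OF assms(1)] relatively_compact_fmeasurable[OF B']
    by (intro measure_Union) (auto dest: fmeasurableD2)
  then show ?thesis
    using that[OF dis relatively_compact_Un[OF assms(1) B']] assms(2)
    by (simp add: measure_translation relatively_compact_def)
qed

lemma glue:
  assumes A: "relatively_compact A" and B: "relatively_compact B"
  obtains \<Omega> where "relatively_compact \<Omega>" "measure M \<Omega> = measure M A + measure M B"
    "esum A k1 + esum B k2 \<le> esum \<Omega> (k1 + k2)"
proof -
  obtain x where x: "A \<inter> (+) x ` B = {}" "relatively_compact (A \<union> (+) x ` B)"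
    "measure M (A \<union> (+) x ` B) = measure M A + measure M B"
    by (rule disjoint_union_with_translate[OF A B])
  have Bf: "B \<in> fmeasurable M" by (rule relatively_compact_fmeasurable[OF B])
  have "esum A k1 + esum B k2 \<le> esum A k1 + esum ((+) x ` B) k2"
    by (intro add_left_mono esum_translate Bf)
  also have "\<dots> \<le> esum (A \<union> (+) x ` B) (k1 + k2)"
    by (intro esum_disjoint_Un relatively_compact_fmeasurable[OF A] translation_fmeasurable Bf x)
  finally show ?thesis using that x by blast
qed

end

text \<open>The bound is affine in the trace \<open>t\<close> of the first family between consecutive integers, so it
  is largest at an integer.\<close>

lemma merge_spectra:
  assumes T: "trace_bounded T c" "spectral_seq T a \<alpha>" and S: "trace_bounded S d" "spectral_seq S b \<beta>"
    and p: "Bessel_family n p" and q: "Bessel_family n q"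
    and sum: "(\<Sum>i<n. (norm (p i))\<^sup>2) + (\<Sum>i<n. (norm (q i))\<^sup>2) = real K"
  shows "\<exists>k\<le>K. (\<Sum>i<n. qform T (p i)) + (\<Sum>i<n. qform S (q i)) \<le> (\<Sum>j<k. \<alpha> j) + (\<Sum>j<K - k. \<beta> j)"
proof -
  interpret T: trace_bounded T c by fact
  interpret S: trace_bounded S d by fact
  define t where "t = (\<Sum>i<n. (norm (p i))\<^sup>2)"
  have t0: "0 \<le> t" unfolding t_def by (simp add: sum_nonneg)
  have tK: "t \<le> K" using sum sum_nonneg[of "{..<n}" "\<lambda>i. (norm (q i))\<^sup>2"] by (simp add: t_def)
  have t': "(\<Sum>i<n. (norm (q i))\<^sup>2) = real K - t" using sum by (simp add: t_def)
  define k where "k = nat \<lfloor>t\<rfloor>"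
  have k: "real k \<le> t" "t < real k + 1" unfolding k_def using t0 by linarith+
  have kK: "k \<le> K" using k(1) tK by linarith
  have bT: "(\<Sum>i<n. qform T (p i)) \<le> (\<Sum>j<k. \<alpha> j) + \<alpha> k * (t - real k)"
    using T.Ky_Fan[OF T(2) p, of k] by (simp add: t_def)
  show ?thesis
  proof (cases "k = K")
    case True
    then have "t = K" using k tK by simp
    then show ?thesis
      using bT S.Ky_Fan[OF S(2) q, of 0] True t' by (intro exI[of _ K]) simp
  next
    case False
    \<comment> \<open>Trace \<open>K - t\<close> is left for \<open>q\<close>, and it lies between
      the integers \<open>j\<close> and \<open>j + 1\<close>; for \<open>k = K\<close> there is no
      such natural number \<open>j\<close>.\<close>
    define j where "j = K - Suc k"
    have j: "K - k = Suc j" "K - Suc k = j" using False kK by (auto simp: j_def)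
    have jr: "real j = real K - real k - 1" using False kK by (simp add: j_def of_nat_diff)
    have bS: "(\<Sum>i<n. qform S (q i)) \<le> (\<Sum>i<j. \<beta> i) + \<beta> j * (1 - (t - real k))"
      using S.Ky_Fan[OF S(2) q, of j] by (simp add: t' jr algebra_simps)
    have th: "0 \<le> t - real k" "0 \<le> 1 - (t - real k)" using k by auto
    show ?thesis
    proof (cases "\<beta> j \<le> \<alpha> k")
      case True
      have "\<alpha> k * (t - real k) + \<beta> j * (1 - (t - real k)) \<le> \<alpha> k * (t - real k) + \<alpha> k * (1 - (t - real k))"
        using True th by (intro add_left_mono mult_right_mono)
      also have "\<dots> = \<alpha> k" by (simp add: algebra_simps)
      finally show ?thesis
        using bT bS False kK by (intro exI[of _ "Suc k"]) (auto simp: j)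
    next
      case False
      have "\<alpha> k * (t - real k) + \<beta> j * (1 - (t - real k)) \<le> \<beta> j * (t - real k) + \<beta> j * (1 - (t - real k))"
        using False th by (intro add_right_mono mult_right_mono) auto
      also have "\<dots> = \<beta> j" by (simp add: algebra_simps)
      finally show ?thesis
        using bT bS kK by (intro exI[of _ k]) (auto simp: j)
    qed
  qed
qed

context wavelet_setting
begin

section \<open>Concentration compactness\<close>

text \<open>A finite \<open>\<epsilon>\<close>-net of the compact orbit piece is orthonormalised.
  Since the complementary projection is a contraction that kills the net, every orbit point inherits
  its distance to the net.\<close>

lemma compact_orbit_projection:
  fixes C :: "'g set"
  assumes "compact C" "\<epsilon> > 0"
  obtains N h where "orthonormal N h" "\<And>x. x \<in> C \<Longrightarrow> norm (\<pi> x \<psi> - proj N h (\<pi> x \<psi>)) \<le> \<epsilon>"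
proof -
  have K: "compact ((\<lambda>x. \<pi> x \<psi>) ` C)"
    by (intro compact_continuous_image continuous_on_subset[OF cont_rep] assms) simp
  obtain D where D: "finite D" "(\<lambda>x. \<pi> x \<psi>) ` C \<subseteq> (\<Union>y\<in>D. ball y \<epsilon>)"
    by (rule compactE_image[OF K, of UNIV "\<lambda>y. ball y \<epsilon>"])
      (use assms(2) in \<open>auto, metis dist_self\<close>)
  obtain N v where v: "D = v ` {..<N::nat}"
    using finite_imp_nat_seg_image_inj_on[OF D(1)] by (metis lessThan_def)
  obtain h where h: "orthonormal N h" "\<And>j. j < N \<Longrightarrow> proj N h (v j) = v j"
    using Gram_Schmidt[OF inf_dim, of N v] by blast
  show ?thesis
  proof (rule that[OF h(1)])
    fix x assume "x \<in> C"
    then have "\<pi> x \<psi> \<in> (\<Union>y\<in>D. ball y \<epsilon>)" using D(2) by blast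
    then obtain y where "y \<in> D" "dist y (\<pi> x \<psi>) < \<epsilon>" by auto
    then obtain j where j: "j < N" "dist (v j) (\<pi> x \<psi>) < \<epsilon>" by (auto simp: v)
    have "norm (\<pi> x \<psi> - proj N h (\<pi> x \<psi>)) = norm ((\<pi> x \<psi> - v j) - proj N h (\<pi> x \<psi> - v j))"
      by (simp add: proj_diff h(2)[OF j(1)])
    also have "\<dots> \<le> norm (\<pi> x \<psi> - v j)" by (rule norm_proj_compl_le[OF h(1)])
    also have "\<dots> \<le> \<epsilon>" using j(2) by (simp add: dist_norm norm_minus_commute)
    finally show "norm (\<pi> x \<psi> - proj N h (\<pi> x \<psi>)) \<le> \<epsilon>" .
  qed
qed

lemma W_proj: "W (proj N h f) x = (\<Sum>i<N. cinner f (h i) * W (h i) x)"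
  by (simp add: proj_def wavelet_transform_def cinner_sum_left cinner_scaleC_left)

text \<open>Moves the complement onto the orbit vector: where the projection almost fixes the orbit,
  the complement of \<open>f\<close> has a small transform, for all unit vectors \<open>f\<close> at
  once.\<close>

lemma W_proj_compl: "W (f - proj N h f) x = cinner f (\<pi> x \<psi> - proj N h (\<pi> x \<psi>))"
  by (simp add: wavelet_transform_def cinner_diff_left cinner_diff_right cinner_proj_right)

lemma energy_add:
  assumes "\<Omega> \<in> fmeasurable M"
  shows "energy \<Omega> (f + g) = energy \<Omega> f + 2 * Re (loc_form \<Omega> f g) + energy \<Omega> g"
  using trace_bounded.qform_add[OF trace_bounded_L[OF assms], of f g]
  by (simp add: qform_L cinner_L assms)

lemma loc_form_Cauchy_Schwarz:
  assumes "\<Omega> \<in> fmeasurable M"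
  shows "(cmod (loc_form \<Omega> f g))\<^sup>2 \<le> energy \<Omega> f * energy \<Omega> g"
  using trace_bounded.form_Cauchy_Schwarz[OF trace_bounded_L[OF assms], of f g]
  by (simp add: qform_L cinner_L assms)

lemma energy_le_esum:
  assumes \<Omega>: "\<Omega> \<in> fmeasurable M" shows "energy \<Omega> f \<le> esum \<Omega> 1 * (norm f)\<^sup>2"
  unfolding qform_L[OF \<Omega>, symmetric]
proof (rule trace_bounded.qform_le_unit[OF trace_bounded_L[OF \<Omega>]])
  fix u :: 'h assume "norm u = 1"
  then have "orthonormal 1 (\<lambda>_. u)" by (simp add: orthonormal_def cinner_self_eq_1)
  then show "qform (L \<Omega>) u \<le> esum \<Omega> 1" using esum_ge[OF \<Omega>] by (fastforce simp: qform_L[OF \<Omega>])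
qed

text \<open>The range of the projection is spanned by finitely many vectors whose transforms are
  small off \<open>C'\<close>; within \<open>C'\<close> only the mass of \<open>B\<close> counts.
  The denominator \<open>real N + 1\<close> absorbs the sum over the \<open>N\<close> basis
  vectors.\<close>

lemma energy_proj_far:
  assumes B: "B \<in> fmeasurable M" "B \<inter> C' \<in> sets M" and h: "orthonormal N h"
    and small: "\<And>x i. x \<notin> C' \<Longrightarrow> i < N \<Longrightarrow> cmod (W (h i) x) \<le> \<epsilon> / (real N + 1)" and "\<epsilon> > 0"
  shows "energy B (proj N h f) \<le> (measure M (B \<inter> C') + \<epsilon>\<^sup>2 * measure M B) * (norm f)\<^sup>2"
proof -
  have B1: "B \<inter> C' \<in> fmeasurable M" using fmeasurableI2[OF B(1) _ B(2)] by blast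
  have B2: "B - C' \<in> fmeasurable M"
    using fmeasurable_Diff[OF B(1) B(2)] by (simp add: Diff_Int)
  have "energy B (proj N h f) = energy (B \<inter> C') (proj N h f) + energy (B - C') (proj N h f)"
    using energy_Un[OF B1 B2, of "proj N h f"] by (simp add: Int_Diff_Un Int_Diff_disjoint)
  also have "energy (B \<inter> C') (proj N h f) \<le> (norm f)\<^sup>2 * measure M (B \<inter> C')"
    using energy_le_measure[OF B1, of "proj N h f"] norm_proj_le[OF h, of f]
    by (meson dual_order.trans measure_nonneg mult_right_mono norm_ge_zero power_mono)
  also have "energy (B - C') (proj N h f) \<le> (\<epsilon> * norm f)\<^sup>2 * measure M (B - C')"
  proof (rule energy_le[OF B2])
    fix x assume "x \<in> B - C'"
    then have x: "x \<notin> C'" by simp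
    have "cmod (W (proj N h f) x) \<le> (\<Sum>i<N. cmod (cinner f (h i)) * cmod (W (h i) x))"
      unfolding W_proj by (rule order_trans[OF norm_sum]) (simp add: norm_mult)
    also have "\<dots> \<le> (\<Sum>i<N. norm f * (\<epsilon> / (real N + 1)))"
    proof (intro sum_mono mult_mono)
      fix i assume "i \<in> {..<N}"
      then show "cmod (cinner f (h i)) \<le> norm f"
        using cinner_Cauchy_Schwarz[of f "h i"] orthonormal_norm[OF h] by simp
      show "cmod (W (h i) x) \<le> \<epsilon> / (real N + 1)" using small[OF x] \<open>i \<in> {..<N}\<close> by simp
    qed auto
    also have "\<dots> = \<epsilon> * norm f * (real N / (real N + 1))" by simp
    also have "\<dots> \<le> \<epsilon> * norm f * 1"
      using \<open>\<epsilon> > 0\<close> by (intro mult_left_mono) auto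
    finally show "cmod (W (proj N h f) x) \<le> \<epsilon> * norm f" by simp
  qed
  also have "(\<epsilon> * norm f)\<^sup>2 * measure M (B - C') \<le> (\<epsilon> * norm f)\<^sup>2 * measure M B"
    using B B2 by (intro mult_left_mono measure_mono_fmeasurable) auto
  finally show ?thesis by (simp add: algebra_simps power_mult_distrib)
qed

end

text \<open>\<open>T\<close> is the weak limit of the operators and \<open>c C\<close> the limiting
  mass inside \<open>C\<close>; both limits run along the same filter, which is what allows them to
  be combined.\<close>

locale concentration = wavelet_setting M \<omega> \<pi> \<psi>
  for M :: "'g::{topological_group_add, t2_space} measure"
    and \<omega> :: "'g \<Rightarrow> 'g \<Rightarrow> complex"
    and \<pi> :: "'g \<Rightarrow> 'h::complex_hilbert_space \<Rightarrow> 'h"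
    and \<psi> :: 'h +
  fixes \<Omega> :: "nat \<Rightarrow> 'g set" and F :: "nat filter" and T :: "'h \<Rightarrow> 'h"
    and c :: "'g set \<Rightarrow> real" and m :: real
  assumes \<Omega>_fm: "\<Omega> n \<in> fmeasurable M" and \<Omega>_le: "measure M (\<Omega> n) \<le> m"
    and F: "F \<noteq> bot"
    and form_lim: "((\<lambda>n. loc_form (\<Omega> n) f g) \<longlongrightarrow> cinner (T f) g) F"
    and c_lim: "((\<lambda>n. measure M (\<Omega> n \<inter> C)) \<longlongrightarrow> c C) F"
begin

lemma energy_lim: "((\<lambda>n. energy (\<Omega> n) f) \<longlongrightarrow> qform T f) F"
proof -
  have "Re (loc_form (\<Omega> n) f f) = energy (\<Omega> n) f" for n
    using qform_L[OF \<Omega>_fm, of n f] cinner_L[OF \<Omega>_fm, of n f f] by (simp add: qform_def)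
  then show ?thesis
    using tendsto_Re[OF form_lim[of f f]] by (simp add: qform_def)
qed

lemma m_nonneg: "0 \<le> m"
  using \<Omega>_le[of 0] measure_nonneg order_trans by blast

text \<open>Each partial trace is a finite sum and passes to the limit, so the spectral theory
  applies to \<open>T\<close> although compactness is not stable under weak limits.\<close>

lemma trace_bounded_T: "trace_bounded T m"
proof
  show "cinner (T f) g = cinner f (T g)" for f g
  proof (rule tendsto_unique[OF F form_lim])
    show "((\<lambda>n. loc_form (\<Omega> n) f g) \<longlongrightarrow> cinner f (T g)) F"
      using tendsto_cnj[OF form_lim[of g f]] cinner_commute[of f "T g"] by (simp add: cnj_loc_form)
  qed
  show "0 \<le> qform T f" for f
    by (rule tendsto_lowerbound[OF energy_lim _ F]) (simp add: energy_nonneg)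
  show "(\<Sum>i<N. qform T (e i)) \<le> m" if "orthonormal N e" for N e
  proof (rule tendsto_upperbound[OF tendsto_sum[OF energy_lim] _ F])
    show "\<forall>\<^sub>F n in F. (\<Sum>i<N. energy (\<Omega> n) (e i)) \<le> m"
      using sum_energy_le_measure[OF orthonormal_Bessel[OF that] \<Omega>_fm] \<Omega>_le order_trans
      by (intro always_eventually) blast
  qed
qed

sublocale T: trace_bounded T m by (rule trace_bounded_T)

lemma Int_fm: "compact C \<Longrightarrow> \<Omega> n \<inter> C \<in> fmeasurable M"
  by (intro fmeasurable_Int_fmeasurable \<Omega>_fm compact_sets)

lemma Diff_fm: "compact C \<Longrightarrow> \<Omega> n - C \<in> fmeasurable M"
  by (intro fmeasurable_Diff \<Omega>_fm compact_sets)

lemma measure_Int_le: "compact C \<Longrightarrow> measure M (\<Omega> n \<inter> C) \<le> m"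
  using measure_mono_fmeasurable[of "\<Omega> n \<inter> C" "\<Omega> n" M] Int_fm[of C n] \<Omega>_fm[of n] \<Omega>_le[of n] by force

lemma measure_Diff_le: "compact C \<Longrightarrow> measure M (\<Omega> n - C) \<le> m"
  using measure_mono_fmeasurable[of "\<Omega> n - C" "\<Omega> n" M] Diff_fm[of C n] \<Omega>_fm[of n] \<Omega>_le[of n] by force

lemma measure_Diff_eq:
  assumes "compact C" shows "measure M (\<Omega> n - C) = measure M (\<Omega> n) - measure M (\<Omega> n \<inter> C)"
proof -
  have "\<Omega> n - C = \<Omega> n - (\<Omega> n \<inter> C)" by blast
  then show ?thesis
    using measurable_measure_Diff[OF \<Omega>_fm fmeasurableD[OF Int_fm[OF assms]], of n n] by simp
qed

lemma c_le: "compact C \<Longrightarrow> c C \<le> m"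
  by (rule tendsto_upperbound[OF c_lim _ F]) (simp add: measure_Int_le)

lemma c_nonneg: "0 \<le> c C"
  by (rule tendsto_lowerbound[OF c_lim _ F]) simp

lemma c_mono:
  assumes "compact C" "compact D" "C \<subseteq> D" shows "c C \<le> c D"
proof (rule tendsto_le[OF F c_lim c_lim])
  have "measure M (\<Omega> n \<inter> C) \<le> measure M (\<Omega> n \<inter> D)" for n
    using assms Int_fm by (intro measure_mono_fmeasurable) auto
  then show "\<forall>\<^sub>F n in F. measure M (\<Omega> n \<inter> C) \<le> measure M (\<Omega> n \<inter> D)" by simp
qed

text \<open>The limit in \<open>n\<close> is taken before the supremum over \<open>C\<close>, so
  mass that leaves every fixed compact set is not counted.\<close>

definition s1 :: real where "s1 = (SUP C\<in>Collect compact. c C)"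

lemma c_bdd: "bdd_above (c ` Collect compact)"
  using c_le by (intro bdd_aboveI2[of _ _ m]) simp

lemma c_le_s1: "compact C \<Longrightarrow> c C \<le> s1"
  unfolding s1_def by (rule cSUP_upper[OF _ c_bdd]) simp

lemma s1_nonneg: "0 \<le> s1"
  using c_le_s1[of "{}"] c_nonneg[of "{}"] by simp

lemma s1_le: "s1 \<le> m"
  unfolding s1_def by (rule cSUP_least) (use c_le in \<open>auto intro: exI[of _ "{}"]\<close>)

text \<open>Inserting a point keeps \<open>C\<close> compact and cannot lower \<open>c C\<close>.
  The point will be 0, where the centred eigenvectors have transforms bounded below.\<close>

lemma nearly_optimal_compact:
  assumes "\<epsilon> > 0" obtains C where "compact C" "x \<in> C" "s1 - \<epsilon> < c C"
proof -
  obtain C where C: "compact C" "s1 - \<epsilon> < c C"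
    using less_cSUP_iff[OF _ c_bdd, of "s1 - \<epsilon>"] assms unfolding s1_def
    by (metis (no_types, lifting) compact_empty diff_less_eq less_add_same_cancel1 empty_iff mem_Collect_eq)
  have "compact (insert x C)" using C by (simp add: compact_insert)
  moreover have "c C \<le> c (insert x C)" using C calculation by (intro c_mono) auto
  ultimately show ?thesis using C that by (metis insertI1 less_le_trans)
qed

text \<open>The error of the splitting, with near part \<open>\<Omega> n \<inter> C\<close> and far
  part \<open>\<Omega> n - C\<close>: \<open>\<epsilon>\<close> from weak convergence on the
  finite-dimensional range; \<open>m * \<epsilon>\<close> from the near energy of the complement and
  twice that from the near cross term; the root bounds the far cross term by Cauchy-Schwarz, from
  far energies at most \<open>\<epsilon> * (2 + m)\<close> and \<open>m\<close>.\<close>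

definition \<rho> :: "real \<Rightarrow> real" where
  "\<rho> \<epsilon> = \<epsilon> + 3 * m * \<epsilon> + 2 * sqrt (\<epsilon> * (2 + m) * m)"

lemma \<rho>_tendsto: "(\<rho> \<longlongrightarrow> 0) (at_right 0)"
proof -
  have "isCont \<rho> 0" unfolding \<rho>_def by (intro continuous_intros)
  then have "(\<rho> \<longlongrightarrow> \<rho> 0) (at_right 0)"
    unfolding isCont_def by (rule tendsto_mono[OF at_le[OF subset_UNIV]])
  then show ?thesis by (simp add: \<rho>_def)
qed

text \<open>On the range of a finite-rank projection weak convergence is uniform, because only the
  \<open>N * N\<close> matrix entries of the form matter.\<close>

lemma qform_proj_eventually:
  assumes h: "orthonormal N h" and e: "\<epsilon> > 0"
  shows "\<forall>\<^sub>F n in F. \<forall>f. energy (\<Omega> n) (proj N h f) \<le> qform T (proj N h f) + \<epsilon> * (norm f)\<^sup>2"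
proof -
  define D where "D n = (\<Sum>i<N. \<Sum>j<N. cmod (loc_form (\<Omega> n) (h i) (h j) - cinner (T (h i)) (h j)))" for n
  have "(D \<longlongrightarrow> (\<Sum>i<N. \<Sum>j<N. cmod (cinner (T (h i)) (h j) - cinner (T (h i)) (h j)))) F"
    unfolding D_def by (intro tendsto_sum tendsto_norm tendsto_diff form_lim tendsto_const)
  then have "(D \<longlongrightarrow> 0) F" by simp
  then have "\<forall>\<^sub>F n in F. D n < \<epsilon>" using e by (rule order_tendstoD)
  then show ?thesis
  proof (rule eventually_mono, intro allI)
    fix n f assume Dn: "D n < \<epsilon>"
    interpret Ln: trace_bounded "L (\<Omega> n)" "measure M (\<Omega> n)" by (rule trace_bounded_L[OF \<Omega>_fm])
    let ?c = "\<lambda>i. cinner f (h i)"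
    have cle: "cmod (?c i) \<le> norm f" if "i < N" for i
      using cinner_Cauchy_Schwarz[of f "h i"] orthonormal_norm[OF h that] by simp
    have ex: "cinner (R (proj N h f)) (proj N h f) = (\<Sum>i<N. \<Sum>j<N. ?c i * cnj (?c j) * cinner (R (h i)) (h j))"
      if R: "trace_bounded R b" for R b
    proof -
      have "R (proj N h f) = (\<Sum>i<N. ?c i *\<^sub>C R (h i))"
        by (simp add: proj_def trace_bounded.T_sum[OF R] trace_bounded.T_scaleC[OF R])
      then show ?thesis
        by (simp add: proj_def cinner_sum_left cinner_sum_right cinner_scaleC_left cinner_scaleC_right
            mult_ac sum_distrib_left) (rule sum.swap)
    qed
    have "energy (\<Omega> n) (proj N h f) - qform T (proj N h f)
        = Re (cinner (L (\<Omega> n) (proj N h f)) (proj N h f) - cinner (T (proj N h f)) (proj N h f))"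
      by (simp add: qform_L[OF \<Omega>_fm, symmetric] qform_def)
    also have "\<dots> \<le> cmod (cinner (L (\<Omega> n) (proj N h f)) (proj N h f) - cinner (T (proj N h f)) (proj N h f))"
      by (rule complex_Re_le_cmod)
    also have "\<dots> = cmod (\<Sum>i<N. \<Sum>j<N. ?c i * cnj (?c j) * (loc_form (\<Omega> n) (h i) (h j) - cinner (T (h i)) (h j)))"
      unfolding ex[OF Ln.trace_bounded_axioms] ex[OF trace_bounded_T]
      unfolding cinner_L[OF \<Omega>_fm] by (simp add: sum_subtractf right_diff_distrib)
    also have "\<dots> \<le> (\<Sum>i<N. \<Sum>j<N. cmod (?c i * cnj (?c j) * (loc_form (\<Omega> n) (h i) (h j) - cinner (T (h i)) (h j))))"
      by (intro order_trans[OF norm_sum] sum_mono norm_sum)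
    also have "\<dots> \<le> (\<Sum>i<N. \<Sum>j<N. (norm f * norm f) * cmod (loc_form (\<Omega> n) (h i) (h j) - cinner (T (h i)) (h j)))"
      unfolding norm_mult by (intro sum_mono mult_mono) (auto intro: cle)
    also have "\<dots> = (norm f)\<^sup>2 * D n"
      by (simp add: D_def sum_distrib_left power2_eq_square)
    also have "\<dots> \<le> (norm f)\<^sup>2 * \<epsilon>" using Dn by (intro mult_left_mono) auto
    finally show "energy (\<Omega> n) (proj N h f) \<le> qform T (proj N h f) + \<epsilon> * (norm f)\<^sup>2"
      by (simp add: mult.commute)
  qed
qed

text \<open>As \<open>c C\<close> is within \<open>\<epsilon>\<close> of the supremum, enlarging
  \<open>C\<close> by \<open>C'\<close> gains less than \<open>\<epsilon>\<close> in the limit; the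
  factor 2 leaves room before the limit.\<close>

lemma far_mass_eventually:
  assumes C: "compact C" "compact C'" "s1 - \<epsilon> < c C" and e: "\<epsilon> > 0"
  shows "\<forall>\<^sub>F n in F. measure M ((\<Omega> n - C) \<inter> C') \<le> 2 * \<epsilon>"
proof -
  have "((\<lambda>n. measure M (\<Omega> n \<inter> (C \<union> C')) - measure M (\<Omega> n \<inter> C)) \<longlongrightarrow> c (C \<union> C') - c C) F"
    by (intro tendsto_diff c_lim)
  moreover have "c (C \<union> C') - c C < 2 * \<epsilon>"
    using c_le_s1[OF compact_Un[OF C(1,2)]] C(3) e by simp
  ultimately have "\<forall>\<^sub>F n in F. measure M (\<Omega> n \<inter> (C \<union> C')) - measure M (\<Omega> n \<inter> C) < 2 * \<epsilon>"
    by (rule order_tendstoD)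
  then show ?thesis
  proof (rule eventually_mono)
    fix n assume a: "measure M (\<Omega> n \<inter> (C \<union> C')) - measure M (\<Omega> n \<inter> C) < 2 * \<epsilon>"
    have "measure M (\<Omega> n \<inter> (C \<union> C') - (\<Omega> n \<inter> C))
        = measure M (\<Omega> n \<inter> (C \<union> C')) - measure M (\<Omega> n \<inter> C)"
      using C Int_fm by (intro measurable_measure_Diff) auto
    moreover have "\<Omega> n \<inter> (C \<union> C') - (\<Omega> n \<inter> C) = (\<Omega> n - C) \<inter> C'" by blast
    ultimately show "measure M ((\<Omega> n - C) \<inter> C') \<le> 2 * \<epsilon>" using a by simp
  qed
qed

text \<open>Near the compact set \<open>C\<close> the operators are approximated through a finite-rank projection,
  uniformly in \<open>n\<close>; far from \<open>C\<close> they do not see its range.\<close>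

lemma splitting:
  assumes C: "compact C" "s1 - \<epsilon> < c C" and e: "0 < \<epsilon>" "\<epsilon> \<le> 1"
    and h: "orthonormal N h" "\<And>x. x \<in> C \<Longrightarrow> norm (\<pi> x \<psi> - proj N h (\<pi> x \<psi>)) \<le> \<epsilon>"
  shows "\<forall>\<^sub>F n in F. \<forall>f. energy (\<Omega> n) f
    \<le> qform T (proj N h f) + energy (\<Omega> n - C) (f - proj N h f) + \<rho> \<epsilon> * (norm f)\<^sup>2"
proof -
  have pos: "\<epsilon> / (real N + 1) > 0" using e by (simp add: add_nonneg_pos)
  obtain C' where C': "compact C'" "\<And>x i. x \<notin> C' \<Longrightarrow> i < N \<Longrightarrow> cmod (W (h i) x) < \<epsilon> / (real N + 1)"
    using W_vanishes_uniformly[OF pos, where n = N and f = h] by blast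
  show ?thesis
    using qform_proj_eventually[OF h(1) e(1)] far_mass_eventually[OF C(1) C'(1) C(2) e(1)]
  proof eventually_elim
    case (elim n)
    show ?case
    proof
      fix f
      let ?P = "proj N h f" let ?Q = "f - proj N h f"
      let ?A = "\<Omega> n \<inter> C" let ?B = "\<Omega> n - C"
      have A: "?A \<in> fmeasurable M" "measure M ?A \<le> m" by (rule Int_fm[OF C(1)] measure_Int_le[OF C(1)])+
      have B: "?B \<in> fmeasurable M" "measure M ?B \<le> m" by (rule Diff_fm[OF C(1)] measure_Diff_le[OF C(1)])+
      have AB: "?A \<union> ?B = \<Omega> n" "?A \<inter> ?B = {}" by auto
      have nP: "norm ?P \<le> norm f" and nQ: "norm ?Q \<le> norm f"
        by (rule norm_proj_le[OF h(1)], rule norm_proj_compl_le[OF h(1)])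
      have WQ: "cmod (W ?Q x) \<le> \<epsilon> * norm f" if "x \<in> ?A" for x
        using cinner_Cauchy_Schwarz[of f "\<pi> x \<psi> - proj N h (\<pi> x \<psi>)"] h(2)[of x] that
          mult_left_mono[OF h(2)[of x], of "norm f"]
        by (simp add: W_proj_compl mult.commute)
      have QA: "energy ?A ?Q \<le> m * \<epsilon> * (norm f)\<^sup>2"
      proof -
        have "energy ?A ?Q \<le> (\<epsilon> * norm f)\<^sup>2 * measure M ?A" by (rule energy_le[OF A(1) WQ])
        also have "\<dots> \<le> (\<epsilon> * norm f)\<^sup>2 * m" by (intro mult_left_mono A) simp
        also have "\<dots> = (m * \<epsilon> * (norm f)\<^sup>2) * \<epsilon>" by (simp add: power2_eq_square)
        also have "\<dots> \<le> (m * \<epsilon> * (norm f)\<^sup>2) * 1" using e m_nonneg by (intro mult_left_mono) auto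
        finally show ?thesis by simp
      qed
      have PB: "energy ?B ?P \<le> \<epsilon> * (2 + m) * (norm f)\<^sup>2"
      proof -
        have "energy ?B ?P \<le> (measure M (?B \<inter> C') + \<epsilon>\<^sup>2 * measure M ?B) * (norm f)\<^sup>2"
          by (rule energy_proj_far[OF B(1) _ h(1)])
            (use B C' e in \<open>auto intro: less_imp_le sets.Int compact_sets\<close>)
        also have "\<dots> \<le> (2 * \<epsilon> + \<epsilon> * m) * (norm f)\<^sup>2"
        proof (intro mult_right_mono add_mono mult_mono)
          show "\<epsilon>\<^sup>2 \<le> \<epsilon>" using e by (simp add: power2_eq_square mult_left_le)
        qed (use elim B e m_nonneg in auto)
        finally show ?thesis by (simp add: algebra_simps)
      qed
      have crossA: "cmod (loc_form ?A ?P ?Q) \<le> m * \<epsilon> * (norm f)\<^sup>2"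
      proof -
        have "cmod (loc_form ?A ?P ?Q) \<le> norm f * (\<epsilon> * norm f) * measure M ?A"
          by (rule loc_form_bound[OF A(1) order_trans[OF W_le nP] WQ]) auto
        also have "\<dots> \<le> norm f * (\<epsilon> * norm f) * m" using e by (intro mult_left_mono A) auto
        finally show ?thesis by (simp add: power2_eq_square mult_ac)
      qed
      have crossB: "cmod (loc_form ?B ?P ?Q) \<le> sqrt (\<epsilon> * (2 + m) * m) * (norm f)\<^sup>2"
      proof (rule power2_le_imp_le)
        have "(cmod (loc_form ?B ?P ?Q))\<^sup>2 \<le> energy ?B ?P * energy ?B ?Q"
          by (rule loc_form_Cauchy_Schwarz[OF B(1)])
        also have "\<dots> \<le> (\<epsilon> * (2 + m) * (norm f)\<^sup>2) * ((norm f)\<^sup>2 * m)"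
        proof (rule mult_mono[OF PB])
          have "energy ?B ?Q \<le> (norm ?Q)\<^sup>2 * measure M ?B" by (rule energy_le_measure[OF B(1)])
          also have "\<dots> \<le> (norm f)\<^sup>2 * m" using nQ B by (intro mult_mono power_mono) auto
          finally show "energy ?B ?Q \<le> (norm f)\<^sup>2 * m" .
        qed (use e m_nonneg in \<open>auto simp: energy_nonneg\<close>)
        also have "\<dots> = (sqrt (\<epsilon> * (2 + m) * m) * (norm f)\<^sup>2)\<^sup>2"
          using e m_nonneg by (simp add: power_mult_distrib power2_eq_square mult_ac)
        finally show "(cmod (loc_form ?B ?P ?Q))\<^sup>2 \<le> (sqrt (\<epsilon> * (2 + m) * m) * (norm f)\<^sup>2)\<^sup>2" .
      qed (use e m_nonneg in auto)
      have cross: "Re (loc_form (\<Omega> n) ?P ?Q) \<le> m * \<epsilon> * (norm f)\<^sup>2 + sqrt (\<epsilon> * (2 + m) * m) * (norm f)\<^sup>2"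
        using loc_form_Un[OF A(1) B(1) AB(2), of ?P ?Q] crossA crossB
          complex_Re_le_cmod[of "loc_form ?A ?P ?Q"] complex_Re_le_cmod[of "loc_form ?B ?P ?Q"]
        by (simp add: AB(1))
      have \<rho>: "\<rho> \<epsilon> * (norm f)\<^sup>2 = \<epsilon> * (norm f)\<^sup>2 + 3 * (m * \<epsilon> * (norm f)\<^sup>2)
          + 2 * (sqrt (\<epsilon> * (2 + m) * m) * (norm f)\<^sup>2)"
        by (simp add: \<rho>_def distrib_right mult.assoc)
      have "energy (\<Omega> n) f = energy (\<Omega> n) ?P + 2 * Re (loc_form (\<Omega> n) ?P ?Q) + energy (\<Omega> n) ?Q"
        using energy_add[OF \<Omega>_fm, of n ?P ?Q] by simp
      also have "energy (\<Omega> n) ?Q = energy ?A ?Q + energy ?B ?Q"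
        using energy_Un[OF A(1) B(1) AB(2), of ?Q] by (simp add: AB(1))
      finally show "energy (\<Omega> n) f \<le> qform T ?P + energy ?B ?Q + \<rho> \<epsilon> * (norm f)\<^sup>2"
        using QA cross elim(1)[rule_format, of f] \<rho> by linarith
    qed
  qed
qed

lemma \<rho>_nonneg: "0 < \<epsilon> \<Longrightarrow> 0 \<le> \<rho> \<epsilon>"
  using m_nonneg by (simp add: \<rho>_def)

text \<open>The eigenvectors of \<open>T\<close> are tested on \<open>\<Omega> n\<close>: outside a
  large compact \<open>C\<close> their density is small, and inside, the mass tends to
  \<open>c C \<le> s1\<close>. The bathtub set for the same vectors thus dominates in the
  limit.\<close>

lemma spectrum_le_bathtub:
  assumes spec: "spectral_seq T a \<alpha>" and k: "k \<ge> 1"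
  obtains \<Omega>' where "relatively_compact \<Omega>'" "measure M \<Omega>' = s1" "(\<Sum>j<k. \<alpha> j) \<le> esum \<Omega>' k"
proof -
  have on: "orthonormal k a" by (rule T.spec_orthonormal[OF spec])
  obtain \<Omega>' where \<Omega>': "relatively_compact \<Omega>'" "measure M \<Omega>' = s1"
    "\<And>E. E \<in> fmeasurable M \<Longrightarrow>
      (\<Sum>i<k. energy E (a i)) \<le> (\<Sum>i<k. energy \<Omega>' (a i)) + max 0 (measure M E - s1)"
    by (rule bathtub[OF on k s1_nonneg]) blast
  have "(\<Sum>j<k. \<alpha> j) \<le> esum \<Omega>' k + \<epsilon> * (m + 1)" if e: "\<epsilon> > 0" for \<epsilon>
  proof -
    obtain C where C: "compact C" "\<And>x. x \<notin> C \<Longrightarrow> (\<Sum>i<k. (cmod (W (a i) x))\<^sup>2) < \<epsilon>"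
      using density_vanishes[OF e, where n = k and f = a] by blast
    have bound: "(\<Sum>i<k. energy (\<Omega> n) (a i)) \<le> esum \<Omega>' k + max 0 (measure M (\<Omega> n \<inter> C) - s1) + \<epsilon> * m" for n
    proof -
      have "(\<Sum>i<k. energy (\<Omega> n - C) (a i)) = (LINT x:\<Omega> n - C|M. (\<Sum>i<k. (cmod (W (a i) x))\<^sup>2))"
        by (rule sum_energy[OF Diff_fm[OF C(1)]])
      also have "\<dots> \<le> (LINT x:\<Omega> n - C|M. \<epsilon>)"
        by (intro set_integral_mono set_integrable_continuous[of _ _ 1] set_integrable_continuous[of _ _ \<epsilon>]
            Diff_fm C(1) cont_sum_density continuous_on_const)
          (use C(2) e W_Bessel[OF orthonormal_Bessel[OF on]] in \<open>auto simp: sum_nonneg less_imp_le\<close>)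
      also have "\<dots> \<le> \<epsilon> * m"
        using measure_Diff_le[OF C(1)] e by (simp add: set_integral_const Diff_fm C(1))
      finally have far: "(\<Sum>i<k. energy (\<Omega> n - C) (a i)) \<le> \<epsilon> * m" .
      have split: "energy (\<Omega> n) f = energy (\<Omega> n \<inter> C) f + energy (\<Omega> n - C) f" for f
        using energy_Un[OF Int_fm[OF C(1)] Diff_fm[OF C(1)], of n n f] by (simp add: Int_Diff_Un Int_Diff_disjoint)
      have "(\<Sum>i<k. energy \<Omega>' (a i)) \<le> esum \<Omega>' k"
        by (rule esum_ge[OF relatively_compact_fmeasurable[OF \<Omega>'(1)] on])
      then show ?thesis
        using far \<Omega>'(3)[OF Int_fm[OF C(1), of n]] by (simp add: split sum.distrib)
    qed
    have lim: "((\<lambda>n. esum \<Omega>' k + max 0 (measure M (\<Omega> n \<inter> C) - s1) + \<epsilon> * m)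
        \<longlongrightarrow> esum \<Omega>' k + max 0 (c C - s1) + \<epsilon> * m) F"
      by (intro tendsto_intros c_lim)
    have "(\<Sum>j<k. \<alpha> j) = (\<Sum>i<k. qform T (a i))" by (simp add: T.spec_qform[OF spec])
    also have "\<dots> \<le> esum \<Omega>' k + max 0 (c C - s1) + \<epsilon> * m"
      by (rule tendsto_le[OF F lim tendsto_sum[OF energy_lim] always_eventually]) (use bound in blast)
    also have "max 0 (c C - s1) = 0" using c_le_s1[OF C(1)] by simp
    finally show ?thesis using e by (simp add: algebra_simps)
  qed
  then have "(\<Sum>j<k. \<alpha> j) \<le> esum \<Omega>' k"
  proof -
    assume *: "\<And>\<epsilon>. \<epsilon> > 0 \<Longrightarrow> (\<Sum>j<k. \<alpha> j) \<le> esum \<Omega>' k + \<epsilon> * (m + 1)"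
    show ?thesis
    proof (rule field_le_epsilon)
      fix e :: real assume "e > 0"
      then show "(\<Sum>j<k. \<alpha> j) \<le> esum \<Omega>' k + e"
        using *[of "e / (m + 1)"] m_nonneg by simp
    qed
  qed
  then show ?thesis using that \<Omega>' by blast
qed

text \<open>The splitting is applied to an optimal family for \<open>\<Omega> n\<close>, and
  \<open>merge_spectra\<close> chooses \<open>k\<close>. Applied to the centred eigenvector
  \<open>v n\<close>, it also shows that the top eigenvalue persists in \<open>T\<close> up to an
  error, which turns \<open>k = 0\<close> into \<open>k = 1\<close>.\<close>

lemma upper_estimate:
  fixes v :: "nat \<Rightarrow> 'h"
  assumes spec: "spectral_seq T a \<alpha>" and K: "K \<ge> 1"
    and v: "\<And>n. norm (v n) = 1" "\<And>n. energy (\<Omega> n) (v n) = esum (\<Omega> n) 1"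
      "\<And>n. \<delta> \<le> cmod (W (v n) 0)"
    and e: "0 < \<epsilon>" "\<epsilon> \<le> 1" "\<epsilon> \<le> \<delta> / 2"
  obtains C where "compact C" "s1 - \<epsilon> < c C"
    "\<forall>\<^sub>F n in F. \<exists>k. 1 \<le> k \<and> k \<le> K \<and> esum (\<Omega> n) K
      \<le> (\<Sum>j<k. \<alpha> j) + esum (\<Omega> n - C) (K - k) + (real K * \<rho> \<epsilon> + 4 * \<rho> \<epsilon> / \<delta>\<^sup>2)"
proof -
  have \<delta>: "\<delta> > 0" using e by simp
  obtain C where C: "compact C" "0 \<in> C" "s1 - \<epsilon> < c C"
    by (rule nearly_optimal_compact[OF e(1)])
  obtain N h where h: "orthonormal N h" "\<And>x. x \<in> C \<Longrightarrow> norm (\<pi> x \<psi> - proj N h (\<pi> x \<psi>)) \<le> \<epsilon>"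
    by (rule compact_orbit_projection[OF C(1) e(1)]) blast
  note \<rho>0 = \<rho>_nonneg[OF e(1)]
  have "\<forall>\<^sub>F n in F. \<exists>k. 1 \<le> k \<and> k \<le> K \<and> esum (\<Omega> n) K
      \<le> (\<Sum>j<k. \<alpha> j) + esum (\<Omega> n - C) (K - k) + (real K * \<rho> \<epsilon> + 4 * \<rho> \<epsilon> / \<delta>\<^sup>2)"
    using splitting[OF C(1,3) e(1,2) h]
  proof (rule eventually_mono)
    fix n assume split: "\<forall>f. energy (\<Omega> n) f
      \<le> qform T (proj N h f) + energy (\<Omega> n - C) (f - proj N h f) + \<rho> \<epsilon> * (norm f)\<^sup>2"
    let ?B = "\<Omega> n - C"
    have B: "?B \<in> fmeasurable M" by (rule Diff_fm[OF C(1)])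
    define \<Lambda> where "\<Lambda> = esum (\<Omega> n) 1"
    \<comment> \<open>With \<open>p + q = 1\<close> for the squared norms of the two parts of
      \<open>v n\<close>, the splitting gives
      \<open>(\<Lambda> - \<alpha> 0) * p \<le> \<rho> \<epsilon>\<close>, and \<open>p\<close> is
      at least \<open>\<delta>\<^sup>2 / 4\<close>.\<close>
    have top: "\<Lambda> \<le> \<alpha> 0 + 4 * \<rho> \<epsilon> / \<delta>\<^sup>2"
    proof (cases "\<Lambda> \<le> \<alpha> 0")
      case True
      then show ?thesis using \<rho>0 by (simp add: add_increasing2)
    next
      case False
      let ?p = "(norm (proj N h (v n)))\<^sup>2" let ?q = "(norm (v n - proj N h (v n)))\<^sup>2"
      have pq: "?p + ?q = 1" using Pythagoras_proj[OF h(1), of "v n"] v(1) by simp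
      have "energy ?B (v n - proj N h (v n)) \<le> energy (\<Omega> n) (v n - proj N h (v n))"
        using B by (intro energy_mono \<Omega>_fm) auto
      also have "\<dots> \<le> \<Lambda> * ?q" unfolding \<Lambda>_def by (rule energy_le_esum[OF \<Omega>_fm])
      finally have 1: "energy ?B (v n - proj N h (v n)) \<le> \<Lambda> * ?q" .
      have 2: "qform T (proj N h (v n)) \<le> \<alpha> 0 * ?p"
        by (rule T.spec_top[OF spec]) simp
      have "\<Lambda> \<le> \<alpha> 0 * ?p + \<Lambda> * ?q + \<rho> \<epsilon>"
        using split[rule_format, of "v n"] 1 2 v(1,2)[of n] by (simp add: \<Lambda>_def)
      moreover have "\<Lambda> = \<Lambda> * ?p + \<Lambda> * ?q" using pq by (metis distrib_left mult.right_neutral)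
      ultimately have 3: "(\<Lambda> - \<alpha> 0) * ?p \<le> \<rho> \<epsilon>" by (simp add: algebra_simps)
      \<comment> \<open>Since \<open>0 \<in> C\<close>, the vector \<open>\<pi> 0 \<psi>\<close> is
        nearly fixed by the projection, so at least half of \<open>\<delta>\<close> must come from
        the projection of \<open>v n\<close>.\<close>
      have "\<delta> \<le> cmod (cinner (v n) (proj N h (\<pi> 0 \<psi>))) + cmod (cinner (v n) (\<pi> 0 \<psi> - proj N h (\<pi> 0 \<psi>)))"
        using v(3)[of n] norm_triangle_ineq[of "cinner (v n) (proj N h (\<pi> 0 \<psi>))"
            "cinner (v n) (\<pi> 0 \<psi> - proj N h (\<pi> 0 \<psi>))"]
        by (simp add: wavelet_transform_def cinner_diff_right)
      also have "cmod (cinner (v n) (\<pi> 0 \<psi> - proj N h (\<pi> 0 \<psi>))) \<le> \<epsilon>"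
        using cinner_Cauchy_Schwarz[of "v n" "\<pi> 0 \<psi> - proj N h (\<pi> 0 \<psi>)"] h(2)[OF C(2)] v(1)[of n] by simp
      also have "cmod (cinner (v n) (proj N h (\<pi> 0 \<psi>))) \<le> norm (proj N h (v n))"
        using cinner_Cauchy_Schwarz[of "proj N h (v n)" "\<pi> 0 \<psi>"] by (simp add: cinner_proj_right)
      finally have "\<delta> / 2 \<le> norm (proj N h (v n))" using e(3) by simp
      then have "(\<delta> / 2)\<^sup>2 \<le> ?p" using \<delta> by (intro power_mono) auto
      then have "(\<Lambda> - \<alpha> 0) * (\<delta> / 2)\<^sup>2 \<le> (\<Lambda> - \<alpha> 0) * ?p"
        using False by (intro mult_left_mono) auto
      with 3 have "(\<Lambda> - \<alpha> 0) * (\<delta> / 2)\<^sup>2 \<le> \<rho> \<epsilon>" by simp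
      then show ?thesis using \<delta> by (simp add: field_simps power2_eq_square)
    qed
    obtain f where f: "orthonormal K f" "(\<Sum>i<K. energy (\<Omega> n) (f i)) = esum (\<Omega> n) K"
      by (rule esum_attained[OF \<Omega>_fm])
    obtain b \<beta> where b: "spectral_seq (L ?B) b \<beta>" "\<And>K. esum ?B K = (\<Sum>j<K. \<beta> j)"
      by (rule esum_spectral[OF B]) blast
    have "(\<Sum>i<K. (norm (proj N h (f i)))\<^sup>2) + (\<Sum>i<K. (norm (f i - proj N h (f i)))\<^sup>2) = real K"
      using Pythagoras_proj[OF h(1), symmetric] orthonormal_norm[OF f(1)]
      by (simp flip: sum.distrib)
    from merge_spectra[OF trace_bounded_T spec trace_bounded_L[OF B] b(1)
        Bessel_proj[OF orthonormal_Bessel[OF f(1)] h(1)]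
        Bessel_proj_compl[OF orthonormal_Bessel[OF f(1)] h(1)] this]
    obtain k where k: "k \<le> K" "(\<Sum>i<K. qform T (proj N h (f i))) + (\<Sum>i<K. energy ?B (f i - proj N h (f i)))
        \<le> (\<Sum>j<k. \<alpha> j) + esum ?B (K - k)"
      by (auto simp: qform_L[OF B] b(2))
    have "esum (\<Omega> n) K \<le> (\<Sum>i<K. qform T (proj N h (f i)) + energy ?B (f i - proj N h (f i)) + \<rho> \<epsilon> * (norm (f i))\<^sup>2)"
      unfolding f(2)[symmetric] using split by (intro sum_mono) blast
    also have "\<dots> = (\<Sum>i<K. qform T (proj N h (f i))) + (\<Sum>i<K. energy ?B (f i - proj N h (f i))) + real K * \<rho> \<epsilon>"
      using orthonormal_norm[OF f(1)] by (simp add: sum.distrib)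
    finally have main: "esum (\<Omega> n) K \<le> (\<Sum>j<k. \<alpha> j) + esum ?B (K - k) + real K * \<rho> \<epsilon>"
      using k(2) by simp
    have pos: "0 \<le> 4 * \<rho> \<epsilon> / \<delta>\<^sup>2" using \<rho>0 by simp
    show "\<exists>k. 1 \<le> k \<and> k \<le> K \<and> esum (\<Omega> n) K
      \<le> (\<Sum>j<k. \<alpha> j) + esum (\<Omega> n - C) (K - k) + (real K * \<rho> \<epsilon> + 4 * \<rho> \<epsilon> / \<delta>\<^sup>2)"
    proof (cases "k = 0")
      case False
      then show ?thesis using main pos k(1) by (intro exI[of _ k]) auto
    next
      case True
      \<comment> \<open>The smallest far eigenvalue in the sum is exchanged for
        \<open>\<alpha> 0\<close>: it is at most the top far eigenvalue, hence at most
        \<open>\<Lambda>\<close>.\<close>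
      have "\<beta> (K - 1) \<le> \<beta> 0"
        using b(1) by (auto simp: spectral_seq_def decseq_def)
      also have "\<beta> 0 = esum ?B 1" by (simp add: b(2))
      also have "\<dots> \<le> \<Lambda>" unfolding \<Lambda>_def using B by (intro esum_mono \<Omega>_fm) auto
      finally have "\<beta> (K - 1) \<le> \<alpha> 0 + 4 * \<rho> \<epsilon> / \<delta>\<^sup>2" using top by simp
      moreover have "esum ?B K = esum ?B (K - 1) + \<beta> (K - 1)"
        using K unfolding b(2) by (metis Suc_diff_1 less_eq_Suc_le One_nat_def sum.lessThan_Suc)
      ultimately show ?thesis using main True K by (intro exI[of _ 1]) auto
    qed
  qed
  then show ?thesis using that C by blast
qed

end

section \<open>Optimal sets and their existence by induction on the number of eigenvalues\<close>

context wavelet_setting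
begin

text \<open>Competitors may have smaller measure, while the optimal set has measure exactly
  \<open>m\<close>. Relative compactness is carried through the induction because gluing needs
  it.\<close>

definition optimal :: "nat \<Rightarrow> real \<Rightarrow> 'g set \<Rightarrow> bool" where
  "optimal K m \<Omega> \<longleftrightarrow> relatively_compact \<Omega> \<and> measure M \<Omega> = m \<and>
     (\<forall>\<Omega>'\<in>fmeasurable M. measure M \<Omega>' \<le> m \<longrightarrow> esum \<Omega>' K \<le> esum \<Omega> K)"

text \<open>A bathtub set for the best family of \<open>E\<close> has measure \<open>m\<close> and
  loses at most the excess mass. This is needed because the far parts of \<open>\<Omega> n\<close>
  have mass at most \<open>m - s1\<close> only up to a small error.\<close>

lemma optimal_Lipschitz:
  assumes opt: "optimal K m \<Omega>" and E: "E \<in> fmeasurable M"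
  shows "esum E K \<le> esum \<Omega> K + max 0 (measure M E - m)"
proof (cases "K = 0")
  case False
  have m: "0 \<le> m" using opt by (auto simp: optimal_def)
  obtain f where f: "orthonormal K f" "(\<Sum>i<K. energy E (f i)) = esum E K"
    by (rule esum_attained[OF E])
  obtain \<Omega>' where \<Omega>': "relatively_compact \<Omega>'" "measure M \<Omega>' = m"
    "\<And>E. E \<in> fmeasurable M \<Longrightarrow>
      (\<Sum>i<K. energy E (f i)) \<le> (\<Sum>i<K. energy \<Omega>' (f i)) + max 0 (measure M E - m)"
    by (rule bathtub[OF f(1) _ m]) (use False in auto)
  have \<Omega>'f: "\<Omega>' \<in> fmeasurable M" by (rule relatively_compact_fmeasurable[OF \<Omega>'(1)])
  have "esum E K \<le> esum \<Omega>' K + max 0 (measure M E - m)"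
    using \<Omega>'(3)[OF E] esum_ge[OF \<Omega>'f f(1)] f(2) by simp
  moreover have "esum \<Omega>' K \<le> esum \<Omega> K" using opt \<Omega>'f \<Omega>'(2) by (simp add: optimal_def)
  ultimately show ?thesis by simp
qed simp

lemma esum_translate_eq:
  assumes "\<Omega> \<in> fmeasurable M" shows "esum ((+) y ` \<Omega>) K = esum \<Omega> K"
proof (rule antisym)
  have "(+) (- y) ` (+) y ` \<Omega> = \<Omega>" by (simp add: image_image add.assoc[symmetric])
  then show "esum ((+) y ` \<Omega>) K \<le> esum \<Omega> K"
    using esum_translate[OF translation_fmeasurable[OF assms], of y K "- y"] by simp
qed (rule esum_translate[OF assms])

lemma esum_le_mult:
  assumes \<Omega>: "\<Omega> \<in> fmeasurable M" shows "esum \<Omega> K \<le> real K * esum \<Omega> 1"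
proof -
  obtain e l where l: "spectral_seq (L \<Omega>) e l" "\<And>K. esum \<Omega> K = (\<Sum>j<K. l j)"
    by (rule esum_spectral[OF \<Omega>]) blast
  have "(\<Sum>j<K. l j) \<le> (\<Sum>j<K. l 0)"
    using l(1) by (intro sum_mono) (auto simp: spectral_seq_def decseq_def)
  then show ?thesis by (simp add: l(2))
qed

text \<open>A transform bounded by \<open>\<delta>\<close> everywhere would give the top eigenvector
  energy at most \<open>\<delta>\<^sup>2 * m\<close>. A point where it is larger is moved to
  0.\<close>

lemma centred_translate:
  assumes \<Omega>: "\<Omega> \<in> fmeasurable M" "measure M \<Omega> \<le> m" and \<delta>: "0 < \<delta>" "\<delta>\<^sup>2 * m < esum \<Omega> 1"
  obtains \<Omega>' v where "\<Omega>' \<in> fmeasurable M" "measure M \<Omega>' = measure M \<Omega>" "\<And>K. esum \<Omega>' K = esum \<Omega> K"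
    "norm v = 1" "energy \<Omega>' v = esum \<Omega>' 1" "\<delta> \<le> cmod (W v 0)"
proof -
  obtain f where f: "orthonormal 1 f" "(\<Sum>i<1. energy \<Omega> (f i)) = esum \<Omega> 1"
    by (rule esum_attained[OF \<Omega>(1)])
  have "\<exists>x. \<delta> < cmod (W (f 0) x)"
  proof (rule ccontr)
    assume "\<nexists>x. \<delta> < cmod (W (f 0) x)"
    then have "energy \<Omega> (f 0) \<le> \<delta>\<^sup>2 * measure M \<Omega>" by (intro energy_le \<Omega>) (auto simp: not_less)
    also have "\<dots> \<le> \<delta>\<^sup>2 * m" using \<Omega>(2) by (intro mult_left_mono) auto
    finally show False using \<delta>(2) f(2) by simp
  qed
  then obtain x where x: "\<delta> < cmod (W (f 0) x)" by blast
  have s: "\<Omega> \<in> sets M" using \<Omega>(1) by blast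
  show ?thesis
  proof (rule that[of "(+) (- x) ` \<Omega>" "\<pi> (- x) (f 0)"])
    show "(+) (- x) ` \<Omega> \<in> fmeasurable M" by (rule translation_fmeasurable[OF \<Omega>(1)])
    show "measure M ((+) (- x) ` \<Omega>) = measure M \<Omega>" by (rule measure_translation[OF s])
    show "esum ((+) (- x) ` \<Omega>) K = esum \<Omega> K" for K by (rule esum_translate_eq[OF \<Omega>(1)])
    show "norm (\<pi> (- x) (f 0)) = 1" using orthonormal_norm[OF f(1)] by (simp add: rep_norm)
    show "energy ((+) (- x) ` \<Omega>) (\<pi> (- x) (f 0)) = esum ((+) (- x) ` \<Omega>) 1"
      using f(2) by (simp add: energy_translate[OF s] esum_translate_eq[OF \<Omega>(1)])
    show "\<delta> \<le> cmod (W (\<pi> (- x) (f 0)) 0)"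
      using x cmod_W_translate[of "- x" "f 0" x] by simp
  qed
qed

text \<open>One application of Tychonoff's theorem, with the disjoint sum of pairs of vectors and
  subsets as index type, makes all forms and all masses converge along the same filter.\<close>

lemma concentration_limit:
  assumes \<Omega>: "\<And>n. \<Omega> n \<in> fmeasurable M" "\<And>n::nat. measure M (\<Omega> n) \<le> m"
  obtains F T c where "concentration M \<omega> \<pi> \<psi> \<Omega> F T c m" "F \<le> sequentially"
proof -
  have m: "0 \<le> m" using \<Omega>(2)[of 0] measure_nonneg order_trans by blast
  define X where "X n i = (case i of Inl (f, g) \<Rightarrow> loc_form (\<Omega> n) f g
      | Inr C \<Rightarrow> complex_of_real (measure M (\<Omega> n \<inter> C)))" for n and i :: "('h \<times> 'h) + 'g set"
  define B where "B i = (case i of Inl (f, g) \<Rightarrow> norm f * norm g * m | Inr C \<Rightarrow> m)"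
    for i :: "('h \<times> 'h) + 'g set"
  have form_le: "cmod (loc_form (\<Omega> n) f g) \<le> norm f * norm g * m" for n f g
    using loc_form_bound[OF \<Omega>(1)[of n] W_le W_le norm_ge_zero, of f g]
      mult_left_mono[OF \<Omega>(2)[of n], of "norm f * norm g"] by simp
  \<comment> \<open>\<open>C\<close> ranges over arbitrary subsets; when the intersection is not
    measurable, its \<open>measure\<close> is 0.\<close>
  have "measure M (\<Omega> n \<inter> C) \<le> m" for n C
  proof (cases "\<Omega> n \<inter> C \<in> sets M")
    case True
    then show ?thesis
      using measure_mono_fmeasurable[of "\<Omega> n \<inter> C" "\<Omega> n" M] \<Omega>(1)[of n] \<Omega>(2)[of n] by force
  next
    case False
    then show ?thesis using m by (simp add: measure_notin_sets)
  qed
  then have bnd: "cmod (X n i) \<le> B i" for n i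
    using form_le by (auto simp: X_def B_def split: sum.split)
  obtain F where F: "F \<noteq> bot" "F \<le> sequentially" "\<And>i. \<exists>l. ((\<lambda>n. X n i) \<longlongrightarrow> l) F"
    by (rule bounded_family_convergent_filter[of sequentially X B, OF _ bnd]) (simp, blast)
  have "\<exists>l. ((\<lambda>n. loc_form (\<Omega> n) f g) \<longlongrightarrow> l) F" for f g
    using F(3)[of "Inl (f, g)"] by (simp add: X_def)
  then obtain t where t: "\<And>f g. ((\<lambda>n. loc_form (\<Omega> n) f g) \<longlongrightarrow> t f g) F" by metis
  have "\<exists>l::real. ((\<lambda>n. measure M (\<Omega> n \<inter> C)) \<longlongrightarrow> l) F" for C
  proof -
    obtain l where "((\<lambda>n. complex_of_real (measure M (\<Omega> n \<inter> C))) \<longlongrightarrow> l) F"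
      using F(3)[of "Inr C"] by (auto simp: X_def)
    from tendsto_Re[OF this] show ?thesis by auto
  qed
  then obtain c where c: "\<And>C. ((\<lambda>n. measure M (\<Omega> n \<inter> C)) \<longlongrightarrow> c C) F" by metis
  obtain T where T: "\<And>f g. cinner (T f) g = t f g"
  proof (rule bounded_sesquilinear_operator[of t m])
    show "t (x + y) g = t x g + t y g" for x y g
    proof (rule tendsto_unique[OF F(1) t])
      have "loc_form (\<Omega> n) (x + y) g = loc_form (\<Omega> n) x g + loc_form (\<Omega> n) y g" for n
        unfolding cinner_L[OF \<Omega>(1), symmetric] trace_bounded.T_add[OF trace_bounded_L[OF \<Omega>(1)]] cinner_add_left ..
      then show "((\<lambda>n. loc_form (\<Omega> n) (x + y) g) \<longlongrightarrow> t x g + t y g) F"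
        using tendsto_add[OF t t] by simp
    qed
    show "t (a *\<^sub>C x) g = a * t x g" for a x g
    proof (rule tendsto_unique[OF F(1) t])
      have "loc_form (\<Omega> n) (a *\<^sub>C x) g = a * loc_form (\<Omega> n) x g" for n
        unfolding cinner_L[OF \<Omega>(1), symmetric] trace_bounded.T_scaleC[OF trace_bounded_L[OF \<Omega>(1)]] cinner_scaleC_left ..
      then show "((\<lambda>n. loc_form (\<Omega> n) (a *\<^sub>C x) g) \<longlongrightarrow> a * t x g) F"
        using tendsto_mult_left[OF t] by simp
    qed
    show "t f g = cnj (t g f)" for f g
      by (rule tendsto_unique[OF F(1) t]) (use tendsto_cnj[OF t[of g f]] in \<open>simp add: cnj_loc_form\<close>)
    show "cmod (t f g) \<le> m * norm f * norm g" for f g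
      by (rule tendsto_upperbound[OF tendsto_norm[OF t] _ F(1)]) (use form_le in \<open>simp add: mult_ac\<close>)
  qed blast
  have "concentration M \<omega> \<pi> \<psi> \<Omega> F T c m"
    by unfold_locales (use \<Omega> F t c T in auto)
  then show ?thesis using F(2) that by blast
qed

text \<open>The claim is made for every \<open>m \<ge> 0\<close>, including 0, because the induction
  passes to \<open>m - s1\<close>, which may vanish.\<close>

theorem optimal_exists: "0 \<le> m \<Longrightarrow> \<exists>\<Omega>. optimal K m \<Omega>"
proof (induction K arbitrary: m rule: less_induct)
  case (less K)
  note m = less.prems
  define \<Lambda> where "\<Lambda> = (SUP \<Omega>\<in>{\<Omega> \<in> fmeasurable M. measure M \<Omega> \<le> m}. esum \<Omega> K)"
  have bdd: "bdd_above ((\<lambda>\<Omega>. esum \<Omega> K) ` {\<Omega> \<in> fmeasurable M. measure M \<Omega> \<le> m})"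
    using esum_le_measure by (intro bdd_aboveI2[of _ _ m]) (auto intro: order_trans)
  have ne: "{\<Omega> \<in> fmeasurable M. measure M \<Omega> \<le> m} \<noteq> {}" using m by (auto intro: exI[of _ "{}"])
  have \<Lambda>: "esum \<Omega> K \<le> \<Lambda>" if "\<Omega> \<in> fmeasurable M" "measure M \<Omega> \<le> m" for \<Omega>
    unfolding \<Lambda>_def by (rule cSUP_upper[OF _ bdd]) (use that in simp)
  have suff: "\<exists>\<Omega>. optimal K m \<Omega>" if "relatively_compact \<Omega>" "measure M \<Omega> = m" "\<Lambda> \<le> esum \<Omega> K" for \<Omega>
    using that \<Lambda> unfolding optimal_def by (intro exI[of _ \<Omega>]) (auto intro: order_trans)
  show ?case
  \<comment> \<open>The cases \<open>K = 0\<close> and \<open>m = 0\<close> fall under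
    \<open>\<Lambda> \<le> 0\<close>, where every relatively compact set of measure \<open>m\<close>
    will do.\<close>
  proof (cases "\<Lambda> \<le> 0")
    case True
    obtain \<Omega> where \<Omega>: "relatively_compact \<Omega>" "measure M \<Omega> = m" by (rule relatively_compact_of_measure[OF m])
    then show ?thesis
      using True esum_nonneg[OF relatively_compact_fmeasurable[OF \<Omega>(1)], of K] by (intro suff[OF \<Omega>]) simp
  next
    case False
    then have \<Lambda>pos: "\<Lambda> > 0" by simp
    have K: "K \<ge> 1"
    proof (rule ccontr)
      assume "\<not> K \<ge> 1"
      then have "\<Lambda> = 0" unfolding \<Lambda>_def using ne by (simp add: not_less_eq_eq)
      then show False using \<Lambda>pos by simp
    qed
    \<comment> \<open>In the maximising sequence below, the offset 2 in
      \<open>\<Lambda> / (real n + 2)\<close> keeps every value of \<open>esum\<close> for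
      \<open>K\<close> above \<open>\<Lambda> / 2\<close>, so every top eigenvalue exceeds
      \<open>\<Lambda> / (2 * real K)\<close>. This \<open>\<delta>\<close> puts
      \<open>\<delta>\<^sup>2 * m\<close> below that; \<open>m + 1\<close> avoids dividing by
      \<open>m\<close>.\<close>
    define \<delta> where "\<delta> = sqrt (\<Lambda> / (4 * real K * (m + 1)))"
    have \<delta>: "\<delta> > 0" "\<delta>\<^sup>2 = \<Lambda> / (4 * real K * (m + 1))"
      unfolding \<delta>_def using \<Lambda>pos K m by auto
    have "\<exists>\<Omega>' v. \<Omega>' \<in> fmeasurable M \<and> measure M \<Omega>' \<le> m \<and> \<Lambda> - \<Lambda> / (real n + 2) < esum \<Omega>' K \<and>
      norm v = 1 \<and> energy \<Omega>' v = esum \<Omega>' 1 \<and> \<delta> \<le> cmod (W v 0)" for n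
    proof -
      have "\<Lambda> - \<Lambda> / (real n + 2) < \<Lambda>" using \<Lambda>pos by simp
      then obtain \<Omega> where \<Omega>: "\<Omega> \<in> fmeasurable M" "measure M \<Omega> \<le> m" "\<Lambda> - \<Lambda> / (real n + 2) < esum \<Omega> K"
        using less_cSUP_iff[OF ne bdd, of "\<Lambda> - \<Lambda> / (real n + 2)"] unfolding \<Lambda>_def by blast
      have "\<Lambda> / (real n + 2) \<le> \<Lambda> / 2" using \<Lambda>pos by (intro divide_left_mono) auto
      then have "\<Lambda> / 2 < real K * esum \<Omega> 1" using \<Omega>(3) esum_le_mult[OF \<Omega>(1), of K] by simp
      then have "\<Lambda> / (2 * real K) < esum \<Omega> 1" using K by (simp add: field_simps)
      moreover have "\<delta>\<^sup>2 * m \<le> \<Lambda> / (2 * real K)"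
      proof -
        have "\<delta>\<^sup>2 * m \<le> \<delta>\<^sup>2 * (m + 1)" by (intro mult_left_mono) auto
        also have "\<dots> = \<Lambda> / (4 * real K)" using m by (simp add: \<delta>(2))
        also have "\<dots> \<le> \<Lambda> / (2 * real K)" using \<Lambda>pos K by (intro divide_left_mono) auto
        finally show ?thesis .
      qed
      ultimately have "\<delta>\<^sup>2 * m < esum \<Omega> 1" by simp
      from centred_translate[OF \<Omega>(1,2) \<delta>(1) this] show ?thesis using \<Omega> by metis
    qed
    then obtain \<Omega> v where \<Omega>: "\<And>n. \<Omega> n \<in> fmeasurable M" "\<And>n. measure M (\<Omega> n) \<le> m"
      "\<And>n. \<Lambda> - \<Lambda> / (real n + 2) < esum (\<Omega> n) K"
      and v: "\<And>n. norm (v n) = 1" "\<And>n. energy (\<Omega> n) (v n) = esum (\<Omega> n) 1" "\<And>n. \<delta> \<le> cmod (W (v n) 0)"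
      by metis
    obtain F T c where conc: "concentration M \<omega> \<pi> \<psi> \<Omega> F T c m" and Fseq: "F \<le> sequentially"
      by (rule concentration_limit[OF \<Omega>(1,2)])
    interpret C: concentration M \<omega> \<pi> \<psi> \<Omega> F T c m by (rule conc)
    obtain a \<alpha> where spec: "spectral_seq T a \<alpha>" by (rule C.T.spectral_seq_exists[OF inf_dim])
    have "\<exists>\<Omega>2 \<Omega>'. relatively_compact \<Omega>' \<and> measure M \<Omega>' = m \<and> optimal (K - k) (m - C.s1) \<Omega>2
        \<and> (\<Sum>j<k. \<alpha> j) + esum \<Omega>2 (K - k) \<le> esum \<Omega>' K" if k: "k \<in> {1..K}" for k
    proof -
      obtain \<Omega>1 where \<Omega>1: "relatively_compact \<Omega>1" "measure M \<Omega>1 = C.s1" "(\<Sum>j<k. \<alpha> j) \<le> esum \<Omega>1 k"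
        by (rule C.spectrum_le_bathtub[OF spec]) (use k in auto)
      obtain \<Omega>2 where \<Omega>2: "optimal (K - k) (m - C.s1) \<Omega>2"
        using less.IH[of "K - k" "m - C.s1"] k C.s1_le by auto
      then have "relatively_compact \<Omega>2" by (simp add: optimal_def)
      then obtain \<Omega>' where "relatively_compact \<Omega>'" "measure M \<Omega>' = measure M \<Omega>1 + measure M \<Omega>2"
        "esum \<Omega>1 k + esum \<Omega>2 (K - k) \<le> esum \<Omega>' (k + (K - k))"
        by (rule glue[OF \<Omega>1(1)])
      then show ?thesis using \<Omega>1 \<Omega>2 k by (intro exI[of _ \<Omega>2] exI[of _ \<Omega>']) (auto simp: optimal_def)
    qed
    then obtain \<Omega>2 \<Omega>' where opt: "\<And>k. k \<in> {1..K} \<Longrightarrow> relatively_compact (\<Omega>' k)"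
      "\<And>k. k \<in> {1..K} \<Longrightarrow> measure M (\<Omega>' k) = m"
      "\<And>k. k \<in> {1..K} \<Longrightarrow> optimal (K - k) (m - C.s1) (\<Omega>2 k)"
      "\<And>k. k \<in> {1..K} \<Longrightarrow> (\<Sum>j<k. \<alpha> j) + esum (\<Omega>2 k) (K - k) \<le> esum (\<Omega>' k) K"
      by metis
    \<comment> \<open>The \<open>k\<close> of the upper estimate may depend on \<open>n\<close> and
      \<open>\<epsilon>\<close>, so one glued set is prepared for every \<open>k\<close>, and the
      best of these finitely many sets serves for all.\<close>
    have "Max ((\<lambda>k. esum (\<Omega>' k) K) ` {1..K}) \<in> (\<lambda>k. esum (\<Omega>' k) K) ` {1..K}"
      by (rule Max_in) (use K in auto)
    then obtain k0 where k0in: "k0 \<in> {1..K}" and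
      k0eq: "Max ((\<lambda>k. esum (\<Omega>' k) K) ` {1..K}) = esum (\<Omega>' k0) K" by (rule imageE)
    have k0: "k0 \<in> {1..K}" "\<And>k. k \<in> {1..K} \<Longrightarrow> esum (\<Omega>' k) K \<le> esum (\<Omega>' k0) K"
      unfolding k0eq[symmetric] by (rule k0in, rule Max_ge) auto
    \<comment> \<open>The first term pays for far mass in excess of \<open>m - s1\<close>; the rest
      is the error of \<open>upper_estimate\<close>.\<close>
    define \<eta> where "\<eta> \<epsilon> = 2 * \<epsilon> + (real K * C.\<rho> \<epsilon> + 4 * C.\<rho> \<epsilon> / \<delta>\<^sup>2)" for \<epsilon>
    have est: "\<Lambda> \<le> esum (\<Omega>' k0) K + \<eta> \<epsilon>" if e: "0 < \<epsilon>" "\<epsilon> \<le> 1" "\<epsilon> \<le> \<delta> / 2" for \<epsilon>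
    proof -
      obtain C where C: "compact C" "C.s1 - \<epsilon> < c C"
        "\<forall>\<^sub>F n in F. \<exists>k. 1 \<le> k \<and> k \<le> K \<and> esum (\<Omega> n) K
          \<le> (\<Sum>j<k. \<alpha> j) + esum (\<Omega> n - C) (K - k) + (real K * C.\<rho> \<epsilon> + 4 * C.\<rho> \<epsilon> / \<delta>\<^sup>2)"
        by (rule C.upper_estimate[OF spec K v e])
      have near: "\<forall>\<^sub>F n in F. C.s1 - 2 * \<epsilon> < measure M (\<Omega> n \<inter> C)"
        by (rule order_tendstoD(1)[OF C.c_lim]) (use C(2) e in simp)
      have "\<forall>\<^sub>F n in F. \<Lambda> - \<Lambda> / (real n + 2) \<le> esum (\<Omega>' k0) K + \<eta> \<epsilon>"
        using C(3) near
      proof eventually_elim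
        case (elim n)
        then obtain k where k: "k \<in> {1..K}" "esum (\<Omega> n) K
          \<le> (\<Sum>j<k. \<alpha> j) + esum (\<Omega> n - C) (K - k) + (real K * C.\<rho> \<epsilon> + 4 * C.\<rho> \<epsilon> / \<delta>\<^sup>2)"
          by auto
        have "measure M (\<Omega> n - C) - (m - C.s1) \<le> 2 * \<epsilon>"
          using elim(2) C.measure_Diff_eq[OF C(1), of n] \<Omega>(2)[of n] by simp
        then have "esum (\<Omega> n - C) (K - k) \<le> esum (\<Omega>2 k) (K - k) + 2 * \<epsilon>"
          using optimal_Lipschitz[OF opt(3)[OF k(1)] C.Diff_fm[OF C(1), of n]] e(1) by (simp add: max_def split: if_splits)
        then show ?case
          using k(2) opt(4)[OF k(1)] k0(2)[OF k(1)] \<Omega>(3)[of n] by (simp add: \<eta>_def)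
      qed
      moreover have "((\<lambda>n. \<Lambda> - \<Lambda> / (real n + 2)) \<longlongrightarrow> \<Lambda> - 0) F"
      proof (rule tendsto_mono[OF Fseq])
        have "filterlim (\<lambda>n. real n + 2) at_top sequentially"
          by (rule filterlim_tendsto_add_at_top[OF tendsto_const filterlim_real_sequentially, of 2, simplified add.commute])
        then show "(\<lambda>n. \<Lambda> - \<Lambda> / (real n + 2)) \<longlonglongrightarrow> \<Lambda> - 0"
          by (intro tendsto_diff tendsto_const tendsto_divide_0[OF tendsto_const] filterlim_at_top_imp_at_infinity)
      qed
      ultimately have "\<Lambda> - 0 \<le> esum (\<Omega>' k0) K + \<eta> \<epsilon>"
        by (intro tendsto_upperbound[OF _ _ C.F])
      then show ?thesis by simp
    qed
    have "((\<lambda>\<epsilon>. esum (\<Omega>' k0) K + \<eta> \<epsilon>) \<longlongrightarrow> esum (\<Omega>' k0) K + (2 * 0 + (real K * 0 + 4 * 0 / \<delta>\<^sup>2))) (at_right 0)"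
      unfolding \<eta>_def by (intro tendsto_intros C.\<rho>_tendsto) (use \<delta>(1) in auto)
    moreover have "\<forall>\<^sub>F \<epsilon> in at_right 0. \<Lambda> \<le> esum (\<Omega>' k0) K + \<eta> \<epsilon>"
      unfolding eventually_at_right_field
      by (rule exI[of _ "min 1 (\<delta> / 2)"]) (use \<delta>(1) est in auto)
    ultimately have "\<Lambda> \<le> esum (\<Omega>' k0) K + (2 * 0 + (real K * 0 + 4 * 0 / \<delta>\<^sup>2))"
      by (intro tendsto_lowerbound[of _ _ "at_right (0::real)"]) auto
    then show ?thesis by (intro suff[OF opt(1,2)[OF k0(1)]]) simp
  qed
qed

end

theorem theorem5p5:
  fixes M :: "'g::{topological_group_add, t2_space} measure"
    and \<omega> :: "'g \<Rightarrow> 'g \<Rightarrow> complex"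
    and \<pi> :: "'g \<Rightarrow> 'h::complex_hilbert_space \<Rightarrow> 'h"
    and \<psi> :: 'h
    and K :: nat
    and s :: real
  assumes "locally compact (UNIV :: 'g set)"
    and "\<not> compact (UNIV :: 'g set)"
    and "left_haar_measure M"
    and "projective_unitary_rep \<omega> \<pi>"
    and "strongly_continuous_rep \<pi>"
    and "irreducible_rep \<pi>"
    and "square_integrable_rep M \<pi>"
    and "infinite_dimensional TYPE('h)"
    and "admissible_wavelet M \<pi> \<psi>"
    and "wavelet_constant M \<pi> \<psi> = 1"
    and "\<And>\<Omega> f. \<Omega> \<in> sets M \<Longrightarrow> emeasure M \<Omega> > 0 \<Longrightarrow> f \<noteq> 0 \<Longrightarrow>
           (\<integral>\<^sup>+ x\<in>\<Omega>. ennreal ((cmod (wavelet_transform \<pi> \<psi> f x))\<^sup>2) \<partial>M) > 0"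
    and "K \<ge> 1"
    and "s > 0"
  shows "bdd_above ((\<lambda>\<Omega>. \<Sum>k=1..K. loc_eigenvalue M \<pi> \<psi> \<Omega> k) `
             {\<Omega> \<in> sets M. emeasure M \<Omega> = ennreal s}) \<and>
         (\<exists>\<Omega>\<in>{\<Omega> \<in> sets M. emeasure M \<Omega> = ennreal s}.
            (\<Sum>k=1..K. loc_eigenvalue M \<pi> \<psi> \<Omega> k) =
            (SUP \<Omega>'\<in>{\<Omega> \<in> sets M. emeasure M \<Omega> = ennreal s}.
               \<Sum>k=1..K. loc_eigenvalue M \<pi> \<psi> \<Omega>' k))"
proof -
  interpret wavelet_setting M \<omega> \<pi> \<psi>
    by unfold_locales (use assms in blast)+
  let ?S = "{\<Omega> \<in> sets M. emeasure M \<Omega> = ennreal s}"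
  let ?e = "\<lambda>\<Omega>. \<Sum>k=1..K. loc_eigenvalue M \<pi> \<psi> \<Omega> k"
  obtain \<Omega> where opt: "optimal K s \<Omega>" using optimal_exists[of s K] \<open>s > 0\<close> by auto
  have S: "\<Omega>' \<in> fmeasurable M \<and> measure M \<Omega>' = s" if "\<Omega>' \<in> ?S" for \<Omega>'
    using that \<open>s > 0\<close> by (auto simp: fmeasurable_def measure_def)
  have \<Omega>: "\<Omega> \<in> ?S"
    using opt relatively_compact_fmeasurable[of \<Omega>]
    by (auto simp: optimal_def emeasure_eq_measure2)
  \<comment> \<open>\<open>optimal\<close> covers all competitors of measure at most
    \<open>s\<close>, in particular those of measure exactly \<open>s\<close>.\<close>
  have le: "?e \<Omega>' \<le> ?e \<Omega>" if "\<Omega>' \<in> ?S" for \<Omega>'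
    using S[OF that] opt unfolding optimal_def esum_def by blast
  have bdd: "bdd_above (?e ` ?S)"
    using le by (rule bdd_aboveI2)
  have "?e \<Omega> = (SUP \<Omega>'\<in>?S. ?e \<Omega>')"
    using \<Omega> le bdd by (intro antisym cSUP_upper cSUP_least) auto
  then show ?thesis using bdd \<Omega> by blast
qed

end
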